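(* Let $T_\theta^{(\nu)}$ denote the self-adjoint realizations of the Bessel expression $-\frac{d^2}{dx^2}+\frac{\nu^2-1/4}{x^2}$ on $(0,\infty)$ defined in the context. If $\nu\in(0,1)$, $\theta\in(0,\pi)$, and $z\in\rho\big(T_0^{(\nu)}\big)\cap\rho\big(T_\theta^{(\nu)}\big)$, then $$\big(T_\theta^{(\nu)}-zI\big)^{-1}-\big(T_0^{(\nu)}-zI\big)^{-1}=\left[\cot(\theta)+\frac{\Gamma(1-\nu)e^{-i\nu\pi}}{\Gamma(1+\nu)2^{2\nu+1}\nu}z^\nu\right]^{-1}\langle w_{\overline z,\nu},\,\cdot\,\rangle\,w_{z,\nu},$$ where $$w_{z,\nu}(x)=\frac{i\,\Gamma(1-\nu)\sin(\nu\pi)z^{\nu/2}}{2^{\nu+1}\nu}\,x^{1/2}H_\nu^{(1)}\big(z^{1/2}x\big),\qquad x\in(0,\infty).$$ In particular, $\big(T_\theta^{(\nu)}-zI\big)^{-1}-\big(T_0^{(\nu)}-zI\big)^{-1}$ is trace class on $L^2((0,\infty);dx)$, and $$\operatorname{tr}\Big(\big(T_\theta^{(\nu)}-zI\big)^{-1}-\big(T_0^{(\nu)}-zI\big)^{-1}\Big)=\left[\cot(\theta)+\frac{\Gamma(1-\nu)e^{-i\nu\pi}}{\Gamma(1+\nu)2^{2\nu+1}\nu}z^\nu\right]^{-1}\langle w_{\overline z,\nu},w_{z,\nu}\rangle=-\frac{\Gamma(1-\nu)\,\nu\, e^{-i\nu\pi}z^{\nu-1}}{\Gamma(1+\nu)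2^{2\nu+1}\nu\cot(\theta)+\Gamma(1-\nu)e^{-i\nu\pi}z^\nu}.$$
   Context: $I$, $\langle\cdot,\cdot\rangle$ (linear in the second argument) are the identity and inner product in $L^2((0,\infty);dx)$. $\mathfrak D(0,\infty)$ is the set of $f\in AC_{\mathrm{loc}}(0,\infty)$ with $f'\in AC_{\mathrm{loc}}(0,\infty)$, and $\tau_\nu f=-f''+\frac{\nu^2-1/4}{x^2}f$. The maximal operator $T_{\max}^{(\nu)}$ acts as $\tau_\nu$ on $\{g\in\mathfrak D(0,\infty): g,\tau_\nu g\in L^2((0,\infty);dx)\}$, and $T_{\min}^{(\nu)}=(T_{\max}^{(\nu)})^*$. Write $[f,g](x)=f(x)\overline{g'(x)}-f'(x)\overline{g(x)}$ and $[f,g](0)=\lim_{x\downarrow0}[f,g](x)$, which exists for $f,g\in\operatorname{dom}(T_{\max}^{(\nu)})$. For $\nu\in(0,1)$ fix real-valued $\phi_{0,\nu},\psi_{0,\nu}\in\operatorname{dom}(T_{\max}^{(\nu)})$ vanishing in a neighborhood of $\infty$ with $\phi_{0,\nu}(x)=x^{\frac12+\nu}$ and $\psi_{0,\nu}(x)=\frac1{2\nu}x^{\frac12-\nu}$ for $x\in(0,1)$. For $\theta\in[0,\pi)$, $T_\theta^{(\nu)}$ is the restriction of $T_{\max}^{(\nu)}$ to $$\{g\in\operatorname{dom}(T_{\max}^{(\nu)}):\cos(\theta)[g,\phi_{0,\nu}](0)+\sin(\theta)[g,\psi_{0,\nu}](0)=0\}.$$ These are known to be exactly the self-adjoint extensions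 of $T_{\min}^{(\nu)}$; $T_0^{(\nu)}$ is the Friedrichs extension and $\sigma(T_0^{(\nu)})=[0,\infty)$. $H_\nu^{(1)}=J_\nu+iY_\nu$ is the Hankel function of the first kind. Complex powers use the branch $\arg(z)\in[0,2\pi)$: $z^{\pm\beta}=|z|^{\pm\beta}e^{\pm i\beta\arg(z)}$ for $z\ne0$; in particular $\operatorname{Im}(z^{1/2})\ge0$. *)

theory Defs
  imports "HOL-Analysis.Analysis"
begin

section \<open>The Hilbert space of square-integrable functions on the half-line\<close>

abbreviation half_line :: "real measure" where
  "half_line \<equiv> lebesgue_on {0<..}"

definition square_integrable :: "(real \<Rightarrow> complex) \<Rightarrow> bool" where
  "square_integrable f \<longleftrightarrow>
     f \<in> borel_measurable half_line \<and> integrable half_line (\<lambda>x. (cmod (f x))\<^sup>2)"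

definition l2_rel :: "(real \<Rightarrow> complex) \<Rightarrow> (real \<Rightarrow> complex) \<Rightarrow> bool" where
  "l2_rel f g \<longleftrightarrow> square_integrable f \<and> square_integrable g \<and> (AE x in half_line. f x = g x)"

lemma square_integrable_zero: "square_integrable (\<lambda>x. 0)"
  by (simp add: square_integrable_def)

lemma square_integrable_mult_integrable:
  assumes f: "square_integrable f" and g: "square_integrable g"
  shows "integrable half_line (\<lambda>x. cnj (f x) * g x)"
proof (rule Bochner_Integration.integrable_bound)
  show "integrable half_line (\<lambda>x. (cmod (f x))\<^sup>2 + (cmod (g x))\<^sup>2)"
    using f g by (simp add: square_integrable_def)
  have m: "f \<in> borel_measurable half_line" "g \<in> borel_measurable half_line"
    using f g by (simp_all add: square_integrable_def)
  have "(\<lambda>x. cnj (f x)) \<in> borel_measurable half_line"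
    using borel_measurable_continuous_on [OF continuous_on_cnj [OF continuous_on_id] m(1)] .
  then show "(\<lambda>x. cnj (f x) * g x) \<in> borel_measurable half_line"
    using m(2) by (rule borel_measurable_times)
  have "cmod a * cmod b \<le> (cmod a)\<^sup>2 + (cmod b)\<^sup>2" for a b :: complex
  proof -
    have "0 \<le> cmod a * cmod b" by simp
    then show ?thesis using sum_squares_bound [of "cmod a" "cmod b"] by linarith
  qed
  then show "AE x in half_line. norm (cnj (f x) * g x) \<le> norm ((cmod (f x))\<^sup>2 + (cmod (g x))\<^sup>2)"
    by (simp add: norm_mult)
qed

lemma square_integrable_add:
  assumes f: "square_integrable f" and g: "square_integrable g"
  shows "square_integrable (\<lambda>x. f x + g x)"
  unfolding square_integrable_def
proof
  show m: "(\<lambda>x. f x + g x) \<in> borel_measurable half_line"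
    using f g by (auto simp: square_integrable_def intro: borel_measurable_add)
  show "integrable half_line (\<lambda>x. (cmod (f x + g x))\<^sup>2)"
  proof (rule Bochner_Integration.integrable_bound)
    show "integrable half_line (\<lambda>x. 2 * ((cmod (f x))\<^sup>2 + (cmod (g x))\<^sup>2))"
      using f g by (simp add: square_integrable_def)
    show "(\<lambda>x. (cmod (f x + g x))\<^sup>2) \<in> borel_measurable half_line"
      using m by measurable
    have "(cmod (a + b))\<^sup>2 \<le> 2 * ((cmod a)\<^sup>2 + (cmod b)\<^sup>2)" for a b :: complex
    proof -
      have "(cmod (a + b))\<^sup>2 \<le> (cmod a + cmod b)\<^sup>2"
        by (intro power_mono norm_triangle_ineq) simp
      also have "\<dots> \<le> 2 * ((cmod a)\<^sup>2 + (cmod b)\<^sup>2)"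
        using sum_squares_bound [of "cmod a" "cmod b"] by (simp add: power2_sum)
      finally show ?thesis .
    qed
    then show "AE x in half_line. norm ((cmod (f x + g x))\<^sup>2)
        \<le> norm (2 * ((cmod (f x))\<^sup>2 + (cmod (g x))\<^sup>2))"
      by simp
  qed
qed

lemma square_integrable_scale:
  "square_integrable f \<Longrightarrow> square_integrable (\<lambda>x. c * f x)"
  by (auto simp: square_integrable_def norm_mult power_mult_distrib intro: borel_measurable_times)

quotient_type l2 = "real \<Rightarrow> complex" / partial: l2_rel
proof (rule part_equivpI)
  show "\<exists>f. l2_rel f f"
    using square_integrable_zero by (auto simp: l2_rel_def)
  show "symp l2_rel"
    by (rule sympI) (auto simp: l2_rel_def elim: AE_mp)
  show "transp l2_rel"
    by (rule transpI) (auto simp: l2_rel_def elim: AE_mp)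
qed

lift_definition scaleC :: "complex \<Rightarrow> l2 \<Rightarrow> l2" is "\<lambda>c f x. c * f x"
  by (auto simp: l2_rel_def intro: square_integrable_scale elim: AE_mp)

text \<open>The inner product is linear in its \<^emph>\<open>second\<close> argument.\<close>

lift_definition cinner :: "l2 \<Rightarrow> l2 \<Rightarrow> complex" is
  "\<lambda>f g. integral\<^sup>L half_line (\<lambda>x. cnj (f x) * g x)"
proof -
  fix f f' g g'
  assume "l2_rel f f'" "l2_rel g g'"
  then have m: "square_integrable f" "square_integrable f'" "square_integrable g" "square_integrable g'"
    and e: "AE x in half_line. f x = f' x" "AE x in half_line. g x = g' x"
    by (auto simp: l2_rel_def)
  show "integral\<^sup>L half_line (\<lambda>x. cnj (f x) * g x) = integral\<^sup>L half_line (\<lambda>x. cnj (f' x) * g' x)"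
  proof (rule integral_cong_AE)
    show "AE x in half_line. cnj (f x) * g x = cnj (f' x) * g' x"
      using e by eventually_elim simp
  qed (use m square_integrable_mult_integrable borel_measurable_integrable in blast)+
qed

instantiation l2 :: real_inner
begin

lift_definition zero_l2 :: l2 is "\<lambda>x. 0"
  by (simp add: l2_rel_def square_integrable_zero)

lift_definition plus_l2 :: "l2 \<Rightarrow> l2 \<Rightarrow> l2" is "\<lambda>f g x. f x + g x"
  by (auto simp: l2_rel_def intro: square_integrable_add elim!: AE_mp)

definition uminus_l2 :: "l2 \<Rightarrow> l2" where "uminus_l2 u = scaleC (-1) u"
definition minus_l2 :: "l2 \<Rightarrow> l2 \<Rightarrow> l2" where "minus_l2 u v = u + scaleC (-1) v"
definition scaleR_l2 :: "real \<Rightarrow> l2 \<Rightarrow> l2" where "scaleR_l2 r u = scaleC (complex_of_real r) u"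
definition inner_l2 :: "l2 \<Rightarrow> l2 \<Rightarrow> real" where "inner_l2 u v = Re (cinner u v)"
definition norm_l2 :: "l2 \<Rightarrow> real" where "norm_l2 u = sqrt (inner u u)"
definition sgn_l2 :: "l2 \<Rightarrow> l2" where "sgn_l2 u = scaleR (inverse (norm u)) u"
definition dist_l2 :: "l2 \<Rightarrow> l2 \<Rightarrow> real" where "dist_l2 u v = norm (u - v)"
definition uniformity_l2 :: "(l2 \<times> l2) filter" where
  "uniformity_l2 = (INF e\<in>{0<..}. principal {(u, v). dist u v < e})"
definition open_l2 :: "l2 set \<Rightarrow> bool" where
  "open_l2 U \<longleftrightarrow> (\<forall>u\<in>U. eventually (\<lambda>(u', v). u' = u \<longrightarrow> v \<in> U) uniformity)"

instance
proof
  fix u v w :: l2 and r s :: real and U :: "l2 set"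
  have rel: "l2_rel f g" if "l2_rel f f" "f = g" for f g
    using that by simp
  show "u + v + w = u + (v + w)"
    by transfer (auto simp: add.assoc l2_rel_def intro!: square_integrable_add)
  show "u + v = v + u"
    by transfer (auto simp: add.commute l2_rel_def intro!: square_integrable_add)
  show "0 + u = u"
    by transfer (auto simp: l2_rel_def)
  show "- u + u = 0"
    unfolding uminus_l2_def
    by transfer (auto simp: l2_rel_def square_integrable_zero)
  show "u - v = u + - v"
    by (simp add: minus_l2_def uminus_l2_def)
  show "r *\<^sub>R (u + v) = r *\<^sub>R u + r *\<^sub>R v"
    unfolding scaleR_l2_def
    by transfer (auto simp: l2_rel_def distrib_left intro!: square_integrable_add square_integrable_scale)
  show "(r + s) *\<^sub>R u = r *\<^sub>R u + s *\<^sub>R u"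
    unfolding scaleR_l2_def
    by transfer (auto simp: l2_rel_def distrib_right intro!: square_integrable_add square_integrable_scale)
  show "r *\<^sub>R s *\<^sub>R u = (r * s) *\<^sub>R u"
    unfolding scaleR_l2_def
    by transfer (auto simp: l2_rel_def mult.assoc intro!: square_integrable_scale)
  show "1 *\<^sub>R u = u"
    unfolding scaleR_l2_def by transfer (auto simp: l2_rel_def)
  show "sgn u = inverse (norm u) *\<^sub>R u" by (rule sgn_l2_def)
  show "dist u v = norm (u - v)" by (rule dist_l2_def)
  show "uniformity = (INF e\<in>{0<..}. principal {(u, v :: l2). dist u v < e})"
    by (rule uniformity_l2_def)
  show "open U \<longleftrightarrow> (\<forall>u\<in>U. eventually (\<lambda>(u', v). u' = u \<longrightarrow> v \<in> U) uniformity)"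
    by (rule open_l2_def)
  show "norm u = sqrt (inner u u)" by (rule norm_l2_def)
  show "inner u v = inner v u"
    unfolding inner_l2_def
  proof transfer
    fix f g assume "l2_rel f f" "l2_rel g g"
    have "integral\<^sup>L half_line (\<lambda>x. cnj (f x) * g x)
        = integral\<^sup>L half_line (\<lambda>x. cnj (cnj (g x) * f x))"
      by (simp add: mult.commute)
    also have "\<dots> = cnj (integral\<^sup>L half_line (\<lambda>x. cnj (g x) * f x))"
      by (rule Bochner_Integration.integral_cnj)
    finally show "Re (integral\<^sup>L half_line (\<lambda>x. cnj (f x) * g x))
        = Re (integral\<^sup>L half_line (\<lambda>x. cnj (g x) * f x))"
      by simp
  qed
  show "inner (u + v) w = inner u w + inner v w"
    unfolding inner_l2_def
    by transfer (auto simp: l2_rel_def distrib_right square_integrable_mult_integrable)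
  show "inner (r *\<^sub>R u) v = r * inner u v"
    unfolding inner_l2_def scaleR_l2_def
    by transfer (auto simp: l2_rel_def mult.assoc square_integrable_mult_integrable)
  have cc: "integral\<^sup>L half_line (\<lambda>x. cnj (f x) * f x)
      = of_real (integral\<^sup>L half_line (\<lambda>x. (cmod (f x))\<^sup>2))" for f
    by (simp only: mult.commute [of "cnj _"] complex_norm_square [symmetric] integral_complex_of_real)
  show "0 \<le> inner u u"
    unfolding inner_l2_def by transfer (simp add: cc)
  show "(inner u u = 0) = (u = 0)"
    unfolding inner_l2_def
  proof transfer
    fix f assume f: "l2_rel f f"
    then have i: "integrable half_line (\<lambda>x. (cmod (f x))\<^sup>2)"
      by (simp add: l2_rel_def square_integrable_def)
    show "(Re (integral\<^sup>L half_line (\<lambda>x. cnj (f x) * f x)) = 0) = l2_rel f (\<lambda>x. 0)"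
      using f integral_nonneg_eq_0_iff_AE [OF i]
      by (simp add: cc l2_rel_def square_integrable_zero)
  qed
qed

end

section \<open>Operators on this space\<close>

definition bounded_clinear :: "(l2 \<Rightarrow> l2) \<Rightarrow> bool" where
  "bounded_clinear A \<longleftrightarrow> bounded_linear A \<and> (\<forall>c u. A (scaleC c u) = scaleC c (A u))"

text \<open>An unbounded operator \<open>T\<close> is given by its graph: \<open>(u, v) \<in> T\<close> means that \<open>u\<close> lies in the
  domain and \<open>v = T u\<close>. Thus \<open>(u, f + z u) \<in> T\<close> says \<open>(T - z I) u = f\<close>.\<close>

definition resolvent :: "(l2 \<times> l2) set \<Rightarrow> complex \<Rightarrow> l2 \<Rightarrow> l2" where
  "resolvent T z f = (THE u. (u, f + scaleC z u) \<in> T)"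

definition resolvent_set :: "(l2 \<times> l2) set \<Rightarrow> complex set" where
  "resolvent_set T =
     {z. (\<forall>f. \<exists>!u. (u, f + scaleC z u) \<in> T) \<and> bounded_clinear (resolvent T z)}"

definition is_onb :: "l2 set \<Rightarrow> bool" where
  "is_onb E \<longleftrightarrow> (\<forall>e\<in>E. cinner e e = 1) \<and> (\<forall>e\<in>E. \<forall>e'\<in>E. e \<noteq> e' \<longrightarrow> cinner e e' = 0) \<and>
     (\<forall>u. (\<forall>e\<in>E. cinner e u = 0) \<longrightarrow> u = 0)"

definition positive_operator :: "(l2 \<Rightarrow> l2) \<Rightarrow> bool" where
  "positive_operator B \<longleftrightarrow> bounded_clinear B \<and> (\<forall>u. cinner u (B u) \<in> \<real>\<^sub>\<ge>\<^sub>0)"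

definition is_adjoint :: "(l2 \<Rightarrow> l2) \<Rightarrow> (l2 \<Rightarrow> l2) \<Rightarrow> bool" where
  "is_adjoint A A' \<longleftrightarrow> (\<forall>u v. cinner (A' u) v = cinner u (A v))"

text \<open>\<open>A\<close> is trace class if the trace of \<open>B = \<bar>A\<bar> = (A\<^sup>* A)\<^sup>1\<^sup>/\<^sup>2\<close> is finite. The sum of the
  non-negative numbers \<open>\<langle>e, B e\<rangle>\<close> does not depend on the orthonormal basis.\<close>

definition trace_class :: "(l2 \<Rightarrow> l2) \<Rightarrow> bool" where
  "trace_class A \<longleftrightarrow> bounded_clinear A \<and>
     (\<exists>A' B E. is_adjoint A A' \<and> positive_operator B \<and> B \<circ> B = A' \<circ> A \<and>
        is_onb E \<and> (\<lambda>e. cinner e (B e)) summable_on E)"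

definition op_trace :: "(l2 \<Rightarrow> l2) \<Rightarrow> complex" where
  "op_trace A = (THE t. \<forall>E. is_onb E \<longrightarrow> ((\<lambda>e. cinner e (A e)) has_sum t) E)"

section \<open>The Bessel operators\<close>

text \<open>Here \<open>d\<close> ranges over the finite families of non-overlapping compact subintervals of \<open>[a, b]\<close>.\<close>

definition absolutely_continuous_on :: "real \<Rightarrow> real \<Rightarrow> (real \<Rightarrow> complex) \<Rightarrow> bool" where
  "absolutely_continuous_on a b f \<longleftrightarrow>
     (\<forall>\<epsilon>>0. \<exists>\<delta>>0. \<forall>d. d division_of \<Union>d \<and> \<Union>d \<subseteq> {a..b} \<and> (\<Sum>k\<in>d. Sup k - Inf k) < \<delta> \<longrightarrow>
        (\<Sum>k\<in>d. cmod (f (Sup k) - f (Inf k))) < \<epsilon>)"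

definition AC_loc :: "(real \<Rightarrow> complex) set" where
  "AC_loc = {f. \<forall>a b. 0 < a \<and> a \<le> b \<longrightarrow> absolutely_continuous_on a b f}"

abbreviation D1 :: "(real \<Rightarrow> complex) \<Rightarrow> real \<Rightarrow> complex" where
  "D1 f \<equiv> (\<lambda>x. vector_derivative f (at x))"

text \<open>Differentiability is stated explicitly because \<^const>\<open>vector_derivative\<close> is total. It
  follows from \<open>f\<close> and \<open>f'\<close> being locally absolutely continuous.\<close>

definition D_half :: "(real \<Rightarrow> complex) set" where
  "D_half = {f. f \<in> AC_loc \<and> f differentiable_on {0<..} \<and> D1 f \<in> AC_loc}"

text \<open>\<open>\<tau>\<^sub>\<nu> g = h\<close> almost everywhere, that is, \<open>g'' = ((\<nu>\<^sup>2 - 1/4) / x\<^sup>2) g - h\<close>; the derivative of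
  \<open>g'\<close> exists almost everywhere for \<open>g \<in> D_half\<close>.\<close>

definition bessel_expression :: "real \<Rightarrow> (real \<Rightarrow> complex) \<Rightarrow> (real \<Rightarrow> complex) \<Rightarrow> bool" where
  "bessel_expression \<nu> g h \<longleftrightarrow>
     (AE x in half_line. \<exists>g''. (D1 g has_vector_derivative g'') (at x) \<and>
        h x = - g'' + complex_of_real ((\<nu>\<^sup>2 - 1/4) / x\<^sup>2) * g x)"

definition max_action :: "real \<Rightarrow> (real \<Rightarrow> complex) \<Rightarrow> (real \<Rightarrow> complex) \<Rightarrow> bool" where
  "max_action \<nu> g h \<longleftrightarrow>
     g \<in> D_half \<and> square_integrable g \<and> square_integrable h \<and> bessel_expression \<nu> g h"

definition dom_max :: "real \<Rightarrow> (real \<Rightarrow> complex) set" where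
  "dom_max \<nu> = {g. \<exists>h. max_action \<nu> g h}"

definition T_max :: "real \<Rightarrow> (l2 \<times> l2) set" where
  "T_max \<nu> = {(abs_l2 g, abs_l2 h) | g h. max_action \<nu> g h}"

definition lagrange_bracket :: "(real \<Rightarrow> complex) \<Rightarrow> (real \<Rightarrow> complex) \<Rightarrow> real \<Rightarrow> complex" where
  "lagrange_bracket f g x = f x * cnj (D1 g x) - D1 f x * cnj (g x)"

definition lagrange_bracket_0 :: "(real \<Rightarrow> complex) \<Rightarrow> (real \<Rightarrow> complex) \<Rightarrow> complex" where
  "lagrange_bracket_0 f g = Lim (at_right 0) (lagrange_bracket f g)"

text \<open>The restriction of \<^const>\<open>T_max\<close> by the boundary condition with parameter \<open>\<theta>\<close>.\<close>

definition T_bc ::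
  "real \<Rightarrow> (real \<Rightarrow> complex) \<Rightarrow> (real \<Rightarrow> complex) \<Rightarrow> real \<Rightarrow> (l2 \<times> l2) set" where
  "T_bc \<nu> \<phi> \<psi> \<theta> =
     {(abs_l2 g, abs_l2 h) | g h. max_action \<nu> g h \<and>
        complex_of_real (cos \<theta>) * lagrange_bracket_0 g \<phi> +
        complex_of_real (sin \<theta>) * lagrange_bracket_0 g \<psi> = 0}"

definition boundary_functions :: "real \<Rightarrow> (real \<Rightarrow> complex) \<Rightarrow> (real \<Rightarrow> complex) \<Rightarrow> bool" where
  "boundary_functions \<nu> \<phi> \<psi> \<longleftrightarrow>
     \<phi> \<in> dom_max \<nu> \<and> \<psi> \<in> dom_max \<nu> \<and>
     (\<forall>x>0. \<phi> x \<in> \<real> \<and> \<psi> x \<in> \<real>) \<and>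
     eventually (\<lambda>x. \<phi> x = 0) at_top \<and> eventually (\<lambda>x. \<psi> x = 0) at_top \<and>
     (\<forall>x\<in>{0<..<1}. \<phi> x = complex_of_real (x powr (1/2 + \<nu>))) \<and>
     (\<forall>x\<in>{0<..<1}. \<psi> x = complex_of_real (1 / (2 * \<nu>) * x powr (1/2 - \<nu>)))"

section \<open>Powers and Bessel functions\<close>

text \<open>Powers with the branch \<open>arg z \<in> [0, 2\<pi>)\<close>, for \<open>z \<noteq> 0\<close>; this differs from the principal
  branch of \<^const>\<open>powr\<close> in the lower half-plane.\<close>

definition cpow :: "complex \<Rightarrow> real \<Rightarrow> complex" where
  "cpow z \<beta> = complex_of_real (cmod z powr \<beta>) * cis (\<beta> * Arg2pi z)"

text \<open>The principal branch of \<^const>\<open>powr\<close> is used here, as is customary for Bessel functions. For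
  arguments in the closed upper half-plane other than the origin it agrees with
  \<^const>\<open>cpow\<close>, and \<open>z\<^sup>1\<^sup>/\<^sup>2 x\<close> is always such an argument.\<close>

definition Bessel_J :: "real \<Rightarrow> complex \<Rightarrow> complex" where
  "Bessel_J \<nu> z = (z / 2) powr complex_of_real \<nu> *
     (\<Sum>k. (-1) ^ k / fact k * rGamma (complex_of_real \<nu> + of_nat k + 1) * (z / 2) ^ (2 * k))"

definition Bessel_Y_nonint :: "real \<Rightarrow> complex \<Rightarrow> complex" where
  "Bessel_Y_nonint \<nu> z =
     (Bessel_J \<nu> z * complex_of_real (cos (\<nu> * pi)) - Bessel_J (- \<nu>) z) /
     complex_of_real (sin (\<nu> * pi))"

definition Bessel_Y :: "real \<Rightarrow> complex \<Rightarrow> complex" where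
  "Bessel_Y \<nu> z =
     (if \<nu> \<in> \<int> then Lim (at \<nu>) (\<lambda>\<mu>. Bessel_Y_nonint \<mu> z) else Bessel_Y_nonint \<nu> z)"

definition Hankel_H1 :: "real \<Rightarrow> complex \<Rightarrow> complex" where
  "Hankel_H1 \<nu> z = Bessel_J \<nu> z + \<i> * Bessel_Y \<nu> z"

definition w_fun :: "real \<Rightarrow> complex \<Rightarrow> real \<Rightarrow> complex" where
  "w_fun \<nu> z x =
     \<i> * complex_of_real (Gamma (1 - \<nu>) * sin (\<nu> * pi)) * cpow z (\<nu> / 2) /
       complex_of_real (2 powr (\<nu> + 1) * \<nu>) *
     complex_of_real (x powr (1/2)) * Hankel_H1 \<nu> (cpow z (1/2) * complex_of_real x)"

definition krein_coeff :: "real \<Rightarrow> real \<Rightarrow> complex \<Rightarrow> complex" where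
  "krein_coeff \<nu> \<theta> z = complex_of_real (cot \<theta>) +
     complex_of_real (Gamma (1 - \<nu>)) * exp (- \<i> * complex_of_real (\<nu> * pi)) /
       complex_of_real (Gamma (1 + \<nu>) * 2 powr (2 * \<nu> + 1) * \<nu>) * cpow z \<nu>"

end

theory Submission
  imports Defs "HOL-Complex_Analysis.Conformal_Mappings" "HOL-Real_Asymp.Real_Asymp"
begin

text \<open>The functions \<open>p = x\<^sup>1\<^sup>/\<^sup>2\<^sup>-\<^sup>\<nu>\<close> and \<open>q = x\<^sup>1\<^sup>/\<^sup>2\<^sup>+\<^sup>\<nu>\<close> solve \<open>\<tau> f = 0\<close>, and the brackets of a
  function with \<open>p\<close> and \<open>q\<close> at the origin determine its bracket with every other function. The
  power series of the Bessel functions give \<open>w = p / (2 \<nu>) - m q + \<dots>\<close> near 0, where \<open>cot \<theta> + m\<close> is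
  the coefficient in the theorem. The integral of \<open>u\<^sup>\<nu>\<^sup>-\<^sup>1 exp (- \<zeta> (u + x\<^sup>2 / (4 u)))\<close> over \<open>u > 0\<close>, with
  \<open>\<zeta> = - i z\<^sup>1\<^sup>/\<^sup>2\<close>, times \<open>p\<close>, is a solution that decays at infinity as \<open>z \<notin> [0, \<infinity>)\<close>. Its boundary
  values at 0 are proportional to those of \<open>w\<close>, so \<open>w\<close> decays as well.

  If \<open>u = (T\<^sub>0 - z)\<^sup>-\<^sup>1 f\<close>, Green's formula turns the inner product of \<open>f\<close> and \<open>w\<close> (at the conjugate of
  \<open>z\<close>) into the boundary value \<open>[u, p](0)\<close>, and adding a multiple of \<open>w\<close> to \<open>u\<close> restores the boundary
  condition of \<open>T\<^sub>\<theta>\<close>. Hence the difference of the resolvents has rank one, and Parseval's identity gives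
  its trace. The integral of \<open>w\<^sup>2\<close> has an explicit primitive.\<close>

abbreviation (input) cplx :: "real \<Rightarrow> complex" where
  "cplx \<equiv> complex_of_real"

section \<open>Absolutely continuous functions\<close>

lemma division_interval:
  assumes "d division_of \<Union>d" "\<Union>d \<subseteq> {a..b::real}" "k \<in> d"
  shows "k = {Inf k..Sup k} \<and> Inf k \<le> Sup k \<and> Inf k \<in> {a..b} \<and> Sup k \<in> {a..b}"
proof -
  obtain u v where k: "k = cbox u v" "k \<noteq> {}"
    using division_ofD(3,4)[OF assms(1,3)] by auto
  then have "{u..v} \<subseteq> {a..b}" "u \<le> v" using assms(2,3)
      by (metis Sup_upper box_real(2) order_trans, simp)
  then show ?thesis using k by auto
qed

lemma lipschitz_imp_absolutely_continuous:
  assumes "\<And>x y. x \<in> {a..b} \<Longrightarrow> y \<in> {a..b} \<Longrightarrow> cmod (f x - f y) \<le> L * \<bar>x - y\<bar>"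
  shows "absolutely_continuous_on a b f"
  unfolding absolutely_continuous_on_def
proof (intro allI impI)
  fix e :: real assume "e > 0"
  define \<delta> where "\<delta> = e / (\<bar>L\<bar> + 1)"
  have "\<delta> > 0" using \<open>e > 0\<close> by (simp add: \<delta>_def)
  moreover have "(\<Sum>k\<in>d. cmod (f (Sup k) - f (Inf k))) < e"
    if d: "d division_of \<Union>d \<and> \<Union>d \<subseteq> {a..b} \<and> (\<Sum>k\<in>d. Sup k - Inf k) < \<delta>" for d
  proof -
    have "(\<Sum>k\<in>d. cmod (f (Sup k) - f (Inf k))) \<le> (\<Sum>k\<in>d. (\<bar>L\<bar> + 1) * (Sup k - Inf k))"
    proof (rule sum_mono)
      fix k assume "k \<in> d"
      then have k: "Inf k \<le> Sup k" "Inf k \<in> {a..b}" "Sup k \<in> {a..b}"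
        using division_interval[of d a b k] d by auto
      have "cmod (f (Sup k) - f (Inf k)) \<le> L * \<bar>Sup k - Inf k\<bar>"
        using assms k by blast
      also have "\<dots> \<le> (\<bar>L\<bar> + 1) * (Sup k - Inf k)"
        using k by (simp add: mult_right_mono)
      finally show "cmod (f (Sup k) - f (Inf k)) \<le> (\<bar>L\<bar> + 1) * (Sup k - Inf k)" .
    qed
    also have "\<dots> = (\<bar>L\<bar> + 1) * (\<Sum>k\<in>d. Sup k - Inf k)"
      by (simp add: sum_distrib_left)
    also have "\<dots> < (\<bar>L\<bar> + 1) * \<delta>"
      using d by (intro mult_strict_left_mono) auto
    also have "\<dots> = e" by (simp add: \<delta>_def)
    finally show ?thesis .
  qed
  ultimately show "\<exists>\<delta>>0. \<forall>d. d division_of \<Union>d \<and> \<Union>d \<subseteq> {a..b} \<and> (\<Sum>k\<in>d. Sup k - Inf k) < \<delta> \<longrightarrow>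
        (\<Sum>k\<in>d. cmod (f (Sup k) - f (Inf k))) < e"
    by blast
qed

lemma absolutely_continuous_bilinear:
  assumes f: "absolutely_continuous_on a b f" and g: "absolutely_continuous_on a b g"
    and le: "\<And>x y. x \<in> {a..b} \<Longrightarrow> y \<in> {a..b} \<Longrightarrow>
      cmod (h x - h y) \<le> B * (cmod (f x - f y) + cmod (g x - g y))"
  shows "absolutely_continuous_on a b h"
  unfolding absolutely_continuous_on_def
proof (intro allI impI)
  fix e :: real assume "e > 0"
  define e' where "e' = e / (2 * (\<bar>B\<bar> + 1))"
  have e': "e' > 0" using \<open>e > 0\<close> by (simp add: e'_def)
  obtain d1 where d1: "d1 > 0" "\<And>d. d division_of \<Union>d \<and> \<Union>d \<subseteq> {a..b} \<and>
      (\<Sum>k\<in>d. Sup k - Inf k) < d1 \<Longrightarrow> (\<Sum>k\<in>d. cmod (f (Sup k) - f (Inf k))) < e'"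
    using f e' unfolding absolutely_continuous_on_def by blast
  obtain d2 where d2: "d2 > 0" "\<And>d. d division_of \<Union>d \<and> \<Union>d \<subseteq> {a..b} \<and>
      (\<Sum>k\<in>d. Sup k - Inf k) < d2 \<Longrightarrow> (\<Sum>k\<in>d. cmod (g (Sup k) - g (Inf k))) < e'"
    using g e' unfolding absolutely_continuous_on_def by blast
  have "(\<Sum>k\<in>d. cmod (h (Sup k) - h (Inf k))) < e"
    if d: "d division_of \<Union>d \<and> \<Union>d \<subseteq> {a..b} \<and> (\<Sum>k\<in>d. Sup k - Inf k) < min d1 d2" for d
  proof -
    have "(\<Sum>k\<in>d. cmod (h (Sup k) - h (Inf k)))
        \<le> (\<Sum>k\<in>d. (\<bar>B\<bar> + 1) * (cmod (f (Sup k) - f (Inf k)) + cmod (g (Sup k) - g (Inf k))))"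
    proof (rule sum_mono)
      fix k assume "k \<in> d"
      then have k: "Inf k \<in> {a..b}" "Sup k \<in> {a..b}"
        using division_interval[of d a b k] d by auto
      show "cmod (h (Sup k) - h (Inf k))
        \<le> (\<bar>B\<bar> + 1) * (cmod (f (Sup k) - f (Inf k)) + cmod (g (Sup k) - g (Inf k)))"
        by (rule order_trans[OF le[OF k(2,1)]]) (intro mult_right_mono, auto)
    qed
    also have "\<dots> = (\<bar>B\<bar> + 1) * ((\<Sum>k\<in>d. cmod (f (Sup k) - f (Inf k))) +
        (\<Sum>k\<in>d. cmod (g (Sup k) - g (Inf k))))"
      by (simp only: sum_distrib_left [symmetric] sum.distrib)
    also have "\<dots> < (\<bar>B\<bar> + 1) * (e' + e')"
      using d d1(2)[of d] d2(2)[of d] by (intro mult_strict_left_mono add_strict_mono) auto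
    also have "\<dots> = e"
      unfolding e'_def using abs_ge_zero[of B] by (simp add: field_simps add_nonneg_eq_0_iff)
    finally show ?thesis .
  qed
  then show "\<exists>\<delta>>0. \<forall>d. d division_of \<Union>d \<and> \<Union>d \<subseteq> {a..b} \<and> (\<Sum>k\<in>d. Sup k - Inf k) < \<delta> \<longrightarrow>
        (\<Sum>k\<in>d. cmod (h (Sup k) - h (Inf k))) < e"
    using d1(1) d2(1) by (intro exI[of _ "min d1 d2"]) auto
qed

lemma absolutely_continuous_imp_continuous:
  assumes "absolutely_continuous_on a b f"
  shows "continuous_on {a..b} f"
  unfolding continuous_on_iff
proof (intro ballI allI impI)
  fix x e :: real assume x: "x \<in> {a..b}" and "e > 0"
  obtain \<delta> where \<delta>: "\<delta> > 0" "\<And>d. d division_of \<Union>d \<and> \<Union>d \<subseteq> {a..b} \<and>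
      (\<Sum>k\<in>d. Sup k - Inf k) < \<delta> \<Longrightarrow> (\<Sum>k\<in>d. cmod (f (Sup k) - f (Inf k))) < e"
    using assms \<open>e > 0\<close> unfolding absolutely_continuous_on_def by blast
  have "dist (f y) (f x) < e" if y: "y \<in> {a..b}" "dist y x < \<delta>" for y
  proof -
    have "(\<Sum>k\<in>{cbox (min x y) (max x y)}. cmod (f (Sup k) - f (Inf k))) < e"
      using x y by (intro \<delta>(2)) (auto simp: dist_real_def division_of_def)
    then show ?thesis
      by (cases "x \<le> y") (auto simp: dist_norm norm_minus_commute max_def min_def)
  qed
  then show "\<exists>d>0. \<forall>x'\<in>{a..b}. dist x' x < d \<longrightarrow> dist (f x') (f x) < e"
    using \<delta>(1) by blast
qed

lemma absolutely_continuous_mult: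
  assumes f: "absolutely_continuous_on a b f" and g: "absolutely_continuous_on a b g"
  shows "absolutely_continuous_on a b (\<lambda>x. f x * g x)"
proof -
  have "bounded (f ` {a..b})" "bounded (g ` {a..b})"
    using assms by (auto intro!: compact_imp_bounded compact_continuous_image
        absolutely_continuous_imp_continuous)
  then obtain B C where B: "\<And>x. x \<in> {a..b} \<Longrightarrow> cmod (f x) \<le> B"
      and C: "\<And>x. x \<in> {a..b} \<Longrightarrow> cmod (g x) \<le> C"
    unfolding bounded_iff by blast
  show ?thesis
  proof (rule absolutely_continuous_bilinear[OF f g, of _ "max B C"])
    fix x y assume xy: "x \<in> {a..b}" "y \<in> {a..b}"
    have "f x * g x - f y * g y = f x * (g x - g y) + g y * (f x - f y)"
      by (simp add: algebra_simps)
    also have "cmod \<dots> \<le> cmod (f x) * cmod (g x - g y) + cmod (g y) * cmod (f x - f y)"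
      by (metis norm_mult norm_triangle_ineq)
    also have "\<dots> \<le> max B C * cmod (g x - g y) + max B C * cmod (f x - f y)"
      using B[OF xy(1)] C[OF xy(2)] by (intro add_mono mult_right_mono) auto
    finally show "cmod (f x * g x - f y * g y) \<le> max B C * (cmod (f x - f y) + cmod (g x - g y))"
      by (simp add: algebra_simps)
  qed
qed

lemma absolutely_continuous_lincomb:
  assumes f: "absolutely_continuous_on a b f" and g: "absolutely_continuous_on a b g"
  shows "absolutely_continuous_on a b (\<lambda>x. f x + c * g x)"
proof (rule absolutely_continuous_bilinear[OF f g, of _ "1 + cmod c"])
  fix x y assume xy: "x \<in> {a..b}" "y \<in> {a..b}"
  have "(f x + c * g x) - (f y + c * g y) = (f x - f y) + c * (g x - g y)"
    by (simp add: algebra_simps)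
  also have "cmod \<dots> \<le> cmod (f x - f y) + cmod c * cmod (g x - g y)"
    by (metis norm_mult norm_triangle_ineq)
  also have "\<dots> \<le> (1 + cmod c) * cmod (f x - f y) + (1 + cmod c) * cmod (g x - g y)"
    by (intro add_mono mult_right_mono) (auto simp: mult_left_le_one_le algebra_simps)
  finally show "cmod ((f x + c * g x) - (f y + c * g y))
      \<le> (1 + cmod c) * (cmod (f x - f y) + cmod (g x - g y))"
    by (simp add: algebra_simps)
qed

lemma C1_imp_absolutely_continuous:
  assumes "\<And>x. x \<in> {a..b} \<Longrightarrow> (f has_vector_derivative f' x) (at x)"
    and "continuous_on {a..b} f'"
  shows "absolutely_continuous_on a b f"
proof -
  have "bounded (f' ` {a..b})"
    using assms(2) by (intro compact_imp_bounded compact_continuous_image) auto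
  then obtain B where B: "\<And>x. x \<in> {a..b} \<Longrightarrow> cmod (f' x) \<le> B"
    unfolding bounded_iff by blast
  show ?thesis
  proof (rule lipschitz_imp_absolutely_continuous[of a b f B])
    fix x y assume xy: "x \<in> {a..b}" "y \<in> {a..b}"
    have "norm (f x - f y) \<le> B * norm (x - y)"
    proof (rule differentiable_bound[of "{a..b}" f "\<lambda>x h. h *\<^sub>R f' x"])
      show "(f has_derivative (\<lambda>h. h *\<^sub>R f' x)) (at x within {a..b})" if "x \<in> {a..b}" for x
        using assms(1)[OF that] has_vector_derivative_at_within
        by (auto simp: has_vector_derivative_def intro: has_derivative_at_withinI)
      show "onorm (\<lambda>h. h *\<^sub>R f' x) \<le> B" if "x \<in> {a..b}" for x
        using B[OF that] by (intro onorm_le) (simp add: mult.commute[of B] mult_left_mono)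
    qed (use xy in auto)
    then show "cmod (f x - f y) \<le> B * \<bar>x - y\<bar>" by simp
  qed
qed

text \<open>The intervals tagged in the exceptional null set are made short in total by a fine gauge, so
  absolute continuity controls their contribution; the others are treated as for the usual
  fundamental theorem.\<close>

lemma absolutely_continuous_FTC:
  assumes ac: "absolutely_continuous_on a b f" and "a \<le> b" and N: "negligible N"
    and deriv: "\<And>x. x \<in> {a..b} - N \<Longrightarrow> (f has_vector_derivative F x) (at x)"
  shows "(F has_integral (f b - f a)) {a..b}"
proof (cases "a = b")
  case True
  then show ?thesis using has_integral_refl(2)[of F b] by simp
next
  case False
  with \<open>a \<le> b\<close> have ab: "a < b" by simp
  define F' where "F' = (\<lambda>x. if x \<in> N then 0 else F x)"
  have "(F' has_integral (f b - f a)) {a..b}"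
    unfolding has_integral_factor_content box_real[symmetric]
  proof safe
    fix e :: real assume "e > 0"
    have "\<forall>x. \<exists>d>0. x \<in> {a..b} - N \<longrightarrow>
         (\<forall>y\<in>{a..b}. norm (y-x) < d \<longrightarrow> norm (f y - f x - (y-x) *\<^sub>R F' x) \<le> (e/2) * norm (y-x))"
    proof
      fix x
      show "\<exists>d>0. x \<in> {a..b} - N \<longrightarrow>
         (\<forall>y\<in>{a..b}. norm (y-x) < d \<longrightarrow> norm (f y - f x - (y-x) *\<^sub>R F' x) \<le> (e/2) * norm (y-x))"
      proof (cases "x \<in> {a..b} - N")
        case True
        then have "(f has_derivative (\<lambda>h. h *\<^sub>R F' x)) (at x)"
          using deriv[OF True] by (simp add: F'_def has_vector_derivative_def)
        then show ?thesis
          using \<open>e > 0\<close> unfolding has_derivative_at_alt by (meson half_gt_zero)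
      qed (auto intro: exI[of _ 1])
    qed
    then obtain r where r: "\<And>x. 0 < r x"
      "\<And>x y. \<lbrakk>x \<in> {a..b} - N; y \<in> {a..b}; norm (y-x) < r x\<rbrakk>
         \<Longrightarrow> norm (f y - f x - (y-x) *\<^sub>R F' x) \<le> (e/2) * norm (y-x)"
      by metis
    have "e/2 * (b - a) > 0" using \<open>e > 0\<close> ab by simp
    then obtain \<delta> where \<delta>: "\<delta> > 0" "\<And>d. d division_of \<Union>d \<and> \<Union>d \<subseteq> {a..b} \<and>
        (\<Sum>k\<in>d. Sup k - Inf k) < \<delta> \<Longrightarrow> (\<Sum>k\<in>d. cmod (f (Sup k) - f (Inf k))) < e/2 * (b - a)"
      using ac unfolding absolutely_continuous_on_def by blast
    obtain T where T: "open T" "N \<subseteq> T" "T - N \<in> lmeasurable" "emeasure lebesgue (T - N) < ennreal \<delta>"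
      using sets_lebesgue_outer_open[OF negligible_imp_sets[OF N] \<delta>(1)] by metis
    have Teq: "T = (T - N) \<union> N" using T(2) by auto
    have Tm: "T \<in> lmeasurable"
      using T(3) negligible_imp_measurable[OF N] Teq by (metis fmeasurable.Un)
    have "measure lebesgue T \<le> measure lebesgue (T - N) + measure lebesgue N"
      using T(3) negligible_imp_measurable[OF N] Teq
      by (metis fmeasurableD measure_Un_le)
    also have "measure lebesgue N = 0" using N by (rule negligible_imp_measure0)
    also have "measure lebesgue (T - N) < \<delta>"
      using T(3,4) \<delta>(1) by (metis add_0_right emeasure_eq_measure2 ennreal_less_iff measure_nonneg)
    finally have Tlt: "measure lebesgue T < \<delta>" by simp
    define g where "g = (\<lambda>x. if x \<in> N then T else ball x (r x))"
    show "\<exists>d. gauge d \<and> (\<forall>p. p tagged_division_of (cbox a b) \<and> d fine p \<longrightarrow>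
      norm ((\<Sum>(x, k)\<in>p. measure lborel k *\<^sub>R F' x) - (f b - f a)) \<le> e * measure lborel (cbox a b))"
    proof (rule exI, safe)
      show "gauge g"
        using T r(1) by (auto simp: gauge_def g_def)
    next
      fix p assume p: "p tagged_division_of cbox a b" and fine: "g fine p"
      have fin: "finite p" using p by blast
      define q where "q = {(x,k) \<in> p. x \<in> N}"
      have qp: "q \<subseteq> p" by (auto simp: q_def)
      have kin: "\<exists>u v. k = cbox u v \<and> u \<le> v \<and> x \<in> {u..v} \<and> {u..v} \<subseteq> {a..b} \<and> measure lborel k = v - u \<and>
          Sup k = v \<and> Inf k = u" if "(x,k) \<in> p" for x k
      proof -
        have "x \<in> k" "k \<subseteq> cbox a b" "\<exists>u v. k = cbox u v"
          using p that by (blast dest: tagged_division_ofD)+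
        then show ?thesis by fastforce
      qed
      have qt: "q tagged_partial_division_of cbox a b"
        using p qp by (meson tagged_division_of_def tagged_partial_division_subset)
      then have qU: "q tagged_division_of \<Union>(snd ` q)"
        by (rule tagged_partial_division_of_Union_self)
      have dq: "snd ` q division_of \<Union>(snd ` q)"
        using division_of_tagged_division[OF qU] .
      have dqs: "\<Union>(snd ` q) \<subseteq> {a..b}"
        using kin qp by fastforce
      have "(\<Sum>k\<in>snd ` q. Sup k - Inf k) = (\<Sum>k\<in>snd ` q. measure lebesgue k)"
      proof (rule sum.cong)
        fix k assume "k \<in> snd ` q"
        then obtain x where "(x,k) \<in> p" using qp by auto
        from kin[OF this] show "Sup k - Inf k = measure lebesgue k"
          by (metis lborelD_Collect measure_completion sets_lborel borel_closed closed_cbox)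
      qed simp
      also have "\<dots> = measure lebesgue (\<Union>(snd ` q))"
        using content_division[OF dq] .
      also have "\<dots> \<le> measure lebesgue T"
      proof (rule measure_mono_fmeasurable)
        show "\<Union> (snd ` q) \<subseteq> T"
          using fine qp by (fastforce simp: q_def fine_def g_def)
        show "\<Union> (snd ` q) \<in> sets lebesgue"
          using dq lmeasurable_division by blast
      qed (rule Tm)
      finally have "(\<Sum>k\<in>snd ` q. cmod (f (Sup k) - f (Inf k))) < e/2 * (b - a)"
        using Tlt dq dqs by (intro \<delta>(2)) auto
      moreover have "(\<Sum>(x,k)\<in>q. cmod (f (Sup k) - f (Inf k))) =
          (\<Sum>k\<in>snd ` q. cmod (f (Sup k) - f (Inf k)))"
        (is "?L = ?R")
      proof -
        let ?D = "\<lambda>k. if k = {} then 0 else cmod (f (Sup k) - f (Inf k))"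
        have "?L = (\<Sum>(x,k)\<in>q. ?D k)"
          using kin qp by (intro sum.cong) fastforce+
        also have "\<dots> = (\<Sum>k\<in>snd ` q. ?D k)"
          by (rule sum.over_tagged_division_lemma[OF qU]) (auto simp: box_eq_empty not_less le_less)
        also have "\<dots> = ?R"
          using division_ofD(3)[OF dq] by (intro sum.cong) auto
        finally show ?thesis .
      qed
      ultimately have bad: "(\<Sum>(x,k)\<in>q. cmod (f (Sup k) - f (Inf k))) \<le> e/2 * (b - a)"
        by simp
      have len: "(\<Sum>(x,k)\<in>p. Sup k - Inf k) = b - a"
        using additive_tagged_division_1[where f= "\<lambda>x. x"] \<open>a \<le> b\<close> p by auto
      have "f b - f a = (\<Sum>(x,k)\<in>p. f (Sup k) - f (Inf k))"
        using additive_tagged_division_1[where f= f] \<open>a \<le> b\<close> p by auto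
      then have "norm ((\<Sum>(x, k)\<in>p. measure lborel k *\<^sub>R F' x) - (f b - f a)) =
          norm (\<Sum>(x,k)\<in>p. measure lborel k *\<^sub>R F' x - (f (Sup k) - f (Inf k)))"
        by (simp add: sum_subtractf split_def)
      also have "\<dots> \<le> (\<Sum>(x,k)\<in>p. (e/2) * (Sup k - Inf k) +
          (if x \<in> N then cmod (f (Sup k) - f (Inf k)) else 0))"
      proof (rule sum_norm_le, safe)
        fix x k assume xk: "(x,k) \<in> p"
        from kin[OF this] obtain u v where k: "k = cbox u v" "u \<le> v" "x \<in> {u..v}"
            "{u..v} \<subseteq> {a..b}" "measure lborel k = v - u" "Sup k = v" "Inf k = u"
          by blast
        show "norm (measure lborel k *\<^sub>R F' x - (f (Sup k) - f (Inf k))) \<le> (e/2) * (Sup k - Inf k) +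
          (if x \<in> N then cmod (f (Sup k) - f (Inf k)) else 0)"
        proof (cases "x \<in> N")
          case True
          then show ?thesis using k \<open>e > 0\<close> by (simp add: F'_def norm_minus_commute)
        next
          case False
          have "\<forall>y\<in>k. y \<in> ball x (r x)"
            using fine xk False by (fastforce simp: fine_def g_def)
          then have d: "norm (u - x) < r x" "norm (v - x) < r x"
            using k by (auto simp: dist_norm norm_minus_commute dest: bspec[of _ _ u] bspec[of _ _ v])
          have "norm ((v - u) *\<^sub>R F' x - (f v - f u)) =
              norm ((f u - f x - (u - x) *\<^sub>R F' x) - (f v - f x - (v - x) *\<^sub>R F' x))"
            by (simp add: algebra_simps)
          also have "\<dots> \<le> (e/2) * norm (u - x) + (e/2) * norm (v - x)"
            using k False d by (intro order_trans[OF norm_triangle_ineq4] add_mono r(2)) auto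
          also have "\<dots> = (e/2) * (v - u)" using k by (simp add: field_simps)
          finally show ?thesis using k False by simp
        qed
      qed
      also have "\<dots> = (e/2) * (\<Sum>(x,k)\<in>p. Sup k - Inf k) +
          (\<Sum>(x,k)\<in>p. if x \<in> N then cmod (f (Sup k) - f (Inf k)) else 0)"
        by (simp add: sum.distrib split_def sum_distrib_left)
      also have "(\<Sum>(x,k)\<in>p. if x \<in> N then cmod (f (Sup k) - f (Inf k)) else 0) =
          (\<Sum>(x,k)\<in>q. cmod (f (Sup k) - f (Inf k)))"
        by (rule sum.mono_neutral_cong_right[OF fin qp]) (auto simp: q_def, metis)
      also have "(e/2) * (\<Sum>(x,k)\<in>p. Sup k - Inf k) + (\<Sum>(x,k)\<in>q. cmod (f (Sup k) - f (Inf k)))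
          \<le> (e/2) * (b - a) + (e/2) * (b - a)"
        using bad len by simp
      also have "\<dots> = e * measure lborel (cbox a b)" using ab by simp
      finally show "norm ((\<Sum>(x, k)\<in>p. measure lborel k *\<^sub>R F' x) - (f b - f a)) \<le> e * measure lborel
          (cbox a b)" .
    qed
  qed
  then show ?thesis
    by (rule has_integral_spike[OF N, rotated]) (auto simp: F'_def)
qed

section \<open>Integrals over the half-line\<close>

lemma AE_half_lineI: "(\<And>x. 0 < x \<Longrightarrow> P x) \<Longrightarrow> AE x in half_line. P x"
  by (rule AE_I2) (simp add: space_restrict_space)

lemma integrable_half_line_iff:
  "integrable half_line (f :: real \<Rightarrow> complex) \<longleftrightarrow> f absolutely_integrable_on {0<..}"
  by (simp add: integrable_restrict_space set_integrable_def)

lemma integral_half_line_eq: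
  assumes "integrable half_line (f :: real \<Rightarrow> complex)"
  shows "integral\<^sup>L half_line f = integral {0<..} f"
  using assms by (simp add: lebesgue_integral_eq_integral)

lemma integrable_half_line_subset:
  assumes "integrable half_line (f :: real \<Rightarrow> complex)" "S \<in> sets lebesgue" "S \<subseteq> {0<..}"
  shows "f absolutely_integrable_on S"
  using assms set_integrable_subset unfolding integrable_half_line_iff by blast

lemma integral_half_line_improper:
  fixes F W :: "real \<Rightarrow> complex"
  assumes int: "integrable half_line F"
    and W: "\<And>a b. 0 < a \<Longrightarrow> a \<le> b \<Longrightarrow> (F has_integral (W b - W a)) {a..b}"
    and W0: "(W \<longlongrightarrow> L0) (at_right 0)" and W1: "(W \<longlongrightarrow> L1) at_top"
  shows "integral\<^sup>L half_line F = L1 - L0"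
proof (rule LIMSEQ_unique)
  define S where "S = (\<lambda>n. {1 / real (Suc n)..real (Suc n)})"
  have eq: "integral\<^sup>L half_line (\<lambda>x. indicator (S n) x *\<^sub>R F x) = W (real (Suc n)) - W
      (1 / real (Suc n))" for n
  proof -
    have sub: "S n \<subseteq> {0<..}"
      by (auto simp: S_def less_le_trans[of 0 "1 / (1 + real n)"])
    have "integral\<^sup>L half_line (\<lambda>x. indicator (S n) x *\<^sub>R F x) =
        integral\<^sup>L lebesgue (\<lambda>x. indicator {0<..} x *\<^sub>R (indicator (S n) x *\<^sub>R F x))"
      by (subst integral_restrict_space) auto
    also have "\<dots> = (LINT x:S n|lebesgue. F x)"
      unfolding set_lebesgue_integral_def
      by (rule Bochner_Integration.integral_cong) (use sub in \<open>auto simp: indicator_def\<close>)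
    also have "\<dots> = integral (S n) F"
      using integrable_half_line_subset[OF int _ sub] S_def
      by (intro set_lebesgue_integral_eq_integral) auto
    also have "\<dots> = W (real (Suc n)) - W (1 / real (Suc n))"
      unfolding S_def by (intro integral_unique W) (auto simp: field_simps add_increasing)
    finally show ?thesis .
  qed
  have "(\<lambda>n. integral\<^sup>L half_line (\<lambda>x. indicator (S n) x *\<^sub>R F x)) \<longlonglongrightarrow> integral\<^sup>L half_line F"
  proof (rule integral_dominated_convergence[where w = "\<lambda>x. norm (F x)"])
    show m: "F \<in> borel_measurable half_line" using int by simp
    show "(\<lambda>x. indicator (S n) x *\<^sub>R F x) \<in> borel_measurable half_line" for n
      using m by (intro borel_measurable_scaleR borel_measurable_indicator)
        (auto simp: sets_restrict_space_iff S_def less_le_trans[of 0 "1 / (1 + real _)"])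
    show "integrable half_line (\<lambda>x. norm (F x))" using int by simp
    show "AE x in half_line. (\<lambda>n. indicator (S n) x *\<^sub>R F x) \<longlonglongrightarrow> F x"
    proof (rule AE_half_lineI)
      fix x :: real assume x: "0 < x"
      obtain N where N: "real N \<ge> max x (1/x)" using real_arch_simple by blast
      have "x \<in> S n" if "n \<ge> N" for n
      proof -
        have n: "real (Suc n) \<ge> x" "real (Suc n) \<ge> 1 / x" using N that by auto
        have "1 / real (Suc n) \<le> x" using n(2) x by (simp add: field_simps)
        then show ?thesis using n by (simp add: S_def)
      qed
      then have "eventually (\<lambda>n. indicator (S n) x *\<^sub>R F x = F x) sequentially"
        unfolding eventually_sequentially by (intro exI[of _ N]) auto
      then show "(\<lambda>n. indicator (S n) x *\<^sub>R F x) \<longlonglongrightarrow> F x"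
        by (rule tendsto_eventually)
    qed
    show "AE x in half_line. norm (indicator (S n) x *\<^sub>R F x) \<le> norm (F x)" for n
      by (rule AE_I2) (auto simp: indicator_def)
  qed
  then show "(\<lambda>n. W (real (Suc n)) - W (1 / real (Suc n))) \<longlonglongrightarrow> integral\<^sup>L half_line F"
    unfolding eq .
  have "filterlim (\<lambda>n. 1 / real (Suc n)) (at_right 0) sequentially"
    unfolding filterlim_at
    using LIMSEQ_inverse_real_of_nat[unfolded inverse_eq_divide] by (auto intro!: eventuallyI)
  moreover have "filterlim (\<lambda>n. real (Suc n)) at_top sequentially"
    using filterlim_real_sequentially by (rule filterlim_compose[OF _ filterlim_Suc])
  ultimately show "(\<lambda>n. W (real (Suc n)) - W (1 / real (Suc n))) \<longlonglongrightarrow> L1 - L0"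
    by (intro tendsto_diff filterlim_compose[OF W0] filterlim_compose[OF W1])
qed

section \<open>Laplace integrals\<close>

lemma power2_exp_bound:
  assumes "0 < r" "0 \<le> (k::real)"
  shows "k\<^sup>2 \<le> 32 / r\<^sup>2 * exp (r * k / 4)"
proof -
  have "1 + r*k/4 + (r*k/4)\<^sup>2 / 2 \<le> exp (r*k/4)"
    using assms by (intro exp_lower_Taylor_quadratic) auto
  moreover have "0 \<le> r*k/4" using assms by simp
  ultimately have "(r*k/4)\<^sup>2 / 2 \<le> exp (r*k/4)" by linarith
  then show ?thesis using assms by (simp add: field_simps power2_eq_square)
qed

context
  fixes M :: "'a measure" and k :: "'a \<Rightarrow> real" and p :: "'a \<Rightarrow> complex" and \<eta> :: complex
  assumes mk: "k \<in> borel_measurable M" and mp: "p \<in> borel_measurable M"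
    and nonneg: "\<And>t. t \<in> space M \<Longrightarrow> 0 \<le> k t"
    and int: "\<And>e. 0 < e \<Longrightarrow> integrable M (\<lambda>t. exp (- e * k t) * cmod (p t))"
    and \<eta>: "0 < Re \<eta>"
begin

lemma laplace_measurable:
  "(\<lambda>t. exp (- w * cplx (k t)) * p t) \<in> borel_measurable M"
  using mk mp by measurable

lemma laplace_integrable_halfplane:
  assumes "0 < Re w"
  shows "integrable M (\<lambda>t. exp (- w * cplx (k t)) * p t)"
  by (rule Bochner_Integration.integrable_bound[OF int[OF assms] laplace_measurable])
    (simp add: norm_mult)

lemmas laplace_integrable = laplace_integrable_halfplane[OF \<eta>]

lemma laplace_integrable_moment:
  "integrable M (\<lambda>t. exp (- \<eta> * cplx (k t)) * (cplx (k t) * p t))"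
proof (rule Bochner_Integration.integrable_bound)
  show "integrable M (\<lambda>t. (2 / Re \<eta>) * (exp (- (Re \<eta> / 2) * k t) * cmod (p t)))"
    using int[of "Re \<eta> / 2"] \<eta> by simp
  show "(\<lambda>t. exp (- \<eta> * cplx (k t)) * (cplx (k t) * p t)) \<in> borel_measurable M"
    using mk mp by measurable
  show "AE t in M. norm (exp (- \<eta> * cplx (k t)) * (cplx (k t) * p t))
      \<le> norm ((2 / Re \<eta>) * (exp (- (Re \<eta> / 2) * k t) * cmod (p t)))"
  proof (rule AE_I2)
    fix t assume t: "t \<in> space M"
    have "1 + Re \<eta> / 2 * k t \<le> exp (Re \<eta> / 2 * k t)" by (rule exp_ge_add_one_self)
    then have "k t \<le> 2 / Re \<eta> * exp (Re \<eta> / 2 * k t)"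
      using \<eta> by (simp add: field_simps)
    then have "exp (- Re \<eta> * k t) * k t \<le> exp (- Re \<eta> * k t) * (2 / Re \<eta> * exp (Re \<eta> / 2 * k t))"
      by (rule mult_left_mono) simp
    also have "\<dots> = 2 / Re \<eta> * (exp (- Re \<eta> * k t) * exp (Re \<eta> / 2 * k t))" by simp
    also have "exp (- Re \<eta> * k t) * exp (Re \<eta> / 2 * k t) = exp (- (Re \<eta> / 2) * k t)"
      unfolding mult_exp_exp by (simp add: field_simps)
    finally have "exp (- Re \<eta> * k t) * k t * cmod (p t) \<le> 2 / Re \<eta> * exp (- (Re \<eta> / 2) * k t) * cmod
        (p t)"
      by (rule mult_right_mono) simp
    then show "norm (exp (- \<eta> * cplx (k t)) * (cplx (k t) * p t))
      \<le> norm ((2 / Re \<eta>) * (exp (- (Re \<eta> / 2) * k t) * cmod (p t)))"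
      using \<eta> nonneg[OF t] by (simp add: norm_mult mult.assoc abs_mult)
  qed
qed

lemma laplace_has_field_derivative:
  "((\<lambda>w. LINT t|M. exp (- w * cplx (k t)) * p t) has_field_derivative
    - (LINT t|M. exp (- \<eta> * cplx (k t)) * (cplx (k t) * p t))) (at \<eta>)"
  (is "(?G has_field_derivative - ?D) _")
proof -
  define r where "r = Re \<eta>"
  have r: "r > 0" using \<eta> by (simp add: r_def)
  define C where "C = (LINT t|M. 32 / r\<^sup>2 * (exp (- (r/4) * k t) * cmod (p t)))"
  have intC: "integrable M (\<lambda>t. 32 / r\<^sup>2 * (exp (- (r/4) * k t) * cmod (p t)))"
    using int[of "r/4"] r by simp
  have est: "norm ((?G (\<eta> + h) - ?G \<eta>) / h - (- ?D)) \<le> cmod h * C"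
    if h: "h \<noteq> 0" "cmod h \<le> r / 2" for h
  proof -
    have hp: "Re (\<eta> + h) > 0"
      using h r abs_Re_le_cmod[of h] by (simp add: r_def)
    define E where "E = (\<lambda>t. ((exp (- h * cplx (k t)) - 1) / h + cplx (k t)) *
        (exp (- \<eta> * cplx (k t)) * p t))"
    have "(?G (\<eta> + h) - ?G \<eta>) / h - (- ?D) = (LINT t|M. (exp (- (\<eta> + h) * cplx (k t)) * p t
        - exp (- \<eta> * cplx (k t)) * p t) / h
        + exp (- \<eta> * cplx (k t)) * (cplx (k t) * p t))"
      using laplace_integrable_halfplane[OF hp] laplace_integrable laplace_integrable_moment by simp
    also have "\<dots> = (LINT t|M. E t)"
      using h by (intro Bochner_Integration.integral_cong)
        (auto simp: E_def field_simps exp_add[symmetric] algebra_simps mult_exp_exp)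
    also have "norm \<dots> \<le> (LINT t|M. cmod h * (32 / r\<^sup>2 * (exp (- (r/4) * k t) * cmod (p t))))"
    proof (rule order_trans[OF integral_norm_bound integral_mono])
      show "integrable M (\<lambda>t. cmod h * (32 / r\<^sup>2 * (exp (- (r/4) * k t) * cmod (p t))))"
        by (rule integrable_mult_right[OF intC])
      show bnd: "norm (E t) \<le> cmod h * (32 / r\<^sup>2 * (exp (- (r/4) * k t) * cmod (p t)))"
        if t: "t \<in> space M" for t
      proof -
        have k: "k t \<ge> 0" using nonneg[OF t] .
        have "cmod (exp (- h * cplx (k t)) - (\<Sum>i\<le>1. (- h * cplx (k t)) ^ i / fact i))
            \<le> exp \<bar>Re (- h * cplx (k t))\<bar> * (cmod (- h * cplx (k t)) ^ Suc 1) / fact 1"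
          by (rule Taylor_exp)
        also have "exp \<bar>Re (- h * cplx (k t))\<bar> \<le> exp (r * k t / 2)"
        proof -
          have "\<bar>Re h\<bar> * k t \<le> (r / 2) * k t"
            using h abs_Re_le_cmod[of h] k by (intro mult_right_mono) auto
          then show ?thesis using k by (simp add: abs_mult)
        qed
        finally have "cmod (exp (- h * cplx (k t)) - 1 + h * cplx (k t))
            \<le> exp (r * k t / 2) * ((cmod h)\<^sup>2 * (k t)\<^sup>2)"
          using k by (simp add: norm_mult power_mult_distrib algebra_simps power2_eq_square
              mult_right_mono)
        also have "\<dots> \<le> exp (r * k t / 2) * ((cmod h)\<^sup>2 * (32 / r\<^sup>2 * exp (r * k t / 4)))"
          using power2_exp_bound[OF r k] by (intro mult_left_mono) auto
        finally have A: "cmod (exp (- h * cplx (k t)) - 1 + h * cplx (k t))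
            \<le> exp (r * k t / 2) * ((cmod h)\<^sup>2 * (32 / r\<^sup>2 * exp (r * k t / 4)))" .
        have "norm (E t) = cmod (exp (- h * cplx (k t)) - 1 + h * cplx (k t)) / cmod h
            * (exp (- r * k t) * cmod (p t))"
          using h by (simp add: E_def norm_mult r_def flip: norm_divide) (simp add: field_simps)
        also have "\<dots> \<le> exp (r * k t / 2) * ((cmod h)\<^sup>2 * (32 / r\<^sup>2 * exp (r * k t / 4))) / cmod h
            * (exp (- r * k t) * cmod (p t))"
          using A by (intro mult_right_mono divide_right_mono) auto
        also have "\<dots> = cmod h * (32 / r\<^sup>2 * ((exp (r * k t / 2) * exp (r * k t / 4) * exp
            (- r * k t)) * cmod (p t)))"
          using h by (simp add: power2_eq_square)
        also have "exp (r * k t / 2) * exp (r * k t / 4) * exp (- r * k t) = exp (- (r/4) * k t)"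
          by (simp add: mult_exp_exp)
        finally show ?thesis .
      qed
      show "integrable M (\<lambda>t. norm (E t))"
      proof (rule integrable_norm, rule Bochner_Integration.integrable_bound)
        show "integrable M (\<lambda>t. cmod h * (32 / r\<^sup>2 * (exp (- (r/4) * k t) * cmod (p t))))"
          by (rule integrable_mult_right[OF intC])
        show "E \<in> borel_measurable M" unfolding E_def using mk mp by measurable
        show "AE t in M. norm (E t) \<le> norm (cmod h * (32 / r\<^sup>2 * (exp (- (r/4) * k t) * cmod (p t))))"
          using bnd by (intro AE_I2) (force intro: order_trans[OF _ abs_ge_self])
      qed
    qed
    also have "\<dots> = cmod h * C" unfolding C_def by simp
    finally show ?thesis .
  qed
  have "((\<lambda>h. (?G (\<eta> + h) - ?G \<eta>) / h) \<longlongrightarrow> - ?D) (at 0)"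
  proof (rule LIM_zero_cancel, rule Lim_null_comparison)
    show "((\<lambda>h. cmod h * C) \<longlongrightarrow> 0) (at 0)"
      by (intro tendsto_eq_intros) auto
    show "\<forall>\<^sub>F h in at 0. norm ((?G (\<eta> + h) - ?G \<eta>) / h - (- ?D)) \<le> cmod h * C"
    proof (rule eventually_mono)
      show "\<forall>\<^sub>F h in at 0. h \<noteq> 0 \<and> cmod h \<le> r / 2"
        unfolding eventually_at using r by (intro exI[of _ "r/2"]) auto
    qed (use est in blast)
  qed
  then show ?thesis unfolding DERIV_def .
qed

end

lemma Gamma_integral_scaled:
  assumes "0 < (s::real)" "0 < a"
  shows "integrable half_line (\<lambda>u. exp (- a * u) * u powr (s - 1))"
    and "(LINT u|half_line. exp (- a * u) * u powr (s - 1)) = Gamma s * a powr (- s)"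
proof -
  let ?f = "\<lambda>t::real. t powr (s - 1) / exp t"
  have "(?f has_integral Gamma s) {0..}" by (rule Gamma_integral_real[OF assms(1)])
  then have "(?f has_integral Gamma s) {0<..}"
    by (rule has_integral_spike_set_eq[THEN iffD1, rotated -1])
      (auto intro: negligible_subset[of "{0}"])
  then have f: "?f absolutely_integrable_on {0<..}" "integral {0<..} ?f = Gamma s"
    by (auto intro!: nonnegative_absolutely_integrable_1 simp: integral_unique has_integral_integrable)
  have img: "(\<lambda>u. a * u) ` {0<..} = {0<..}"
    using assms by (auto intro!: image_eqI[of _ _ "_ / a"])
  have "(\<lambda>u. \<bar>a\<bar> *\<^sub>R ?f (a * u)) absolutely_integrable_on {0<..} \<and>
      integral {0<..} (\<lambda>u. \<bar>a\<bar> *\<^sub>R ?f (a * u)) = Gamma s \<longleftrightarrow>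
      ?f absolutely_integrable_on (\<lambda>u. a * u) ` {0<..} \<and> integral ((\<lambda>u. a * u) ` {0<..}) ?f = Gamma s"
    by (rule has_absolute_integral_change_of_variables_real)
      (auto intro!: derivative_eq_intros inj_onI simp: assms(2)[THEN less_imp_neq, symmetric])
  then have *: "(\<lambda>u. a * ?f (a * u)) absolutely_integrable_on {0<..}"
      "integral {0<..} (\<lambda>u. a * ?f (a * u)) = Gamma s"
    using f img assms by auto
  have eq: "a powr (-s) * (a * ?f (a * u)) = exp (- a * u) * u powr (s - 1)" if "u > 0" for u
    using assms that by (simp add: powr_mult exp_minus powr_diff powr_minus field_simps)
  have int': "integrable half_line (\<lambda>u. a * ?f (a * u))"
    using *(1) unfolding set_integrable_def by (subst integrable_restrict_space) simp_all
  then have int: "integrable half_line (\<lambda>u. a powr (-s) * (a * ?f (a * u)))"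
    by (rule integrable_mult_right)
  have val: "integral\<^sup>L half_line (\<lambda>u. a powr (-s) * (a * ?f (a * u))) = Gamma s * a powr (-s)"
  proof -
    have "integral\<^sup>L half_line (\<lambda>u. a * ?f (a * u)) = Gamma s"
      using *(2) lebesgue_integral_eq_integral[OF int'] by simp
    then show ?thesis by (simp only: integral_mult_right_zero mult.commute)
  qed
  have eq': "a powr (-s) * (a * ?f (a * u)) = exp (- a * u) * u powr (s - 1)" if
      "u \<in> space half_line" for u
    using that by (intro eq) (simp add: space_restrict_space)
  show "integrable half_line (\<lambda>u. exp (- a * u) * u powr (s - 1))"
    by (rule iffD1[OF Bochner_Integration.integrable_cong[OF refl] int]) (rule eq')
  show "(LINT u|half_line. exp (- a * u) * u powr (s - 1)) = Gamma s * a powr (- s)"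
    by (rule trans[OF Bochner_Integration.integral_cong[OF refl] val]) (rule eq'[symmetric])
qed

lemma half_line_measurable:
  assumes "f \<in> borel_measurable borel"
  shows "f \<in> borel_measurable half_line"
proof -
  have "f \<in> borel_measurable lebesgue"
    using assms by (intro measurable_completion) simp
  then show ?thesis by (rule measurable_restrict_space1)
qed

abbreviation (input) gkern :: "complex \<Rightarrow> real \<Rightarrow> real \<Rightarrow> complex" where
  "gkern \<zeta> s u \<equiv> exp (- \<zeta> * cplx u) * cplx (u powr (s - 1))"

definition gamma_laplace :: "real \<Rightarrow> complex \<Rightarrow> complex" where
  "gamma_laplace s \<zeta> = (LINT u|half_line. gkern \<zeta> s u)"

lemma gamma_laplace_eq:
  assumes s: "0 < s" and "0 < Re \<zeta>"
  shows "gamma_laplace s \<zeta> = cplx (Gamma s) * \<zeta> powr (- cplx s)"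
proof -
  let ?S = "{w. 0 < Re w}"
  have "gamma_laplace s w - cplx (Gamma s) * w powr (- cplx s) = 0"
    if w: "w \<in> ?S" for w
  proof (rule analytic_continuation[of
        "\<lambda>w. gamma_laplace s w - cplx (Gamma s) * w powr (- cplx s)"
        ?S "cplx ` {0<..}" 1])
    have "(gamma_laplace s has_field_derivative
        - (LINT u|half_line. exp (- v * cplx u) * (cplx u * cplx (u powr (s - 1))))) (at v)"
      if "Re v > 0" for v
      unfolding gamma_laplace_def[abs_def]
      by (rule laplace_has_field_derivative)
        (use that s in \<open>auto intro!: half_line_measurable Gamma_integral_scaled(1)[simplified] simp:
            space_restrict_space\<close>)
    then have "gamma_laplace s holomorphic_on ?S"
      by (intro holomorphic_onI) (auto simp: field_differentiable_def intro:
          has_field_derivative_at_within)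
    then show "(\<lambda>w. gamma_laplace s w - cplx (Gamma s) * w powr (- cplx s)) holomorphic_on ?S"
      by (intro holomorphic_intros) (auto simp: complex_nonpos_Reals_iff)
    show "open ?S" by (rule open_halfspace_Re_gt)
    show "connected ?S" by (intro convex_connected convex_halfspace_Re_gt)
    show "1 islimpt cplx ` {0<..}"
      unfolding islimpt_approachable
    proof (intro allI impI)
      fix e :: real assume "e > 0"
      then show "\<exists>x'\<in>cplx ` {0<..}. x' \<noteq> 1 \<and> dist x' 1 < e"
        by (intro bexI[of _ "cplx (1 + e/2)"] imageI) (auto simp: dist_norm norm_divide)
    qed
    fix v assume "v \<in> cplx ` {0<..}"
    then obtain a where a: "v = cplx a" "a > 0" by auto
    have "exp (- cplx a * cplx u) = cplx (exp (- a * u))" for u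
      by (metis exp_of_real of_real_minus of_real_mult)
    then have "gamma_laplace s v = (LINT u|half_line. cplx (exp (- a * u) * u powr (s - 1)))"
      unfolding gamma_laplace_def a by simp
    also have "\<dots> = cplx (Gamma s * a powr (- s))"
      using Gamma_integral_scaled(2)[OF s a(2)] by (simp only: integral_complex_of_real)
    also have "\<dots> = cplx (Gamma s) * v powr (- cplx s)"
      using a powr_of_real[of a "- s"] by simp
    finally show "gamma_laplace s v - cplx (Gamma s) * v powr (- cplx s) = 0"
      by simp
  qed (use w in auto)
  then show ?thesis using assms by simp
qed

section \<open>Macdonald-type integrals\<close>

abbreviation (input) mkern :: "complex \<Rightarrow> real \<Rightarrow> complex \<Rightarrow> real \<Rightarrow> complex" where
  "mkern \<zeta> s \<eta> u \<equiv> exp (- \<eta> * cplx (1 / u)) * gkern \<zeta> s u"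

text \<open>With \<open>\<zeta> = - i z\<^sup>1\<^sup>/\<^sup>2\<close> and \<open>\<eta> = \<zeta> x\<^sup>2 / 4\<close> this is, up to a power of \<open>x\<close>, the Macdonald function
  of order \<open>s\<close> at \<open>\<zeta> x\<close>.\<close>

definition macdonald :: "complex \<Rightarrow> real \<Rightarrow> complex \<Rightarrow> complex" where
  "macdonald \<zeta> s \<eta> = (LINT u|half_line. mkern \<zeta> s \<eta> u)"

lemma exp_minus_inverse_le:
  assumes "0 < (e::real)" "0 < u" "0 < n"
  shows "exp (- e * (1 / u)) \<le> (real n / e) ^ n * u ^ n"
proof -
  have "(1 + (e / u) / real n) ^ n \<le> exp (e / u)"
    using assms by (intro exp_ge_one_plus_x_over_n_power_n)
        (auto simp: field_simps add_nonneg_nonneg less_imp_le intro: order_trans[of _ 0])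
  moreover have "((e / u) / real n) ^ n \<le> (1 + (e / u) / real n) ^ n"
    using assms by (intro power_mono) auto
  ultimately have "((e / u) / real n) ^ n \<le> exp (e / u)" by linarith
  then have "1 / exp (e / u) \<le> 1 / ((e / u) / real n) ^ n"
    using assms by (intro divide_left_mono) auto
  also have "\<dots> = (real n / e) ^ n * u ^ n"
    by (simp add: power_divide power_mult_distrib)
  finally show ?thesis by (simp add: exp_minus inverse_eq_divide)
qed

context
  fixes \<zeta> :: complex
  assumes \<zeta>: "0 < Re \<zeta>"
begin

lemma macdonald_weight_measurable:
  "(\<lambda>u. gkern \<zeta> s u) \<in> borel_measurable half_line"
  by (intro half_line_measurable) measurable

lemma macdonald_dominated:
  assumes "0 < e"
  shows "integrable half_line (\<lambda>u. exp (- e * (1 / u)) *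
    cmod (gkern \<zeta> s u))"
proof -
  define n where "n = Suc (nat \<lceil>1 - s\<rceil>)"
  have n: "0 < n" "0 < s + real n" by (auto simp: n_def) linarith
  show ?thesis
  proof (rule Bochner_Integration.integrable_bound)
    show "integrable half_line (\<lambda>u. (real n / e) ^ n * (exp (- Re \<zeta> * u) * u powr (s + real n - 1)))"
      by (intro integrable_mult_right Gamma_integral_scaled(1) n \<zeta>)
    show "(\<lambda>u. exp (- e * (1 / u)) *
        cmod (gkern \<zeta> s u)) \<in> borel_measurable half_line"
      by (intro half_line_measurable) measurable
    show "AE u in half_line. norm (exp (- e * (1 / u)) *
        cmod (gkern \<zeta> s u))
      \<le> norm ((real n / e) ^ n * (exp (- Re \<zeta> * u) * u powr (s + real n - 1)))"
    proof (rule AE_half_lineI)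
      fix u :: real assume u: "0 < u"
      have "u powr (s + real n - 1) = u ^ n * u powr (s - 1)"
        using u by (simp add: powr_realpow[symmetric] powr_add[symmetric] algebra_simps)
      moreover have "exp (- e * (1 / u)) * (exp (- Re \<zeta> * u) * u powr (s - 1))
          \<le> ((real n / e) ^ n * u ^ n) * (exp (- Re \<zeta> * u) * u powr (s - 1))"
        by (intro mult_right_mono exp_minus_inverse_le assms u n) simp
      ultimately show "norm (exp (- e * (1 / u)) *
          cmod (gkern \<zeta> s u))
        \<le> norm ((real n / e) ^ n * (exp (- Re \<zeta> * u) * u powr (s + real n - 1)))"
        using assms u by (simp add: norm_mult abs_mult mult.assoc mult.left_commute)
    qed
  qed
qed

lemma macdonald_integrable:
  assumes "0 < Re \<eta>"
  shows "integrable half_line (\<lambda>u. mkern \<zeta> s \<eta> u)"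
  by (rule laplace_integrable[OF _ macdonald_weight_measurable _ macdonald_dominated assms])
    (auto intro!: half_line_measurable simp: space_restrict_space)

lemma macdonald_has_field_derivative:
  assumes "0 < Re \<eta>"
  shows "(macdonald \<zeta> s has_field_derivative - macdonald \<zeta> (s - 1) \<eta>) (at \<eta>)"
proof -
  have "(macdonald \<zeta> s has_field_derivative - (LINT u|half_line. exp (- \<eta> * cplx (1 / u)) *
     (cplx (1 / u) * gkern \<zeta> s u))) (at \<eta>)"
    unfolding macdonald_def[abs_def]
    by (rule laplace_has_field_derivative[OF _ macdonald_weight_measurable _ macdonald_dominated assms])
      (auto intro!: half_line_measurable simp: space_restrict_space)
  also have "(LINT u|half_line. exp (- \<eta> * cplx (1 / u)) *
     (cplx (1 / u) * gkern \<zeta> s u))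
     = macdonald \<zeta> (s - 1) \<eta>"
    unfolding macdonald_def
  proof (rule Bochner_Integration.integral_cong[OF refl])
    fix u assume "u \<in> space half_line"
    then have u: "u > 0" by (simp add: space_restrict_space)
    have "u powr (s - 1) = u * u powr (s - 1 - 1)"
      using u by (simp add: powr_mult_base)
    then show "exp (- \<eta> * cplx (1 / u)) *
     (cplx (1 / u) * gkern \<zeta> s u)
     = mkern \<zeta> (s - 1) \<eta> u"
      using u by simp
  qed
  finally show ?thesis .
qed

text \<open>Integration by parts for \<open>u\<^sup>s exp (- \<zeta> u - \<eta> / u)\<close>, whose boundary values vanish.\<close>

lemma macdonald_recurrence:
  assumes \<eta>: "0 < Re \<eta>"
  shows "cplx s * macdonald \<zeta> s \<eta> - \<zeta> * macdonald \<zeta> (s + 1) \<eta> + \<eta> * macdonald \<zeta> (s - 1) \<eta> = 0"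
proof -
  define G where "G = (\<lambda>s u. mkern \<zeta> s \<eta> u)"
  have G: "integrable half_line (G s)" "macdonald \<zeta> s \<eta> = integral\<^sup>L half_line (G s)" for s
    using macdonald_integrable[OF \<eta>] by (auto simp: G_def macdonald_def)
  define F where "F = (\<lambda>u. cplx s * G s u - \<zeta> * G (s + 1) u + \<eta> * G (s - 1) u)"
  have "integral\<^sup>L half_line F = 0 - 0"
  proof (rule integral_half_line_improper)
    show "integrable half_line F" unfolding F_def using G by auto
    have cG: "cmod (G (s + 1) u) = exp (- Re \<eta> / u - Re \<zeta> * u) * u powr s" if "u > 0" for u
    proof -
      have "cmod (G (s + 1) u) = exp (- Re \<eta> / u) * exp (- Re \<zeta> * u) * u powr s"
        by (simp add: G_def norm_mult)
      then show ?thesis by (simp add: mult_exp_exp)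
    qed
    have "((\<lambda>u. exp (- Re \<eta> / u - Re \<zeta> * u) * u powr s) \<longlongrightarrow> 0) (at_right 0)"
      using \<zeta> \<eta> by real_asymp
    then show "(G (s + 1) \<longlongrightarrow> 0) (at_right 0)"
      by (intro tendsto_norm_zero_cancel[of "G (s+1)"])
        (auto elim!: Lim_transform_eventually simp: cG eventually_at_right_less intro!:
            eventually_mono[OF eventually_at_right_less])
    have "((\<lambda>u. exp (- Re \<eta> / u - Re \<zeta> * u) * u powr s) \<longlongrightarrow> 0) at_top"
      using \<zeta> \<eta> by real_asymp
    then show "(G (s + 1) \<longlongrightarrow> 0) at_top"
      by (intro tendsto_norm_zero_cancel[of "G (s+1)"])
        (auto elim!: Lim_transform_eventually simp: cG intro!:
            eventually_mono[OF eventually_gt_at_top[of 0]])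
    fix a b :: real assume ab: "0 < a" "a \<le> b"
    show "(F has_integral G (s + 1) b - G (s + 1) a) {a..b}"
    proof (rule fundamental_theorem_of_calculus[OF ab(2)])
      fix u assume "u \<in> {a..b}"
      then have u: "u > 0" using ab by auto
      have e: "((\<lambda>u. exp (- \<eta> * cplx (1 / u))) has_vector_derivative
          \<eta> / (cplx u)\<^sup>2 * exp (- \<eta> * cplx (1 / u))) (at u within {a..b})"
      proof -
        have "((\<lambda>u::real. - \<eta> * cplx (1 / u)) has_vector_derivative \<eta> / (cplx u)\<^sup>2) (at u within {a..b})"
        proof -
          have "((\<lambda>u::real. 1 / u) has_real_derivative - 1 / u\<^sup>2) (at u within {a..b})"
            using u by (auto intro!: derivative_eq_intros simp: power2_eq_square)
          from has_vector_derivative_mult_right[OF has_vector_derivative_of_real[OF this], of "- \<eta>"]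
          show ?thesis by (simp add: algebra_simps)
        qed
        from field_vector_diff_chain_within[OF this, of exp, OF
            DERIV_exp[THEN has_field_derivative_at_within]]
        show ?thesis by (simp add: o_def mult.commute)
      qed
      have z: "((\<lambda>u. exp (- \<zeta> * cplx u)) has_vector_derivative
          - \<zeta> * exp (- \<zeta> * cplx u)) (at u within {a..b})"
      proof -
        have "((\<lambda>u::real. - \<zeta> * cplx u) has_vector_derivative - \<zeta>) (at u within {a..b})"
          by (auto intro!: derivative_eq_intros)
        from field_vector_diff_chain_within[OF this, of exp, OF
            DERIV_exp[THEN has_field_derivative_at_within]]
        show ?thesis by (simp add: o_def mult.commute)
      qed
      have p: "((\<lambda>u. cplx (u powr s)) has_vector_derivative
          cplx (s * u powr (s - 1))) (at u within {a..b})"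
        using u by (intro has_vector_derivative_of_real)
          (auto intro!: derivative_eq_intros simp:
              has_real_derivative_iff_has_vector_derivative[symmetric])
      have p1: "u powr (s - 1) = u * u powr (s - 1 - 1)" "u powr s = u * (u * u powr (s - 1 - 1))"
        using u by (simp_all add: powr_mult_base)
      have "F u = exp (- \<eta> * cplx (1 / u)) *
          (exp (- \<zeta> * cplx u) * cplx (s * u powr (s - 1)) +
           (- \<zeta> * exp (- \<zeta> * cplx u)) * cplx (u powr s)) +
          (\<eta> / (cplx u)\<^sup>2 * exp (- \<eta> * cplx (1 / u))) *
          (exp (- \<zeta> * cplx u) * cplx (u powr s))"
        using u unfolding F_def G_def by (simp add: p1 field_simps power2_eq_square)
      then show "(G (s + 1) has_vector_derivative F u) (at u within {a..b})"
        unfolding G_def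
        by (simp only: add_diff_cancel_right')
            (rule has_vector_derivative_mult[OF e has_vector_derivative_mult[OF z p]])
    qed
  qed
  then show ?thesis unfolding F_def G(2) using G(1) by simp
qed

lemma macdonald_reflection:
  assumes q: "0 < q"
  shows "macdonald \<zeta> (- s) (\<zeta> * cplx q) = cplx (q powr (- s)) * macdonald \<zeta> s (\<zeta> * cplx q)"
proof -
  define G where "G = (\<lambda>s u. mkern \<zeta> s (\<zeta> * cplx q) u)"
  have \<eta>: "0 < Re (\<zeta> * cplx q)" using \<zeta> q by simp
  have int: "integrable half_line (G s)" "macdonald \<zeta> s (\<zeta> * cplx q) = integral {0<..} (G s)" for s
    using macdonald_integrable[OF \<eta>, of s] integral_half_line_eq[of "G s"]
        by (auto simp: G_def macdonald_def)
  have img: "(\<lambda>u. q / u) ` {0<..} = {0<..}"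
    using q by (auto intro!: image_eqI[of _ _ "q / _"])
  have "(\<lambda>u. \<bar>- q / u\<^sup>2\<bar> *\<^sub>R G (- s) (q / u)) absolutely_integrable_on {0<..} \<and>
      integral {0<..} (\<lambda>u. \<bar>- q / u\<^sup>2\<bar> *\<^sub>R G (- s) (q / u)) = integral {0<..} (G (- s)) \<longleftrightarrow>
      G (- s) absolutely_integrable_on (\<lambda>u. q / u) ` {0<..} \<and>
      integral ((\<lambda>u. q / u) ` {0<..}) (G (- s)) = integral {0<..} (G (- s))"
    using q by (intro has_absolute_integral_change_of_variables_real)
      (auto intro!: derivative_eq_intros inj_onI simp: field_simps power2_eq_square)
  then have "integral {0<..} (G (- s)) = integral {0<..} (\<lambda>u. \<bar>- q / u\<^sup>2\<bar> *\<^sub>R G (- s) (q / u))"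
    using int(1)[of "- s"] img by (simp add: integrable_half_line_iff)
  also have "\<dots> = integral {0<..} (\<lambda>u. cplx (q powr (- s)) * G s u)"
  proof (rule Henstock_Kurzweil_Integration.integral_cong)
    fix u :: real assume "u \<in> {0<..}"
    then have u: "u > 0" by simp
    have pw: "q / u\<^sup>2 * (q / u) powr (- s - 1) = q powr (- s) * u powr (s - 1)"
    proof -
      have "q / u\<^sup>2 * (q / u) powr (- s - 1) = (q * q powr (- s - 1)) / (u * (u * u powr (- s - 1)))"
        using u q by (simp add: powr_divide power2_eq_square)
      also have "\<dots> = q powr (- s) / u powr (1 - s)"
        using u q by (simp add: powr_mult_base)
      also have "\<dots> = q powr (- s) * u powr (s - 1)"
        using powr_minus_divide[of u "1 - s"] by simp
      finally show ?thesis .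
    qed
    have "\<bar>- q / u\<^sup>2\<bar> *\<^sub>R G (- s) (q / u) = exp (- (\<zeta> * cplx q) * cplx (1 / (q / u))) *
       (exp (- \<zeta> * cplx (q / u)) * cplx (q / u\<^sup>2 * (q / u) powr (- s - 1)))"
      using q by (simp add: G_def scaleR_conv_of_real)
    also have "\<dots> = cplx (q powr (- s)) * G s u"
      using q u unfolding pw by (simp add: G_def algebra_simps)
    finally show "\<bar>- q / u\<^sup>2\<bar> *\<^sub>R G (- s) (q / u) = cplx (q powr (- s)) * G s u" .
  qed
  also have "\<dots> = cplx (q powr (- s)) * integral {0<..} (G s)"
    by (rule integral_mult_right)
  finally show ?thesis by (simp add: int(2))
qed

lemma gamma_weight_integrable:
  assumes "0 < s"
  shows "integrable half_line (\<lambda>u. cmod (gkern \<zeta> s u))"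
  using Gamma_integral_scaled(1)[OF assms \<zeta>] by (simp add: norm_mult)

lemma macdonald_tendsto:
  assumes s: "0 < s"
  shows "((\<lambda>q. macdonald \<zeta> s (\<zeta> * cplx q)) \<longlongrightarrow> gamma_laplace s \<zeta>) (at_right 0)"
  unfolding tendsto_at_iff_sequentially comp_def
proof (intro allI impI)
  fix X :: "nat \<Rightarrow> real" assume X: "\<forall>i. X i \<in> {0<..} - {0}" "X \<longlonglongrightarrow> 0"
  show "(\<lambda>n. macdonald \<zeta> s (\<zeta> * cplx (X n))) \<longlonglongrightarrow> gamma_laplace s \<zeta>"
    unfolding macdonald_def gamma_laplace_def
  proof (rule integral_dominated_convergence[OF _ _ gamma_weight_integrable[OF s]])
    show "(\<lambda>u. gkern \<zeta> s u) \<in> borel_measurable half_line"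
      by (rule macdonald_weight_measurable)
    show "(\<lambda>u. mkern \<zeta> s (\<zeta> * cplx (X n)) u) \<in> borel_measurable half_line" for n
      by (intro half_line_measurable) measurable
    show "AE u in half_line. (\<lambda>n. mkern \<zeta> s (\<zeta> * cplx (X n)) u)
        \<longlonglongrightarrow> gkern \<zeta> s u"
      by (rule AE_I2) (auto intro!: tendsto_eq_intros X(2))
    show "AE u in half_line. norm (mkern \<zeta> s (\<zeta> * cplx (X n)) u)
        \<le> cmod (gkern \<zeta> s u)" for n
    proof (rule AE_half_lineI)
      fix u :: real assume u: "0 < u"
      have "X n > 0" using X(1) by auto
      then have "exp (- (Re \<zeta> * X n / u)) \<le> 1" using u \<zeta> by simp
      then show "norm (mkern \<zeta> s (\<zeta> * cplx (X n)) u)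
        \<le> cmod (gkern \<zeta> s u)"
        unfolding norm_mult[of "exp (- (\<zeta> * _) * _)"] by (intro mult_left_le_one_le) auto
    qed
  qed
qed

text \<open>Half of the exponent is estimated by \<open>u + q / u \<ge> 2 q\<^sup>1\<^sup>/\<^sup>2\<close>, the other half keeps the integral
  finite.\<close>

lemma macdonald_bound:
  assumes s: "0 < s"
  shows "\<exists>C\<ge>0. \<forall>q>0. cmod (macdonald \<zeta> s (\<zeta> * cplx q)) \<le> C * exp (- Re \<zeta> * sqrt q)"
proof (intro exI conjI allI impI)
  define C where "C = (LINT u|half_line. exp (- (Re \<zeta> / 2) * u) * u powr (s - 1))"
  have r: "Re \<zeta> / 2 > 0" using \<zeta> by simp
  show "0 \<le> C" unfolding C_def by (rule Bochner_Integration.integral_nonneg) simp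
  fix q :: real assume q: "q > 0"
  have \<eta>: "0 < Re (\<zeta> * cplx q)" using \<zeta> q by simp
  have "cmod (macdonald \<zeta> s (\<zeta> * cplx q))
      \<le> (LINT u|half_line. exp (- Re \<zeta> * sqrt q) * (exp (- (Re \<zeta> / 2) * u) * u powr (s - 1)))"
    unfolding macdonald_def
  proof (rule order_trans[OF integral_norm_bound integral_mono])
    show "integrable half_line (\<lambda>u. norm (mkern \<zeta> s (\<zeta> * cplx q) u))"
      by (intro integrable_norm macdonald_integrable \<eta>)
    show "integrable half_line (\<lambda>u. exp (- Re \<zeta> * sqrt q) * (exp (- (Re \<zeta> / 2) * u) * u powr (s - 1)))"
      by (intro integrable_mult_right Gamma_integral_scaled s r)
    fix u assume "u \<in> space half_line"
    then have u: "u > 0" by (simp add: space_restrict_space)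
    have "0 \<le> (sqrt u - sqrt (q / u))\<^sup>2" by simp
    also have "\<dots> = u + q / u - 2 * sqrt q"
      using u q by (simp add: power2_diff real_sqrt_divide power_divide)
    finally have "2 * sqrt q \<le> u + q / u" by simp
    then have "Re \<zeta> / 2 * (2 * sqrt q) \<le> Re \<zeta> / 2 * (u + q / u)"
      using r by (intro mult_left_mono) auto
    moreover have "Re \<zeta> / 2 * (2 * sqrt q) = Re \<zeta> * sqrt q" by simp
    moreover have "Re \<zeta> / 2 * (u + q / u) = Re \<zeta> / 2 * u + Re \<zeta> / 2 * (q / u)"
      by (rule distrib_left)
    moreover have "0 \<le> Re \<zeta> / 2 * (q / u)" using r u q by simp
    moreover have "Re \<zeta> * q / u = 2 * (Re \<zeta> / 2 * (q / u))" "Re \<zeta> * u = 2 * (Re \<zeta> / 2 * u)" by simp_all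
    ultimately have "- (Re \<zeta> * q / u) - Re \<zeta> * u \<le> - Re \<zeta> * sqrt q - (Re \<zeta> / 2) * u"
      by linarith
    then have "exp (- (Re \<zeta> * q / u)) * exp (- (Re \<zeta> * u)) \<le> exp (- Re \<zeta> * sqrt q) * exp
        (- (Re \<zeta> / 2) * u)"
      by (simp add: mult_exp_exp)
    then have "exp (- (Re \<zeta> * q / u)) * exp (- (Re \<zeta> * u)) * u powr (s - 1)
        \<le> exp (- Re \<zeta> * sqrt q) * exp (- (Re \<zeta> / 2) * u) * u powr (s - 1)"
      by (rule mult_right_mono) simp
    then show "norm (mkern \<zeta> s (\<zeta> * cplx q) u)
        \<le> exp (- Re \<zeta> * sqrt q) * (exp (- (Re \<zeta> / 2) * u) * u powr (s - 1))"
      by (simp add: norm_mult mult.assoc)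
  qed
  also have "\<dots> = C * exp (- Re \<zeta> * sqrt q)" unfolding C_def by simp
  finally show "cmod (macdonald \<zeta> s (\<zeta> * cplx q)) \<le> C * exp (- Re \<zeta> * sqrt q)" .
qed

end

section \<open>Solutions of the Bessel equation\<close>

definition bessel_coeff :: "real \<Rightarrow> nat \<Rightarrow> complex" where
  "bessel_coeff \<mu> k = (-1) ^ k / fact k * rGamma (cplx \<mu> + of_nat k + 1)"

definition bessel_series :: "real \<Rightarrow> complex \<Rightarrow> complex" where
  "bessel_series \<mu> y = (\<Sum>k. bessel_coeff \<mu> k * y ^ k)"

lemma bessel_coeff_shift:
  "bessel_coeff \<mu> k = cplx (\<mu> + 1 + real k) * bessel_coeff (\<mu> + 1) k"
proof -
  have "(cplx \<mu> + of_nat k + 1) * rGamma (cplx \<mu> + of_nat k + 1 + 1)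
      = rGamma (cplx \<mu> + of_nat k + 1)"
    by (rule rGamma_plus1)
  then show ?thesis unfolding bessel_coeff_def by (simp add: algebra_simps)
qed

lemma bessel_coeff_diffs: "diffs (bessel_coeff \<mu>) k = - bessel_coeff (\<mu> + 1) k"
  unfolding diffs_def bessel_coeff_def by (simp add: divide_simps algebra_simps del: of_nat_Suc)
    (simp add: algebra_simps)

lemma bessel_series_summable: "summable (\<lambda>k. bessel_coeff \<mu> k * y ^ k)"
proof -
  obtain N where N: "real N \<ge> max (2 * cmod y) (1 - \<mu>)" using real_arch_simple by blast
  have "norm (bessel_coeff \<mu> (Suc k) * y ^ Suc k) \<le> 1/2 * norm (bessel_coeff \<mu> k * y ^ k)"
    if k: "k \<ge> N" for k
  proof -
    have k': "real k + 1 \<ge> 2 * cmod y" "\<mu> + real k + 1 \<ge> 1" using N k by linarith+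
    have "of_nat (Suc k) * bessel_coeff \<mu> (Suc k) = - bessel_coeff (\<mu> + 1) k"
      using bessel_coeff_diffs[of \<mu> k] by (simp add: diffs_def)
    then have e: "bessel_coeff \<mu> k = - cplx ((\<mu> + 1 + real k) * real (Suc k)) * bessel_coeff \<mu> (Suc k)"
      by (subst bessel_coeff_shift) (simp add: algebra_simps del: of_nat_Suc)
    have "2 * cmod y \<le> 1 * real (Suc k)" using k' by simp
    also have "\<dots> \<le> (\<mu> + 1 + real k) * real (Suc k)" using k' by (intro mult_right_mono) auto
    finally have "2 * cmod y \<le> \<bar>(\<mu> + 1 + real k) * real (Suc k)\<bar>" by linarith
    then have "2 * cmod y * (cmod (bessel_coeff \<mu> (Suc k)) * cmod (y ^ k))
        \<le> \<bar>(\<mu> + 1 + real k) * real (Suc k)\<bar> * (cmod (bessel_coeff \<mu> (Suc k)) * cmod (y ^ k))"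
      by (rule mult_right_mono) simp
    also have "\<dots> = norm (bessel_coeff \<mu> k * y ^ k)"
      unfolding e norm_mult norm_minus_cancel norm_of_real by simp
    finally show ?thesis by (simp add: norm_mult algebra_simps)
  qed
  then show ?thesis by (intro summable_ratio_test[of "1/2" N]) auto
qed

lemma bessel_series_has_field_derivative:
  "(bessel_series \<mu> has_field_derivative - bessel_series (\<mu> + 1) y) (at y)"
proof -
  have "((\<lambda>y. \<Sum>k. bessel_coeff \<mu> k * y ^ k) has_field_derivative
      (\<Sum>k. diffs (bessel_coeff \<mu>) k * y ^ k)) (at y)"
    by (rule termdiffs_strong_converges_everywhere) (rule bessel_series_summable)
  also have "(\<Sum>k. diffs (bessel_coeff \<mu>) k * y ^ k) = - bessel_series (\<mu> + 1) y"
    unfolding bessel_coeff_diffs bessel_series_def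
    by (subst suminf_minus[symmetric]) (auto simp: bessel_series_summable)
  finally show ?thesis unfolding bessel_series_def[abs_def] .
qed

lemma bessel_series_recurrence:
  "bessel_series \<mu> y = cplx (\<mu> + 1) * bessel_series (\<mu> + 1) y - y * bessel_series (\<mu> + 2) y"
proof -
  let ?c = "bessel_coeff (\<mu> + 1)"
  have "summable (\<lambda>n. diffs ?c n * y ^ n)"
    unfolding bessel_coeff_diffs using summable_minus[OF bessel_series_summable[of "\<mu> + 1 + 1" y]]
        by simp
  then have "(\<lambda>n. of_nat n * ?c n * y ^ (n - Suc 0)) sums (\<Sum>n. diffs ?c n * y ^ n)"
    by (rule diffs_equiv)
  also have "(\<Sum>n. diffs ?c n * y ^ n) = - bessel_series (\<mu> + 2) y"
    unfolding bessel_coeff_diffs bessel_series_def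
    by (subst suminf_minus[symmetric]) (auto simp: bessel_series_summable add.assoc)
  finally have "(\<lambda>n. y * (of_nat n * ?c n * y ^ (n - Suc 0))) sums (y * - bessel_series (\<mu> + 2) y)"
    by (rule sums_mult)
  moreover have "y * (of_nat n * ?c n * y ^ (n - Suc 0)) = of_nat n * ?c n * y ^ n" for n
    by (cases n) auto
  ultimately have "(\<lambda>n. of_nat n * ?c n * y ^ n) sums (y * - bessel_series (\<mu> + 2) y)" by simp
  from sums_add[OF sums_mult[OF summable_sums[OF bessel_series_summable[of "\<mu> + 1" y]], of
      "cplx (\<mu> + 1)"] this]
  have "(\<lambda>n. bessel_coeff \<mu> n * y ^ n) sums
      (cplx (\<mu> + 1) * bessel_series (\<mu> + 1) y + y * - bessel_series (\<mu> + 2) y)"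
    unfolding bessel_coeff_shift[of \<mu>] bessel_series_def by (simp add: algebra_simps)
  then show ?thesis unfolding bessel_series_def[of \<mu>] by (simp add: sums_iff)
qed

lemma bessel_series_0: "bessel_series \<mu> 0 = rGamma (cplx \<mu> + 1)"
  unfolding bessel_series_def by (subst powser_zero) (simp add: bessel_coeff_def)

abbreviation (input) bpot :: "real \<Rightarrow> real \<Rightarrow> complex" where
  "bpot \<nu> x \<equiv> cplx ((\<nu>\<^sup>2 - 1/4) / x\<^sup>2)"

abbreviation (input) sq4 :: "real \<Rightarrow> complex" where
  "sq4 x \<equiv> cplx (x\<^sup>2 / 4)"

definition bessel_solution :: "real \<Rightarrow> complex \<Rightarrow> (real \<Rightarrow> complex) \<Rightarrow> (real \<Rightarrow> complex) \<Rightarrow> bool" where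
  "bessel_solution \<nu> z f f' \<longleftrightarrow> (\<forall>x>0. (f has_vector_derivative f' x) (at x) \<and>
     (f' has_vector_derivative (bpot \<nu> x - z) * f x) (at x))"

definition wronskian :: "(real \<Rightarrow> complex) \<Rightarrow> (real \<Rightarrow> complex) \<Rightarrow> (real \<Rightarrow> complex) \<Rightarrow> (real \<Rightarrow> complex)
    \<Rightarrow> real \<Rightarrow> complex" where
  "wronskian f f' g g' x = f x * g' x - f' x * g x"

lemma bessel_solution_lincomb:
  assumes "bessel_solution \<nu> z f f'" "bessel_solution \<nu> z g g'"
  shows "bessel_solution \<nu> z (\<lambda>x. a * f x + b * g x) (\<lambda>x. a * f' x + b * g' x)"
  unfolding bessel_solution_def
proof (intro allI impI conjI)
  fix x :: real assume "x > 0"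
  then have d: "(f has_vector_derivative f' x) (at x)" "(g has_vector_derivative g' x) (at x)"
    "(f' has_vector_derivative (bpot \<nu> x - z) * f x) (at x)"
    "(g' has_vector_derivative (bpot \<nu> x - z) * g x) (at x)"
    using assms unfolding bessel_solution_def by auto
  show "((\<lambda>x. a * f x + b * g x) has_vector_derivative a * f' x + b * g' x) (at x)"
    by (intro has_vector_derivative_add has_vector_derivative_mult_right d)
  have "((\<lambda>x. a * f' x + b * g' x) has_vector_derivative
      a * ((bpot \<nu> x - z) * f x) + b * ((bpot \<nu> x - z) * g x)) (at x)"
    by (intro has_vector_derivative_add has_vector_derivative_mult_right d)
  moreover have "a * (c * f x) + b * (c * g x) = c * (a * f x + b * g x)" for c
    by (simp add: algebra_simps)
  ultimately show "((\<lambda>x. a * f' x + b * g' x) has_vector_derivative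
      (bpot \<nu> x - z) * (a * f x + b * g x)) (at x)"
    by simp
qed

lemma has_vector_derivative_wronskian:
  assumes "(f has_vector_derivative f' x) (at x)" "(g has_vector_derivative g' x) (at x)"
    "(f' has_vector_derivative f'') (at x)" "(g' has_vector_derivative g'') (at x)"
  shows "(wronskian f f' g g' has_vector_derivative f x * g'' - f'' * g x) (at x)"
proof -
  have "((\<lambda>x. f x * g' x - f' x * g x) has_vector_derivative
      (f x * g'' + f' x * g' x) - (f' x * g' x + f'' * g x)) (at x)"
    by (intro has_vector_derivative_diff has_vector_derivative_mult assms)
  then show ?thesis unfolding wronskian_def[abs_def] by simp
qed

lemma wronskian_constant:
  assumes f: "bessel_solution \<nu> z f f'" and g: "bessel_solution \<nu> z g g'" and x: "0 < x" "0 < y"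
  shows "wronskian f f' g g' x = wronskian f f' g g' y"
proof -
  have "(wronskian f f' g g' has_vector_derivative 0) (at t)" if t: "t > 0" for t
  proof -
    have "(wronskian f f' g g' has_vector_derivative
        f t * ((bpot \<nu> t - z) * g t) - ((bpot \<nu> t - z) * f t) * g t) (at t)"
      using f g t unfolding bessel_solution_def by (intro has_vector_derivative_wronskian) auto
    then show ?thesis by (simp add: algebra_simps)
  qed
  then have d: "(wronskian f f' g g' has_vector_derivative 0) (at t within {0<..})" if "t \<in> {0<..}"
      for t
    using that by (auto intro: has_vector_derivative_at_within)
  obtain c where "\<And>t. t \<in> {0<..} \<Longrightarrow> wronskian f f' g g' t = c"
    using has_vector_derivative_zero_constant[OF convex_real_interval(3) d] by blast
  then show ?thesis using x by simp
qed

text \<open>The solutions of the equation with \<open>z = 0\<close>, which describe the boundary values at the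
  origin.\<close>

abbreviation (input) pow_fun :: "real \<Rightarrow> real \<Rightarrow> complex" where
  "pow_fun s \<equiv> (\<lambda>x. cplx (x powr s))"

abbreviation (input) pow_fun' :: "real \<Rightarrow> real \<Rightarrow> complex" where
  "pow_fun' s \<equiv> (\<lambda>x. cplx (s * x powr (s - 1)))"

lemma has_vector_derivative_pow_fun:
  "0 < x \<Longrightarrow> (pow_fun s has_vector_derivative pow_fun' s x) (at x)"
  by (intro has_vector_derivative_of_real) (auto intro!: derivative_eq_intros)

lemma has_vector_derivative_pow_fun':
  assumes "0 < x"
  shows "(pow_fun' s has_vector_derivative cplx (s * (s - 1) / x\<^sup>2) * pow_fun s x) (at x)"
proof -
  have "((\<lambda>x. s * x powr (s - 1)) has_real_derivative s * ((s - 1) * x powr (s - 1 - 1))) (at x)"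
    using assms by (auto intro!: derivative_eq_intros)
  moreover have "x powr s = x * (x * x powr (s - 1 - 1))"
    using assms by (simp add: powr_mult_base)
  then have "s * ((s - 1) * x powr (s - 1 - 1)) = s * (s - 1) / x\<^sup>2 * x powr s"
    using assms by (simp add: power2_eq_square)
  ultimately show ?thesis
    unfolding of_real_mult[symmetric] by (intro has_vector_derivative_of_real) simp
qed

definition series_sol :: "real \<Rightarrow> complex \<Rightarrow> real \<Rightarrow> complex" where
  "series_sol \<mu> z x = pow_fun (1/2 + \<mu>) x * bessel_series \<mu> (z * sq4 x)"

definition series_sol' :: "real \<Rightarrow> complex \<Rightarrow> real \<Rightarrow> complex" where
  "series_sol' \<mu> z x = pow_fun' (1/2 + \<mu>) x * bessel_series \<mu> (z * sq4 x)
     - pow_fun (1/2 + \<mu>) x * (z * cplx (x / 2)) * bessel_series (\<mu> + 1) (z * sq4 x)"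

lemma has_vector_derivative_quadratic_arg:
  assumes "(f has_field_derivative d) (at (z * sq4 x))"
  shows "((\<lambda>x. f (z * sq4 x)) has_vector_derivative (z * cplx (x / 2)) * d) (at x)"
proof -
  have "((\<lambda>x::real. x\<^sup>2 / 4) has_real_derivative x / 2) (at x)"
    by (auto intro!: derivative_eq_intros)
  from field_vector_diff_chain_at[OF has_vector_derivative_mult_right[OF
      has_vector_derivative_of_real[OF this]] assms]
  show ?thesis by (simp add: o_def)
qed

text \<open>Both solutions used below have the form \<open>x\<^sup>r U(\<omega> x\<^sup>2 / 4)\<close>; the hypothesis on \<open>U\<close> is Bessel's
  equation in the variable \<open>\<omega> x\<^sup>2 / 4\<close>.\<close>

lemma bessel_solution_power_times:
  assumes \<mu>: "\<mu>\<^sup>2 = \<nu>\<^sup>2"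
    and U: "\<And>x. 0 < x \<Longrightarrow> (U has_field_derivative U1 (\<omega> * sq4 x)) (at (\<omega> * sq4 x))"
    and U1: "\<And>x. 0 < x \<Longrightarrow> (U1 has_field_derivative U2 (\<omega> * sq4 x)) (at (\<omega> * sq4 x))"
    and eq: "\<And>x. 0 < x \<Longrightarrow> \<omega> * ((\<omega> * sq4 x) * U2 (\<omega> * sq4 x)
      + cplx (\<mu> + 1) * U1 (\<omega> * sq4 x)) + z * U (\<omega> * sq4 x) = 0"
  shows "bessel_solution \<nu> z (\<lambda>x. pow_fun (1/2 + \<mu>) x * U (\<omega> * sq4 x))
    (\<lambda>x. pow_fun' (1/2 + \<mu>) x * U (\<omega> * sq4 x)
     + pow_fun (1/2 + \<mu>) x * (\<omega> * cplx (x / 2)) * U1 (\<omega> * sq4 x))"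
  unfolding bessel_solution_def
proof (intro allI impI conjI)
  fix x :: real assume x: "x > 0"
  define Y where "Y = (\<lambda>x. \<omega> * sq4 x)"
  define r where "r = 1/2 + \<mu>"
  note dU = has_vector_derivative_quadratic_arg[OF U[OF x]]
  note dU1 = has_vector_derivative_quadratic_arg[OF U1[OF x]]
  have d1: "((\<lambda>x. pow_fun r x * U (Y x)) has_vector_derivative
      pow_fun r x * ((\<omega> * cplx (x / 2)) * U1 (Y x)) + pow_fun' r x * U (Y x)) (at x)"
    unfolding Y_def by (intro has_vector_derivative_mult has_vector_derivative_pow_fun x dU)
  then show "((\<lambda>x. pow_fun (1/2 + \<mu>) x * U (\<omega> * sq4 x)) has_vector_derivative
      pow_fun' (1/2 + \<mu>) x * U (\<omega> * sq4 x)
     + pow_fun (1/2 + \<mu>) x * (\<omega> * cplx (x / 2)) * U1 (\<omega> * sq4 x)) (at x)"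
    by (simp add: Y_def r_def algebra_simps)
  have lin: "((\<lambda>x. \<omega> * cplx (x / 2)) has_vector_derivative \<omega> * cplx (1/2)) (at x)"
    by (intro has_vector_derivative_mult_right has_vector_derivative_of_real)
        (auto intro!: derivative_eq_intros)
  have "((\<lambda>x. pow_fun' r x * U (Y x) + pow_fun r x * (\<omega> * cplx (x / 2)) * U1 (Y x))
      has_vector_derivative
      (pow_fun' r x * ((\<omega> * cplx (x / 2)) * U1 (Y x)) + (cplx (r * (r - 1) / x\<^sup>2) * pow_fun r x) * U
          (Y x))
      + ((pow_fun r x * (\<omega> * cplx (x / 2))) * ((\<omega> * cplx (x / 2)) * U2 (Y x))
         + (pow_fun r x * (\<omega> * cplx (1/2)) + pow_fun' r x * (\<omega> * cplx (x / 2))) * U1 (Y x))) (at x)"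
    unfolding Y_def
    by (intro has_vector_derivative_add has_vector_derivative_mult has_vector_derivative_pow_fun
        has_vector_derivative_pow_fun' x dU dU1 lin)
  also have "(pow_fun' r x * ((\<omega> * cplx (x / 2)) * U1 (Y x)) +
      (cplx (r * (r - 1) / x\<^sup>2) * pow_fun r x) * U (Y x))
      + ((pow_fun r x * (\<omega> * cplx (x / 2))) * ((\<omega> * cplx (x / 2)) * U2 (Y x))
         + (pow_fun r x * (\<omega> * cplx (1/2)) + pow_fun' r x * (\<omega> * cplx (x / 2))) * U1 (Y x))
      = (bpot \<nu> x - z) * (pow_fun r x * U (Y x))"
  proof -
    have p': "pow_fun' r x * cplx (x / 2) = cplx (r / 2) * pow_fun r x"
      using x by (simp add: powr_mult_base mult_ac flip: of_real_mult)
    have r: "r * (r - 1) = \<nu>\<^sup>2 - 1/4" unfolding r_def \<mu>[symmetric]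
        by (simp add: power2_eq_square algebra_simps)
    have e: "z * U (Y x) = - (\<omega> * (Y x * U2 (Y x) + cplx (\<mu> + 1) * U1 (Y x)))"
      using eq[OF x] by (simp add: Y_def add_eq_0_iff)
    have "(pow_fun' r x * ((\<omega> * cplx (x / 2)) * U1 (Y x)) + (cplx (r * (r - 1) / x\<^sup>2) * pow_fun r x)
        * U (Y x))
      + ((pow_fun r x * (\<omega> * cplx (x / 2))) * ((\<omega> * cplx (x / 2)) * U2 (Y x))
         + (pow_fun r x * (\<omega> * cplx (1/2)) + pow_fun' r x * (\<omega> * cplx (x / 2))) * U1 (Y x))
      = cplx (r * (r - 1) / x\<^sup>2) * (pow_fun r x * U (Y x))
        + 2 * \<omega> * U1 (Y x) * (pow_fun' r x * cplx (x / 2))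
        + pow_fun r x * \<omega> * (cplx (1/2) * U1 (Y x) + (\<omega> * (cplx (x / 2) * cplx (x / 2))) * U2 (Y x))"
      by (simp add: algebra_simps)
    also have "\<dots> = cplx (r * (r - 1) / x\<^sup>2) * (pow_fun r x * U (Y x))
        + pow_fun r x * (\<omega> * (Y x * U2 (Y x) + cplx (\<mu> + 1) * U1 (Y x)))"
    proof -
      have Y: "\<omega> * (cplx (x / 2) * cplx (x / 2)) = Y x"
        by (simp add: Y_def power2_eq_square)
      have "cplx (\<mu> + 1) = 2 * cplx (r / 2) + cplx (1/2)"
        by (simp add: r_def add_divide_distrib)
      then show ?thesis unfolding p' Y by (simp only: distrib_left distrib_right mult_ac add_ac)
    qed
    also have "\<dots> = cplx (r * (r - 1) / x\<^sup>2) * (pow_fun r x * U (Y x)) - pow_fun r x * (z * U (Y x))"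
      unfolding e by simp
    finally show ?thesis unfolding r by (simp add: algebra_simps)
  qed
  finally show "((\<lambda>x. pow_fun' (1/2 + \<mu>) x * U (\<omega> * sq4 x)
     + pow_fun (1/2 + \<mu>) x * (\<omega> * cplx (x / 2)) * U1 (\<omega> * sq4 x)) has_vector_derivative
      (bpot \<nu> x - z) * (pow_fun (1/2 + \<mu>) x * U (\<omega> * sq4 x))) (at x)"
    by (simp add: Y_def r_def)
qed

lemma wronskian_power_times:
  assumes "0 < x"
  shows "wronskian (\<lambda>x. pow_fun (1/2 + \<mu>) x * U (\<omega> * sq4 x))
    (\<lambda>x. pow_fun' (1/2 + \<mu>) x * U (\<omega> * sq4 x)
     + pow_fun (1/2 + \<mu>) x * (\<omega> * cplx (x / 2)) * U1 (\<omega> * sq4 x))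
    (pow_fun s) (pow_fun' s) x =
    cplx (x powr (\<mu> + s - 1/2)) * (cplx (s - 1/2 - \<mu>) * U (\<omega> * sq4 x)
      - \<omega> * cplx (x\<^sup>2 / 2) * U1 (\<omega> * sq4 x))"
proof -
  have e: "x powr (1/2 + \<mu>) * x powr (s - 1) = x powr (\<mu> + s - 1/2)"
    "x powr (1/2 + \<mu> - 1) * x powr s = x powr (\<mu> + s - 1/2)"
    "x powr (1/2 + \<mu>) * x powr s = x * x powr (\<mu> + s - 1/2)"
    using assms by (simp_all add: powr_add[symmetric] powr_mult_base algebra_simps)
  have "wronskian (\<lambda>x. pow_fun (1/2 + \<mu>) x * U (\<omega> * sq4 x))
    (\<lambda>x. pow_fun' (1/2 + \<mu>) x * U (\<omega> * sq4 x)
     + pow_fun (1/2 + \<mu>) x * (\<omega> * cplx (x / 2)) * U1 (\<omega> * sq4 x))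
    (pow_fun s) (pow_fun' s) x =
    cplx (s * (x powr (1/2 + \<mu>) * x powr (s - 1))) * U (\<omega> * sq4 x)
    - cplx ((1/2 + \<mu>) * (x powr (1/2 + \<mu> - 1) * x powr s)) * U (\<omega> * sq4 x)
    - cplx (x powr (1/2 + \<mu>) * x powr s) * (\<omega> * cplx (x / 2)) * U1 (\<omega> * sq4 x)"
    unfolding wronskian_def by (simp add: algebra_simps)
  then show ?thesis unfolding e by (simp add: algebra_simps power2_eq_square)
qed

lemma series_sol'_eq:
  "series_sol' \<mu> z x = pow_fun' (1/2 + \<mu>) x * bessel_series \<mu> (z * sq4 x)
     + pow_fun (1/2 + \<mu>) x * (z * cplx (x / 2)) * - bessel_series (\<mu> + 1) (z * sq4 x)"
  by (simp add: series_sol'_def)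

lemma bessel_solution_series:
  assumes "\<mu>\<^sup>2 = \<nu>\<^sup>2"
  shows "bessel_solution \<nu> z (series_sol \<mu> z) (series_sol' \<mu> z)"
  unfolding series_sol_def[abs_def] series_sol'_eq[abs_def]
proof (rule bessel_solution_power_times[OF assms, where ?U2.0 = "bessel_series (\<mu> + 2)"])
  show "(bessel_series \<mu> has_field_derivative - bessel_series (\<mu> + 1) y) (at y)" for y
    by (rule bessel_series_has_field_derivative)
  show "((\<lambda>y. - bessel_series (\<mu> + 1) y) has_field_derivative bessel_series (\<mu> + 2) y) (at y)" for y
    using DERIV_minus[OF bessel_series_has_field_derivative[of "\<mu> + 1" y]] by (simp add: add.assoc)
qed (subst (3) bessel_series_recurrence, simp add: algebra_simps)

lemma tendsto_bessel_series:
  "((\<lambda>x. bessel_series \<mu> (z * sq4 x)) \<longlongrightarrow> rGamma (cplx \<mu> + 1)) (at_right 0)"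
proof -
  have "isCont (bessel_series \<mu>) 0"
    using bessel_series_has_field_derivative DERIV_isCont by blast
  moreover have "((\<lambda>x::real. z * sq4 x) \<longlongrightarrow> 0) (at_right 0)"
    by (auto intro!: tendsto_eq_intros)
  ultimately show ?thesis
    unfolding bessel_series_0[symmetric] by (metis isCont_tendsto_compose)
qed

lemma tendsto_wronskian_series:
  assumes "- 2 < \<mu> + s - 1/2" and "s - 1/2 = \<mu> \<or> s - 1/2 = - \<mu>"
  shows "(wronskian (series_sol \<mu> z) (series_sol' \<mu> z) (pow_fun s) (pow_fun' s) \<longlongrightarrow>
    cplx (s - 1/2 - \<mu>) * rGamma (cplx \<mu> + 1)) (at_right 0)"
proof -
  let ?a = "\<mu> + s - 1/2"
  have "((\<lambda>x. cplx (x powr ?a * (s - 1/2 - \<mu>)) * bessel_series \<mu> (z * sq4 x)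
     + z * cplx (x powr (?a + 2) / 2) * bessel_series (\<mu> + 1) (z * sq4 x))
    \<longlongrightarrow> cplx (s - 1/2 - \<mu>) * rGamma (cplx \<mu> + 1)
       + z * cplx (0 / 2) * rGamma (cplx (\<mu> + 1) + 1)) (at_right 0)"
  proof (intro tendsto_intros tendsto_bessel_series)
    show "((\<lambda>x. x powr ?a * (s - 1/2 - \<mu>)) \<longlongrightarrow> s - 1/2 - \<mu>) (at_right 0)"
      using assms(2)
    proof
      assume "s - 1/2 = - \<mu>"
      then have a: "?a = 0" by simp
      have "eventually (\<lambda>x. s - 1/2 - \<mu> = x powr ?a * (s - 1/2 - \<mu>)) (at_right 0)"
        unfolding a by (rule eventually_mono[OF eventually_at_right_less]) simp
      then show ?thesis by (rule Lim_transform_eventually[OF tendsto_const])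
    qed simp
    show "((\<lambda>x. x powr (?a + 2)) \<longlongrightarrow> 0) (at_right 0)"
      using assms(1) by real_asymp
  qed simp
  then have "((\<lambda>x. cplx (x powr ?a * (s - 1/2 - \<mu>)) * bessel_series \<mu> (z * sq4 x)
     + z * cplx (x powr (?a + 2) / 2) * bessel_series (\<mu> + 1) (z * sq4 x))
    \<longlongrightarrow> cplx (s - 1/2 - \<mu>) * rGamma (cplx \<mu> + 1)) (at_right 0)" by simp
  then show ?thesis
  proof (rule Lim_transform_eventually, intro eventually_mono[OF eventually_at_right_less])
    fix x :: real assume x: "0 < x"
    have "x powr (?a + 2) = x powr ?a * x\<^sup>2"
      using powr_add[of x ?a 2] x by simp
    then show "cplx (x powr ?a * (s - 1/2 - \<mu>)) * bessel_series \<mu> (z * sq4 x)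
     + z * cplx (x powr (?a + 2) / 2) * bessel_series (\<mu> + 1) (z * sq4 x)
     = wronskian (series_sol \<mu> z) (series_sol' \<mu> z) (pow_fun s) (pow_fun' s) x"
      unfolding series_sol_def[abs_def] series_sol'_eq[abs_def]
      by (subst wronskian_power_times[OF x]) (simp add: algebra_simps)
  qed
qed

section \<open>Boundary values at the origin\<close>

lemma wronskian_lincomb_left:
  "wronskian (\<lambda>x. a * f x + b * g x) (\<lambda>x. a * f' x + b * g' x) h h' x = a * wronskian f f' h h' x
      + b * wronskian g g' h h' x"
  by (simp add: wronskian_def algebra_simps)

abbreviation (input) bval_minus :: "real \<Rightarrow> (real \<Rightarrow> complex) \<Rightarrow> (real \<Rightarrow> complex) \<Rightarrow> real \<Rightarrow> complex" where
  "bval_minus \<nu> f f' \<equiv> wronskian f f' (pow_fun (1/2 - \<nu>)) (pow_fun' (1/2 - \<nu>))"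

abbreviation (input) bval_plus :: "real \<Rightarrow> (real \<Rightarrow> complex) \<Rightarrow> (real \<Rightarrow> complex) \<Rightarrow> real \<Rightarrow> complex" where
  "bval_plus \<nu> f f' \<equiv> wronskian f f' (pow_fun (1/2 + \<nu>)) (pow_fun' (1/2 + \<nu>))"

text \<open>On the half-line \<open>weyl\<close> is the function \<open>w\<^sub>z\<close> of the theorem, and \<open>cot \<theta> + krein_m\<close> is the
  coefficient \<^const>\<open>krein_coeff\<close>.\<close>

definition krein_m :: "real \<Rightarrow> complex \<Rightarrow> complex" where
  "krein_m \<nu> z = cplx (Gamma (1 - \<nu>)) * exp (- \<i> * cplx (\<nu> * pi)) /
       cplx (Gamma (1 + \<nu>) * 2 powr (2 * \<nu> + 1) * \<nu>) * cpow z \<nu>"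

definition weyl :: "real \<Rightarrow> complex \<Rightarrow> real \<Rightarrow> complex" where
  "weyl \<nu> z x = cplx (Gamma (1 - \<nu>) / (2 * \<nu>)) * series_sol (- \<nu>) z x
     + (- (krein_m \<nu> z * cplx (Gamma (1 + \<nu>)))) * series_sol \<nu> z x"

definition weyl' :: "real \<Rightarrow> complex \<Rightarrow> real \<Rightarrow> complex" where
  "weyl' \<nu> z x = cplx (Gamma (1 - \<nu>) / (2 * \<nu>)) * series_sol' (- \<nu>) z x
     + (- (krein_m \<nu> z * cplx (Gamma (1 + \<nu>)))) * series_sol' \<nu> z x"

context
  fixes \<nu> :: real
  assumes \<nu>: "0 < \<nu>" "\<nu> < 1"
begin

lemma pow_fun_wronskian:
  assumes "0 < x"
  shows "pow_fun (1/2 - \<nu>) x * pow_fun' (1/2 + \<nu>) x - pow_fun' (1/2 - \<nu>) x * pow_fun (1/2 + \<nu>) x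
    = cplx (2 * \<nu>)"
proof -
  have "x powr (1/2 - \<nu>) * ((1/2 + \<nu>) * x powr (1/2 + \<nu> - 1)) - (1/2 - \<nu>) * x powr (1/2 - \<nu> - 1)
      * x powr (1/2 + \<nu>)
      = (1/2 + \<nu>) * x powr ((1/2 - \<nu>) + (1/2 + \<nu> - 1)) - (1/2 - \<nu>) * x powr ((1/2 - \<nu> - 1) + (1/2 + \<nu>))"
    unfolding powr_add by simp
  also have "\<dots> = 2 * \<nu>" using assms by simp
  finally show ?thesis by (simp only: of_real_mult[symmetric] of_real_diff[symmetric])
qed

lemma wronskian_bval:
  assumes "0 < x"
  shows "cplx (2 * \<nu>) * wronskian f f' g g' x =
    bval_minus \<nu> f f' x * bval_plus \<nu> g g' x - bval_plus \<nu> f f' x * bval_minus \<nu> g g' x"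
  unfolding pow_fun_wronskian[OF assms, symmetric] wronskian_def by (simp only: algebra_simps)

lemma tendsto_wronskian_bval:
  assumes "(bval_minus \<nu> f f' \<longlongrightarrow> r) (at_right 0)" "(bval_plus \<nu> f f' \<longlongrightarrow> q) (at_right 0)"
    and "(bval_minus \<nu> g g' \<longlongrightarrow> r') (at_right 0)" "(bval_plus \<nu> g g' \<longlongrightarrow> q') (at_right 0)"
  shows "(wronskian f f' g g' \<longlongrightarrow> (r * q' - q * r') / cplx (2 * \<nu>)) (at_right 0)"
proof -
  have "((\<lambda>x. (bval_minus \<nu> f f' x * bval_plus \<nu> g g' x - bval_plus \<nu> f f' x * bval_minus \<nu> g g' x)
      / cplx (2 * \<nu>))
      \<longlongrightarrow> (r * q' - q * r') / cplx (2 * \<nu>)) (at_right 0)"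
    using \<nu> by (intro tendsto_intros assms) auto
  then show ?thesis
  proof (rule Lim_transform_eventually, intro eventually_mono[OF eventually_at_right_less])
    fix x :: real assume "0 < x"
    then show "(bval_minus \<nu> f f' x * bval_plus \<nu> g g' x - bval_plus \<nu> f f' x * bval_minus \<nu> g g' x)
        / cplx (2 * \<nu>)
        = wronskian f f' g g' x"
      using \<nu> wronskian_bval[of x f f' g g'] by (simp add: field_simps)
  qed
qed

lemma bval_series:
  "(bval_minus \<nu> (series_sol (- \<nu>) z) (series_sol' (- \<nu>) z) \<longlongrightarrow> 0) (at_right 0)"
  "(bval_plus \<nu> (series_sol (- \<nu>) z) (series_sol' (- \<nu>) z) \<longlongrightarrow> cplx (2 * \<nu>) * rGamma (1 - cplx \<nu>))
      (at_right 0)"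
  "(bval_minus \<nu> (series_sol \<nu> z) (series_sol' \<nu> z) \<longlongrightarrow> - cplx (2 * \<nu>) * rGamma (1 + cplx \<nu>))
      (at_right 0)"
  "(bval_plus \<nu> (series_sol \<nu> z) (series_sol' \<nu> z) \<longlongrightarrow> 0) (at_right 0)"
  using tendsto_wronskian_series[of "- \<nu>" "1/2 - \<nu>" z] tendsto_wronskian_series[of "- \<nu>" "1/2 + \<nu>" z]
    tendsto_wronskian_series[of \<nu> "1/2 - \<nu>" z] tendsto_wronskian_series[of \<nu> "1/2 + \<nu>" z] \<nu>
  by (simp_all add: add.commute)

lemma Gamma_rGamma_of_real:
  assumes "0 < t"
  shows "cplx (Gamma t) * rGamma (cplx t) = 1"
proof -
  have "Gamma t \<noteq> 0" using Gamma_real_pos[OF assms] by simp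
  then show ?thesis by (simp add: rGamma_inverse_Gamma Gamma_complex_of_real)
qed

lemma rGamma_nonzero: "rGamma (1 - cplx \<nu>) \<noteq> 0" "rGamma (1 + cplx \<nu>) \<noteq> 0"
  using Gamma_rGamma_of_real[of "1 - \<nu>"] Gamma_rGamma_of_real[of "1 + \<nu>"] \<nu> by auto

lemma bessel_solution_zero:
  assumes v: "bessel_solution \<nu> z v v'"
    and lim: "(bval_minus \<nu> v v' \<longlongrightarrow> 0) (at_right 0)" "(bval_plus \<nu> v v' \<longlongrightarrow> 0) (at_right 0)"
    and x: "0 < x"
  shows "v x = 0" "v' x = 0"
proof -
  note sm = bessel_solution_series[of "- \<nu>" \<nu> z, simplified]
  note sp = bessel_solution_series[of \<nu> \<nu> z, simplified]
  have const: "wronskian f f' g g' x = l"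
    if "bessel_solution \<nu> z f f'" "bessel_solution \<nu> z g g'"
        "(wronskian f f' g g' \<longlongrightarrow> l) (at_right 0)" for f f' g g' l
  proof -
    have "((\<lambda>_. wronskian f f' g g' x) \<longlongrightarrow> l) (at_right (0::real))"
      using that(3) by (rule Lim_transform_eventually)
        (intro eventually_mono[OF eventually_at_right_less] wronskian_constant[OF that(1,2) _ x])
    then show ?thesis by (simp add: tendsto_const_iff)
  qed
  have m: "wronskian v v' (series_sol (- \<nu>) z) (series_sol' (- \<nu>) z) x = 0"
    using const[OF v sm tendsto_wronskian_bval[OF lim bval_series(1,2)]] by simp
  have p: "wronskian v v' (series_sol \<nu> z) (series_sol' \<nu> z) x = 0"
    using const[OF v sp tendsto_wronskian_bval[OF lim bval_series(3,4)]] by simp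
  have n: "wronskian (series_sol (- \<nu>) z) (series_sol' (- \<nu>) z) (series_sol \<nu> z)
      (series_sol' \<nu> z) x \<noteq> 0"
    using const[OF sm sp tendsto_wronskian_bval[OF bval_series]] rGamma_nonzero \<nu> by simp
  have "v x * wronskian (series_sol (- \<nu>) z) (series_sol' (- \<nu>) z) (series_sol \<nu> z)
      (series_sol' \<nu> z) x = 0"
    "v' x * wronskian (series_sol (- \<nu>) z) (series_sol' (- \<nu>) z) (series_sol \<nu> z)
        (series_sol' \<nu> z) x = 0"
    using m p unfolding wronskian_def by algebra+
  then show "v x = 0" "v' x = 0" using n by auto
qed

section \<open>The square-integrable solution\<close>

lemma bessel_solution_weyl: "bessel_solution \<nu> z (weyl \<nu> z) (weyl' \<nu> z)"
  unfolding weyl_def[abs_def] weyl'_def[abs_def]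
  by (intro bessel_solution_lincomb bessel_solution_series) auto

lemma bval_weyl:
  "(bval_minus \<nu> (weyl \<nu> z) (weyl' \<nu> z) \<longlongrightarrow> cplx (2 * \<nu>) * krein_m \<nu> z) (at_right 0)"
  "(bval_plus \<nu> (weyl \<nu> z) (weyl' \<nu> z) \<longlongrightarrow> 1) (at_right 0)"
proof -
  note G = Gamma_rGamma_of_real[of "1 - \<nu>"] Gamma_rGamma_of_real[of "1 + \<nu>"]
  have "((\<lambda>x. cplx (Gamma (1 - \<nu>) / (2 * \<nu>)) * bval_minus \<nu> (series_sol (- \<nu>) z) (series_sol' (- \<nu>) z) x
      + (- (krein_m \<nu> z * cplx (Gamma (1 + \<nu>)))) * bval_minus \<nu> (series_sol \<nu> z) (series_sol' \<nu> z) x)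
    \<longlongrightarrow> cplx (Gamma (1 - \<nu>) / (2 * \<nu>)) * 0
      + (- (krein_m \<nu> z * cplx (Gamma (1 + \<nu>)))) * (- cplx (2 * \<nu>) * rGamma (1 + cplx \<nu>))) (at_right 0)"
    by (intro tendsto_intros bval_series)
  moreover have "cplx (Gamma (1 - \<nu>) / (2 * \<nu>)) * 0
      + (- (krein_m \<nu> z * cplx (Gamma (1 + \<nu>)))) * (- cplx (2 * \<nu>) * rGamma (1 + cplx \<nu>))
      = cplx (2 * \<nu>) * krein_m \<nu> z * (cplx (Gamma (1 + \<nu>)) * rGamma (cplx (1 + \<nu>)))"
    by simp
  moreover have "\<dots> = cplx (2 * \<nu>) * krein_m \<nu> z" using G(2) \<nu> by simp
  ultimately show "(bval_minus \<nu> (weyl \<nu> z) (weyl' \<nu> z) \<longlongrightarrow> cplx (2 * \<nu>) * krein_m \<nu> z) (at_right 0)"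
    unfolding weyl_def[abs_def] weyl'_def[abs_def] wronskian_lincomb_left[abs_def] by (simp only:)
  have "((\<lambda>x. cplx (Gamma (1 - \<nu>) / (2 * \<nu>)) * bval_plus \<nu> (series_sol (- \<nu>) z) (series_sol' (- \<nu>) z) x
      + (- (krein_m \<nu> z * cplx (Gamma (1 + \<nu>)))) * bval_plus \<nu> (series_sol \<nu> z) (series_sol' \<nu> z) x)
    \<longlongrightarrow> cplx (Gamma (1 - \<nu>) / (2 * \<nu>)) * (cplx (2 * \<nu>) * rGamma (1 - cplx \<nu>))
      + (- (krein_m \<nu> z * cplx (Gamma (1 + \<nu>)))) * 0) (at_right 0)"
    by (intro tendsto_intros bval_series)
  moreover have "cplx (Gamma (1 - \<nu>) / (2 * \<nu>)) * (cplx (2 * \<nu>) * rGamma (1 - cplx \<nu>))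
      + (- (krein_m \<nu> z * cplx (Gamma (1 + \<nu>)))) * 0
      = cplx (Gamma (1 - \<nu>)) * rGamma (cplx (1 - \<nu>))"
    using \<nu> by simp
  moreover have "\<dots> = 1" using G(1) \<nu> by simp
  ultimately show "(bval_plus \<nu> (weyl \<nu> z) (weyl' \<nu> z) \<longlongrightarrow> 1) (at_right 0)"
    unfolding weyl_def[abs_def] weyl'_def[abs_def] wronskian_lincomb_left[abs_def] by (simp only:)
qed

end

lemma Arg2pi_pos:
  assumes "z \<notin> \<real>\<^sub>\<ge>\<^sub>0"
  shows "0 < Arg2pi z" "Arg2pi z < 2 * pi" "z \<noteq> 0"
proof -
  have "Arg2pi z \<noteq> 0" using assms by (auto simp: Arg2pi_eq_0 complex_nonneg_Reals_iff
      complex_is_Real_iff)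
  then show "0 < Arg2pi z" "Arg2pi z < 2 * pi" "z \<noteq> 0"
    using Arg2pi[of z] assms by auto
qed

lemma cpow_exp: "z \<noteq> 0 \<Longrightarrow> cpow z \<beta> = exp (cplx (\<beta> * ln (cmod z)) + \<i> * cplx (\<beta> * Arg2pi z))"
proof -
  assume "z \<noteq> 0"
  then have "cplx (cmod z powr \<beta>) = exp (cplx (\<beta> * ln (cmod z)))"
    unfolding exp_of_real by (simp add: powr_def)
  then show ?thesis by (simp only: cpow_def cis_conv_exp exp_add)
qed

lemma cpow_add: "z \<noteq> 0 \<Longrightarrow> cpow z a * cpow z b = cpow z (a + b)"
  by (simp add: cpow_exp mult_exp_exp algebra_simps)

lemma cpow_zero: "z \<noteq> 0 \<Longrightarrow> cpow z 0 = 1"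
  by (simp add: cpow_exp)

lemma cpow_one: "z \<noteq> 0 \<Longrightarrow> cpow z 1 = z"
  using Arg2pi_eq[of z] by (simp add: cpow_def cis_conv_exp)

lemma cpow_nonzero: "z \<noteq> 0 \<Longrightarrow> cpow z a \<noteq> 0"
  by (simp add: cpow_exp)

lemma cpow_sqrt_powr:
  assumes z: "z \<notin> \<real>\<^sub>\<ge>\<^sub>0" and t: "0 < t"
  shows "(cpow z (1/2) * cplx t) powr cplx \<mu> = cpow z (\<mu> / 2) * cplx (t powr \<mu>)"
proof -
  note a = Arg2pi_pos[OF z]
  have "cpow z (1/2) * cplx t = exp (cplx (ln (cmod z) / 2 + ln t) + \<i> * cplx (Arg2pi z / 2))"
  proof -
    have "cplx t = exp (cplx (ln t))" using t by (simp only: exp_of_real exp_ln)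
    then have "cpow z (1/2) * cplx t = exp (cplx (1/2 * ln (cmod z)) + \<i> * cplx (1/2 * Arg2pi z))
        * exp (cplx (ln t))"
      using a by (simp only: cpow_exp not_False_eq_True)
    then show ?thesis by (simp add: mult_exp_exp algebra_simps)
  qed
  moreover have "Ln (exp (cplx (ln (cmod z) / 2 + ln t) + \<i> * cplx (Arg2pi z / 2)))
     = cplx (ln (cmod z) / 2 + ln t) + \<i> * cplx (Arg2pi z / 2)"
    using a by (intro Ln_exp) (auto simp: less_imp_le)
  ultimately have "(cpow z (1/2) * cplx t) powr cplx \<mu> =
     exp (cplx \<mu> * (cplx (ln (cmod z) / 2 + ln t) + \<i> * cplx (Arg2pi z / 2)))"
    by (simp add: powr_def)
  also have "\<dots> = exp (cplx (\<mu> / 2 * ln (cmod z)) + \<i> * cplx (\<mu> / 2 * Arg2pi z)) * exp (cplx (\<mu> * ln t))"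
    unfolding mult_exp_exp by (simp add: algebra_simps)
  also have "exp (cplx (\<mu> * ln t)) = cplx (t powr \<mu>)"
    using t by (simp only: exp_of_real) (simp add: powr_def)
  finally show ?thesis using a by (simp add: cpow_exp)
qed

lemma Bessel_J_series:
  assumes z: "z \<notin> \<real>\<^sub>\<ge>\<^sub>0" and x: "0 < x"
  shows "Bessel_J \<mu> (cpow z (1/2) * cplx x) =
    cpow z (\<mu> / 2) * cplx ((x / 2) powr \<mu>) * bessel_series \<mu> (z * sq4 x)"
proof -
  have h: "cpow z (1/2) * cplx x / 2 = cpow z (1/2) * cplx (x / 2)" by simp
  have sq: "(cpow z (1/2) * cplx (x / 2))\<^sup>2 = z * sq4 x"
    using cpow_add[of z "1/2" "1/2"] cpow_one[of z] Arg2pi_pos[OF z]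
    by (simp add: power2_eq_square mult_ac)
  show ?thesis
    unfolding Bessel_J_def h cpow_sqrt_powr[OF z half_gt_zero[OF x]] power_mult sq bessel_series_def
        bessel_coeff_def ..
qed

lemma w_fun_eq_weyl:
  assumes \<nu>: "0 < \<nu>" "\<nu> < 1" and z: "z \<notin> \<real>\<^sub>\<ge>\<^sub>0" and x: "0 < x"
  shows "w_fun \<nu> z x = weyl \<nu> z x"
proof -
  have zn: "z \<noteq> 0" using Arg2pi_pos[OF z] by simp
  have sin: "sin (\<nu> * pi) > 0" using \<nu> by (intro sin_gt_zero) auto
  have "\<nu> \<notin> \<int>"
    using \<nu> by (auto elim!: Ints_cases)
  then have Y: "Bessel_Y \<nu> s = (Bessel_J \<nu> s * cplx (cos (\<nu> * pi)) - Bessel_J (- \<nu>) s) / cplx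
      (sin (\<nu> * pi))" for s
    by (simp add: Bessel_Y_def Bessel_Y_nonint_def)
  define e where "e = exp (- \<i> * cplx (\<nu> * pi))"
  have e: "e = cplx (cos (\<nu> * pi)) - \<i> * cplx (sin (\<nu> * pi))"
    using exp_Euler[of "- cplx (\<nu> * pi)"]
    by (simp add: e_def cos_of_real sin_of_real flip: of_real_mult)
  have H: "\<i> * cplx (sin (\<nu> * pi)) * Hankel_H1 \<nu> s = Bessel_J (- \<nu>) s - e * Bessel_J \<nu> s" for s
    unfolding Hankel_H1_def Y e using sin by (simp add: field_simps)
  have "0 < 1 + \<nu>" using \<nu> by simp
  then have G: "Gamma (1 + \<nu>) \<noteq> 0" using Gamma_real_pos by (metis less_irrefl)
  let ?F = "\<lambda>\<mu>. bessel_series \<mu> (z * sq4 x)"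
  have c1: "cpow z (\<nu> / 2) * cpow z (- \<nu> / 2) = 1" "cpow z (\<nu> / 2) * cpow z (\<nu> / 2) = cpow z \<nu>"
    using cpow_add[OF zn, of "\<nu> / 2"] cpow_zero[OF zn] by simp_all
  have x1: "x powr (1/2) * (x / 2) powr (- \<nu>) / 2 powr (\<nu> + 1) = x powr (1/2 - \<nu>) / 2"
    "x powr (1/2) * (x / 2) powr \<nu> / 2 powr (\<nu> + 1) = x powr (1/2 + \<nu>) / 2 powr (2 * \<nu> + 1)"
  proof -
    have "x powr (1/2) * (x / 2) powr (- \<nu>) / 2 powr (\<nu> + 1) = (x powr (1/2) * x powr (- \<nu>)) /
        (2 powr (- \<nu>) * 2 powr (\<nu> + 1))"
      using x by (simp add: powr_divide)
    also have "\<dots> = x powr (1/2 - \<nu>) / 2" unfolding powr_add[symmetric] by simp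
    finally show "x powr (1/2) * (x / 2) powr (- \<nu>) / 2 powr (\<nu> + 1) = x powr (1/2 - \<nu>) / 2" .
    have "x powr (1/2) * (x / 2) powr \<nu> / 2 powr (\<nu> + 1) = (x powr (1/2) * x powr \<nu>) /
        (2 powr \<nu> * 2 powr (\<nu> + 1))"
      using x by (simp add: powr_divide)
    also have "\<dots> = x powr (1/2 + \<nu>) / 2 powr (2 * \<nu> + 1)"
      unfolding powr_add[symmetric] by (simp only: mult_2 add.assoc)
    finally show "x powr (1/2) * (x / 2) powr \<nu> / 2 powr (\<nu> + 1) = x powr (1/2 + \<nu>) / 2 powr
        (2 * \<nu> + 1)" .
  qed
  have "w_fun \<nu> z x = cplx (Gamma (1 - \<nu>) / \<nu>) * (cpow z (\<nu> / 2) * cplx (x powr (1/2) / 2 powr (\<nu> + 1))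
     * (\<i> * cplx (sin (\<nu> * pi)) * Hankel_H1 \<nu> (cpow z (1/2) * cplx x)))"
    unfolding w_fun_def by (simp add: mult_ac)
  also have "\<dots> = cplx (Gamma (1 - \<nu>) / \<nu>) *
     ((cpow z (\<nu> / 2) * cpow z (- \<nu> / 2)) * cplx
         (x powr (1/2) * (x / 2) powr (- \<nu>) / 2 powr (\<nu> + 1)) * ?F (- \<nu>)
      - e * (cpow z (\<nu> / 2) * cpow z (\<nu> / 2)) * cplx
          (x powr (1/2) * (x / 2) powr \<nu> / 2 powr (\<nu> + 1)) * ?F \<nu>)"
    unfolding H Bessel_J_series[OF z x] by (simp add: algebra_simps)
  also have "\<dots> = weyl \<nu> z x"
    unfolding c1 x1 weyl_def series_sol_def krein_m_def e_def[symmetric]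
    using G \<nu> by (simp add: field_simps)
  finally show ?thesis .
qed

lemma bessel_series_cnj: "bessel_series \<mu> (cnj y) = cnj (bessel_series \<mu> y)"
proof -
  have "cnj (bessel_coeff \<mu> k) = bessel_coeff \<mu> k" for k
  proof -
    have "rGamma (cplx (\<mu> + real k + 1)) = cplx (rGamma (\<mu> + real k + 1))"
      by (rule rGamma_complex_of_real)
    then show ?thesis by (simp add: bessel_coeff_def)
  qed
  then have "(\<lambda>k. bessel_coeff \<mu> k * cnj y ^ k) = (\<lambda>k. cnj (bessel_coeff \<mu> k * y ^ k))"
    by simp
  moreover have "(\<lambda>k. cnj (bessel_coeff \<mu> k * y ^ k)) sums cnj (bessel_series \<mu> y)"
    unfolding bessel_series_def sums_cnj by (intro summable_sums bessel_series_summable)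
  ultimately show ?thesis unfolding bessel_series_def[of _ "cnj y"] by (simp add: sums_iff)
qed

lemma krein_m_cis:
  "krein_m \<nu> z = cplx (Gamma (1 - \<nu>) / (Gamma (1 + \<nu>) * 2 powr (2 * \<nu> + 1) * \<nu>) * cmod z powr \<nu>)
      * cis (\<nu> * (Arg2pi z - pi))"
proof -
  have "exp (- \<i> * cplx (\<nu> * pi)) * cis (\<nu> * Arg2pi z) = cis (\<nu> * (Arg2pi z - pi))"
    by (simp add: cis_conv_exp mult_exp_exp algebra_simps)
  then have "exp (- \<i> * cplx (\<nu> * pi)) * cpow z \<nu> = cplx (cmod z powr \<nu>) * cis (\<nu> * (Arg2pi z - pi))"
    by (simp add: cpow_def mult_ac)
  moreover have "krein_m \<nu> z = cplx (Gamma (1 - \<nu>) / (Gamma (1 + \<nu>) * 2 powr (2 * \<nu> + 1) * \<nu>))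
      * (exp (- \<i> * cplx (\<nu> * pi)) * cpow z \<nu>)"
    by (simp add: krein_m_def)
  ultimately show ?thesis by simp
qed

lemma krein_m_cnj:
  assumes "z \<notin> \<real>\<^sub>\<ge>\<^sub>0"
  shows "krein_m \<nu> (cnj z) = cnj (krein_m \<nu> z)"
proof -
  have "Arg2pi (cnj z) = 2 * pi - Arg2pi z"
  proof (cases "z \<in> \<real>")
    case True
    then show ?thesis using Arg2pi_eq_0_pi[of z] Arg2pi_pos[OF assms] by (simp add: Arg2pi_cnj)
  qed (simp add: Arg2pi_cnj)
  then have "Arg2pi (cnj z) - pi = - (Arg2pi z - pi)" by simp
  then have "\<nu> * (Arg2pi (cnj z) - pi) = - (\<nu> * (Arg2pi z - pi))" by (simp only: mult_minus_right)
  then show ?thesis unfolding krein_m_cis by (simp add: cis_cnj)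
qed

lemma weyl_cnj:
  assumes "z \<notin> \<real>\<^sub>\<ge>\<^sub>0"
  shows "weyl \<nu> (cnj z) x = cnj (weyl \<nu> z x)"
proof -
  have "series_sol \<mu> (cnj z) x = cnj (series_sol \<mu> z x)" for \<mu>
    using bessel_series_cnj[of \<mu> "z * sq4 x"] by (simp add: series_sol_def)
  then show ?thesis unfolding weyl_def krein_m_cnj[OF assms] by simp
qed

lemma zeta_properties:
  assumes z: "z \<notin> \<real>\<^sub>\<ge>\<^sub>0"
  defines "\<zeta> \<equiv> - \<i> * cpow z (1/2)"
  shows "0 < Re \<zeta>" "\<zeta>\<^sup>2 = - z"
    "\<zeta> powr cplx \<nu> * \<zeta> powr cplx \<nu> = exp (- \<i> * cplx (\<nu> * pi)) * cpow z \<nu>"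
proof -
  note a = Arg2pi_pos[OF z]
  have mi: "exp (\<i> * cplx (- pi / 2)) = - \<i>"
    using cis_conv_exp[of "- pi / 2"] cis_minus_pi_half by simp
  have "\<zeta> = exp (\<i> * cplx (- pi / 2)) * exp (cplx (1/2 * ln (cmod z)) + \<i> * cplx (1/2 * Arg2pi z))"
    unfolding \<zeta>_def mi using a by (simp only: cpow_exp not_False_eq_True)
  then have \<zeta>: "\<zeta> = exp (cplx (ln (cmod z) / 2) + \<i> * cplx ((Arg2pi z - pi) / 2))"
    by (simp add: mult_exp_exp algebra_simps diff_divide_distrib)
  have "cos ((Arg2pi z - pi) / 2) > 0" using a by (intro cos_gt_zero_pi) auto
  then show "0 < Re \<zeta>" unfolding \<zeta> by (simp add: Re_exp)
  show "\<zeta>\<^sup>2 = - z"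
  proof -
    have "\<zeta>\<^sup>2 = (- \<i>)\<^sup>2 * (cpow z (1/2))\<^sup>2" by (simp only: \<zeta>_def power_mult_distrib)
    moreover have "(cpow z (1/2))\<^sup>2 = z"
      using cpow_add[of z "1/2" "1/2"] cpow_one[of z] a by (simp add: power2_eq_square)
    ultimately show ?thesis by simp
  qed
  have "Ln \<zeta> = cplx (ln (cmod z) / 2) + \<i> * cplx ((Arg2pi z - pi) / 2)"
    unfolding \<zeta> using a by (intro Ln_exp) auto
  then have "\<zeta> powr cplx \<nu> = exp (cplx \<nu> * (cplx (ln (cmod z) / 2) + \<i> * cplx ((Arg2pi z - pi) / 2)))"
    using \<zeta> by (simp add: powr_def)
  then show "\<zeta> powr cplx \<nu> * \<zeta> powr cplx \<nu> = exp (- \<i> * cplx (\<nu> * pi)) * cpow z \<nu>"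
    using a by (simp add: mult_exp_exp cpow_exp algebra_simps diff_divide_distrib add_divide_distrib)
qed

context
  fixes \<nu> :: real and z :: complex
  assumes \<nu>: "0 < \<nu>" "\<nu> < 1" and z: "z \<notin> \<real>\<^sub>\<ge>\<^sub>0"
begin

definition zeta :: complex where "zeta = - \<i> * cpow z (1/2)"

abbreviation (input) mac :: "real \<Rightarrow> real \<Rightarrow> complex" where
  "mac s x \<equiv> macdonald zeta s (zeta * sq4 x)"

definition macdonald_sol :: "real \<Rightarrow> complex" where
  "macdonald_sol x = pow_fun (1/2 + - \<nu>) x * mac \<nu> x"

definition macdonald_sol' :: "real \<Rightarrow> complex" where
  "macdonald_sol' x = pow_fun' (1/2 + - \<nu>) x * mac \<nu> x
     + pow_fun (1/2 + - \<nu>) x * (zeta * cplx (x / 2)) * - mac (\<nu> - 1) x"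

lemma zeta: "0 < Re zeta" "zeta\<^sup>2 = - z"
    "zeta powr cplx \<nu> * zeta powr cplx \<nu> = exp (- \<i> * cplx (\<nu> * pi)) * cpow z \<nu>"
  using zeta_properties[OF z] by (simp_all add: zeta_def)

lemma zeta_arg: "0 < x \<Longrightarrow> 0 < Re (zeta * sq4 x)"
  using zeta(1) by simp

lemma bessel_solution_macdonald: "bessel_solution \<nu> z macdonald_sol macdonald_sol'"
  unfolding macdonald_sol_def[abs_def] macdonald_sol'_def[abs_def]
proof (rule bessel_solution_power_times[where ?U2.0 = "macdonald zeta (\<nu> - 2)"])
  fix x :: real assume x: "0 < x"
  let ?\<eta> = "zeta * sq4 x"
  show "(macdonald zeta \<nu> has_field_derivative - macdonald zeta (\<nu> - 1) ?\<eta>) (at ?\<eta>)"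
    by (rule macdonald_has_field_derivative[OF zeta(1) zeta_arg[OF x]])
  show "((\<lambda>y. - macdonald zeta (\<nu> - 1) y) has_field_derivative macdonald zeta (\<nu> - 2) ?\<eta>) (at ?\<eta>)"
    using DERIV_minus[OF macdonald_has_field_derivative[OF zeta(1) zeta_arg[OF x], of "\<nu> - 1"]] by simp
  have rec: "cplx (\<nu> - 1) * macdonald zeta (\<nu> - 1) ?\<eta> - zeta * macdonald zeta \<nu> ?\<eta> + ?\<eta>
      * macdonald zeta (\<nu> - 2) ?\<eta> = 0"
    using macdonald_recurrence[OF zeta(1) zeta_arg[OF x], of "\<nu> - 1"] by simp
  have zz: "z = - (zeta * zeta)" using zeta(2) by (simp add: power2_eq_square)
  have zM: "z * M = - (zeta * zeta * M)" for M using arg_cong[OF zz, of "\<lambda>t. t * M"] by simp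
  have "zeta * (?\<eta> * macdonald zeta (\<nu> - 2) ?\<eta> + cplx (- \<nu> + 1) * - macdonald zeta (\<nu> - 1) ?\<eta>)
      + z * macdonald zeta \<nu> ?\<eta> =
    zeta * (cplx (\<nu> - 1) * macdonald zeta (\<nu> - 1) ?\<eta> - zeta * macdonald zeta \<nu> ?\<eta> + ?\<eta>
        * macdonald zeta (\<nu> - 2) ?\<eta>)"
    unfolding zM by (simp add: algebra_simps)
  then show "zeta * (?\<eta> * macdonald zeta (\<nu> - 2) ?\<eta> + cplx (- \<nu> + 1) * - macdonald zeta (\<nu> - 1) ?\<eta>)
      + z * macdonald zeta \<nu> ?\<eta> = 0"
    unfolding rec by simp
qed simp

lemma macdonald_shift:
  assumes "0 < x"
  shows "mac (\<nu> - 1) x =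
    cplx (4 powr (1 - \<nu>) * x powr (2 * \<nu> - 2)) * mac (1 - \<nu>) x"
proof -
  have "(x\<^sup>2 / 4) powr (\<nu> - 1) = (x powr 2) powr (\<nu> - 1) / 4 powr (\<nu> - 1)"
    using assms by (simp add: powr_divide)
  also have "\<dots> = x powr (2 * \<nu> - 2) * 4 powr (1 - \<nu>)"
    using powr_minus_divide[of 4 "\<nu> - 1"] unfolding powr_powr by (simp add: algebra_simps)
  finally show ?thesis
    using macdonald_reflection[OF zeta(1), of "x\<^sup>2 / 4" "1 - \<nu>"] assms by (simp add: mult.commute)
qed

lemma macdonald_sol_wronskian:
  assumes x: "0 < x"
  shows "bval_minus \<nu> macdonald_sol macdonald_sol' x =
      zeta * cplx (4 powr (1 - \<nu>) / 2) * mac (1 - \<nu>) x"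
    and "bval_plus \<nu> macdonald_sol macdonald_sol' x =
      cplx (2 * \<nu>) * mac \<nu> x
      + zeta * cplx (4 powr (1 - \<nu>) / 2 * x powr (2 * \<nu>)) * mac (1 - \<nu>) x"
proof -
  have e: "x powr (- (2 * \<nu>)) * x powr (2 * \<nu> - 2) * x\<^sup>2 = 1" "x powr (2 * \<nu> - 2) * x\<^sup>2 = x powr (2 * \<nu>)"
    using x by (simp_all add: powr_add[symmetric] flip: powr_numeral)
  let ?K = "mac (1 - \<nu>) x"
  have "bval_minus \<nu> macdonald_sol macdonald_sol' x =
      cplx (x powr (- \<nu> + (1/2 - \<nu>) - 1/2)) *
      (cplx (1/2 - \<nu> - 1/2 - - \<nu>) * mac \<nu> x
      - zeta * cplx (x\<^sup>2 / 2) * - mac (\<nu> - 1) x)"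
    unfolding macdonald_sol_def[abs_def] macdonald_sol'_def[abs_def]
        by (rule wronskian_power_times[OF x])
  also have "\<dots> = zeta * cplx (4 powr (1 - \<nu>) / 2 * (x powr (- (2 * \<nu>)) * x powr (2 * \<nu> - 2) * x\<^sup>2)) * ?K"
    unfolding macdonald_shift[OF x] by simp
  finally show "bval_minus \<nu> macdonald_sol macdonald_sol' x = zeta * cplx (4 powr (1 - \<nu>) / 2) * ?K"
    unfolding e by simp
  have "bval_plus \<nu> macdonald_sol macdonald_sol' x =
      cplx (x powr (- \<nu> + (1/2 + \<nu>) - 1/2)) *
      (cplx (1/2 + \<nu> - 1/2 - - \<nu>) * mac \<nu> x
      - zeta * cplx (x\<^sup>2 / 2) * - mac (\<nu> - 1) x)"
    unfolding macdonald_sol_def[abs_def] macdonald_sol'_def[abs_def]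
        by (rule wronskian_power_times[OF x])
  also have "\<dots> = cplx (2 * \<nu>) * mac \<nu> x
      + zeta * cplx (4 powr (1 - \<nu>) / 2 * (x powr (2 * \<nu> - 2) * x\<^sup>2)) * ?K"
    unfolding macdonald_shift[OF x] using x by simp
  finally show "bval_plus \<nu> macdonald_sol macdonald_sol' x =
      cplx (2 * \<nu>) * mac \<nu> x
      + zeta * cplx (4 powr (1 - \<nu>) / 2 * x powr (2 * \<nu>)) * ?K"
    unfolding e .
qed

lemma tendsto_macdonald_sq:
  assumes "0 < s"
  shows "((\<lambda>x. mac s x) \<longlongrightarrow> cplx (Gamma s) * zeta powr (- cplx s)) (at_right 0)"
proof -
  have "filterlim (\<lambda>x::real. x\<^sup>2 / 4) (at_right 0) (at_right 0)"
    by real_asymp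
  from filterlim_compose[OF macdonald_tendsto[OF zeta(1) assms] this] show ?thesis
    unfolding gamma_laplace_eq[OF assms zeta(1)] .
qed

lemma bval_macdonald_sol:
  "(bval_minus \<nu> macdonald_sol macdonald_sol' \<longlongrightarrow>
     zeta * cplx (4 powr (1 - \<nu>) / 2) * (cplx (Gamma (1 - \<nu>)) * zeta powr (- cplx (1 - \<nu>))))
         (at_right 0)"
  "(bval_plus \<nu> macdonald_sol macdonald_sol' \<longlongrightarrow>
     cplx (2 * \<nu>) * (cplx (Gamma \<nu>) * zeta powr (- cplx \<nu>))) (at_right 0)"
proof -
  have "((\<lambda>x. zeta * cplx (4 powr (1 - \<nu>) / 2) * mac (1 - \<nu>) x)
     \<longlongrightarrow> zeta * cplx (4 powr (1 - \<nu>) / 2) * (cplx (Gamma (1 - \<nu>)) * zeta powr (- cplx (1 - \<nu>))))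
         (at_right 0)"
    using \<nu> by (intro tendsto_intros tendsto_macdonald_sq) auto
  then show "(bval_minus \<nu> macdonald_sol macdonald_sol' \<longlongrightarrow>
     zeta * cplx (4 powr (1 - \<nu>) / 2) * (cplx (Gamma (1 - \<nu>)) * zeta powr (- cplx (1 - \<nu>))))
         (at_right 0)"
    by (rule Lim_transform_eventually)
      (intro eventually_mono[OF eventually_at_right_less] macdonald_sol_wronskian(1)[symmetric])
  have p: "((\<lambda>x. x powr (2 * \<nu>)) \<longlongrightarrow> 0) (at_right 0)" using \<nu> by real_asymp
  have "((\<lambda>x. cplx (2 * \<nu>) * mac \<nu> x
      + zeta * cplx (4 powr (1 - \<nu>) / 2 * x powr (2 * \<nu>)) * mac (1 - \<nu>) x)
     \<longlongrightarrow> cplx (2 * \<nu>) * (cplx (Gamma \<nu>) * zeta powr (- cplx \<nu>))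
      + zeta * cplx (4 powr (1 - \<nu>) / 2 * 0) * (cplx (Gamma (1 - \<nu>)) * zeta powr (- cplx (1 - \<nu>))))
          (at_right 0)"
    using \<nu> by (intro tendsto_intros tendsto_macdonald_sq p) auto
  then have "((\<lambda>x. cplx (2 * \<nu>) * mac \<nu> x
      + zeta * cplx (4 powr (1 - \<nu>) / 2 * x powr (2 * \<nu>)) * mac (1 - \<nu>) x)
     \<longlongrightarrow> cplx (2 * \<nu>) * (cplx (Gamma \<nu>) * zeta powr (- cplx \<nu>))) (at_right 0)"
    by simp
  then show "(bval_plus \<nu> macdonald_sol macdonald_sol' \<longlongrightarrow>
     cplx (2 * \<nu>) * (cplx (Gamma \<nu>) * zeta powr (- cplx \<nu>))) (at_right 0)"
    by (rule Lim_transform_eventually)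
      (intro eventually_mono[OF eventually_at_right_less] macdonald_sol_wronskian(2)[symmetric])
qed

definition weyl_factor :: complex where
  "weyl_factor = cplx (2 * \<nu>) * (cplx (Gamma \<nu>) * zeta powr (- cplx \<nu>))"

lemma weyl_factor_nonzero: "weyl_factor \<noteq> 0"
proof -
  have "Gamma \<nu> \<noteq> 0" using Gamma_real_pos[OF \<nu>(1)] by simp
  then show ?thesis using \<nu> zeta(1) by (auto simp: weyl_factor_def)
qed

lemma weyl_factor_krein_m:
  "weyl_factor * (cplx (2 * \<nu>) * krein_m \<nu> z) =
    zeta * cplx (4 powr (1 - \<nu>) / 2) * (cplx (Gamma (1 - \<nu>)) * zeta powr (- cplx (1 - \<nu>)))"
proof -
  have z0: "zeta \<noteq> 0" using zeta(1) by auto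
  have G: "\<nu> * Gamma \<nu> = Gamma (1 + \<nu>)" "Gamma (1 + \<nu>) \<noteq> 0"
  proof -
    have "\<nu> \<notin> \<int>\<^sub>\<le>\<^sub>0" using \<nu> by (auto dest: nonpos_Ints_nonpos)
    then show "\<nu> * Gamma \<nu> = Gamma (1 + \<nu>)" using Gamma_plus1[of \<nu>] by (simp add: add.commute)
    have "0 < 1 + \<nu>" using \<nu> by simp
    then show "Gamma (1 + \<nu>) \<noteq> 0" using Gamma_real_pos by (metis less_irrefl)
  qed
  have p1: "zeta powr (- cplx \<nu>) * (zeta powr cplx \<nu> * zeta powr cplx \<nu>) = zeta powr cplx \<nu>"
    using z0 by (simp add: powr_minus)
  have p2: "zeta * zeta powr (- cplx (1 - \<nu>)) = zeta powr cplx \<nu>"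
    using z0 powr_add[of zeta 1 "cplx \<nu> - 1"] by simp
  have two: "4 powr (1 - \<nu>) * 2 powr (2 * \<nu> + 1) = (8::real)"
  proof -
    have "(4::real) powr (1 - \<nu>) = 2 powr (2 * (1 - \<nu>))"
      using powr_powr[of "2::real" 2 "1 - \<nu>"] by simp
    then have "(4::real) powr (1 - \<nu>) * 2 powr (2 * \<nu> + 1) = 2 powr (2 * (1 - \<nu>) + (2 * \<nu> + 1))"
      by (simp only: powr_add)
    then show ?thesis by simp
  qed
  have "weyl_factor * (cplx (2 * \<nu>) * krein_m \<nu> z) =
     cplx (4 * \<nu> * (\<nu> * Gamma \<nu>) * Gamma (1 - \<nu>) / (Gamma (1 + \<nu>) * 2 powr (2 * \<nu> + 1) * \<nu>)) *
     (zeta powr (- cplx \<nu>) * (exp (- \<i> * cplx (\<nu> * pi)) * cpow z \<nu>))"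
    by (simp add: weyl_factor_def krein_m_def mult_ac)
  also have "\<dots> = cplx (4 * \<nu> * (\<nu> * Gamma \<nu>) * Gamma (1 - \<nu>) /
      (Gamma (1 + \<nu>) * 2 powr (2 * \<nu> + 1) * \<nu>)) * zeta powr cplx \<nu>"
    unfolding zeta(3)[symmetric] p1 ..
  also have "4 * \<nu> * (\<nu> * Gamma \<nu>) * Gamma (1 - \<nu>) / (Gamma (1 + \<nu>) * 2 powr (2 * \<nu> + 1) * \<nu>)
      = 4 powr (1 - \<nu>) / 2 * Gamma (1 - \<nu>)"
    unfolding G(1) using G(2) \<nu> two by (simp add: field_simps)
  finally show ?thesis unfolding p2[symmetric] by (simp add: mult_ac)
qed

lemma macdonald_sol_eq_weyl:
  assumes x: "0 < x"
  shows "macdonald_sol x = weyl_factor * weyl \<nu> z x" "macdonald_sol' x = weyl_factor * weyl' \<nu> z x"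
proof -
  let ?v = "\<lambda>x. 1 * macdonald_sol x + (- weyl_factor) * weyl \<nu> z x"
  let ?v' = "\<lambda>x. 1 * macdonald_sol' x + (- weyl_factor) * weyl' \<nu> z x"
  have s: "bessel_solution \<nu> z ?v ?v'"
    by (intro bessel_solution_lincomb bessel_solution_macdonald bessel_solution_weyl[OF \<nu>])
  have m: "(bval_minus \<nu> ?v ?v' \<longlongrightarrow> 0) (at_right 0)"
  proof -
    have "(bval_minus \<nu> ?v ?v' \<longlongrightarrow> 1 * (weyl_factor * (cplx (2 * \<nu>) * krein_m \<nu> z))
        + (- weyl_factor) * (cplx (2 * \<nu>) * krein_m \<nu> z)) (at_right 0)"
      unfolding wronskian_lincomb_left[abs_def]
      by (intro tendsto_intros bval_weyl[OF \<nu>] bval_macdonald_sol(1)[folded weyl_factor_krein_m])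
    then show ?thesis by simp
  qed
  have p: "(bval_plus \<nu> ?v ?v' \<longlongrightarrow> 0) (at_right 0)"
  proof -
    have "(bval_plus \<nu> ?v ?v' \<longlongrightarrow> 1 * weyl_factor + (- weyl_factor) * 1) (at_right 0)"
      unfolding wronskian_lincomb_left[abs_def]
      by (intro tendsto_intros bval_weyl[OF \<nu>] bval_macdonald_sol(2)[folded weyl_factor_def])
    then show ?thesis by simp
  qed
  show "macdonald_sol x = weyl_factor * weyl \<nu> z x" "macdonald_sol' x = weyl_factor * weyl' \<nu> z x"
    using bessel_solution_zero[OF \<nu> s m p x] by simp_all
qed

lemma weyl_decay:
  "\<exists>C \<delta>. 0 \<le> C \<and> 0 < \<delta> \<and> (\<forall>x>0. cmod (weyl \<nu> z x) \<le> C * (x powr (1/2 - \<nu>) * exp (- \<delta> * x))) \<and>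
     (\<forall>x\<ge>1. cmod (weyl' \<nu> z x) \<le> C * (x * exp (- \<delta> * x)))"
proof -
  obtain C1 where C1: "C1 \<ge> 0" "\<And>q. q > 0 \<Longrightarrow> cmod (macdonald zeta \<nu> (zeta * cplx q)) \<le> C1 * exp
      (- Re zeta * sqrt q)"
    using macdonald_bound[OF zeta(1) \<nu>(1)] by blast
  obtain C2 where C2: "C2 \<ge> 0" "\<And>q. q > 0 \<Longrightarrow> cmod (macdonald zeta (1 - \<nu>) (zeta * cplx q)) \<le> C2 * exp
      (- Re zeta * sqrt q)"
    using macdonald_bound[OF zeta(1), of "1 - \<nu>"] \<nu> by auto
  define \<delta> where "\<delta> = Re zeta / 2"
  have \<delta>: "\<delta> > 0" using zeta(1) by (simp add: \<delta>_def)
  have sq: "- Re zeta * sqrt (x\<^sup>2 / 4) = - \<delta> * x" if "x > 0" for x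
    using that by (simp add: \<delta>_def real_sqrt_divide)
  have M1: "cmod (mac \<nu> x) \<le> C1 * exp (- \<delta> * x)" if "x > 0" for x
    using C1(2)[of "x\<^sup>2 / 4"] that unfolding sq[OF that] by simp
  have M2: "cmod (mac (1 - \<nu>) x) \<le> C2 * exp (- \<delta> * x)" if "x > 0" for x
    using C2(2)[of "x\<^sup>2 / 4"] that unfolding sq[OF that] by simp
  define C where "C = (C1 + cmod zeta * (4 powr (1 - \<nu>) / 2) * C2) / cmod weyl_factor"
  have C0: "C1 + cmod zeta * (4 powr (1 - \<nu>) / 2) * C2 \<ge> 0" using C1(1) C2(1) by simp
  have Cge: "C \<ge> 0" using C0 by (simp add: C_def)
  have wf: "cmod weyl_factor > 0" using weyl_factor_nonzero by simp
  have A: "cmod (weyl \<nu> z x) \<le> C * (x powr (1/2 - \<nu>) * exp (- \<delta> * x))" if x: "x > 0" for x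
  proof -
    have "cmod weyl_factor * cmod (weyl \<nu> z x) = cmod (macdonald_sol x)"
      using macdonald_sol_eq_weyl(1)[OF x] by (simp add: norm_mult)
    also have "\<dots> = x powr (1/2 - \<nu>) * cmod (mac \<nu> x)"
      by (simp add: macdonald_sol_def norm_mult)
    also have "\<dots> \<le> x powr (1/2 - \<nu>) * (C1 * exp (- \<delta> * x))"
      by (intro mult_left_mono M1 x) simp
    also have "\<dots> \<le> (C1 + cmod zeta * (4 powr (1 - \<nu>) / 2) * C2) * (x powr (1/2 - \<nu>) * exp (- \<delta> * x))"
      using C2(1) by (simp add: algebra_simps)
    finally show ?thesis using wf by (simp add: C_def field_simps)
  qed
  have B: "cmod (weyl' \<nu> z x) \<le> C * (x * exp (- \<delta> * x))" if x1: "x \<ge> 1" for x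
  proof -
    have x: "x > 0" using x1 by simp
    let ?K = "mac (1 - \<nu>) x"
    have pw: "x powr (1/2 - \<nu>) * (x / 2) * (4 powr (1 - \<nu>) * x powr (2 * \<nu> - 2)) = 4 powr (1 - \<nu>)
        / 2 * x powr (\<nu> - 1/2)"
    proof -
      have "x powr (1/2 - \<nu>) * (x / 2) * (4 powr (1 - \<nu>) * x powr (2 * \<nu> - 2)) =
          4 powr (1 - \<nu>) / 2 * (x powr (1/2 - \<nu>) * x powr 1 * x powr (2 * \<nu> - 2))"
        using x by simp
      also have "x powr (1/2 - \<nu>) * x powr 1 * x powr (2 * \<nu> - 2) = x powr (\<nu> - 1/2)"
        unfolding powr_add[symmetric] by simp
      finally show ?thesis .
    qed
    have "cmod weyl_factor * cmod (weyl' \<nu> z x) = cmod (macdonald_sol' x)"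
      using macdonald_sol_eq_weyl(2)[OF x] by (simp add: norm_mult)
    also have "macdonald_sol' x = cplx ((1/2 - \<nu>) * x powr (- 1/2 - \<nu>)) * mac \<nu> x
       - zeta * cplx (x powr (1/2 - \<nu>) * (x / 2) * (4 powr (1 - \<nu>) * x powr (2 * \<nu> - 2))) * ?K"
      unfolding macdonald_sol'_def macdonald_shift[OF x] by simp
    also have "cmod \<dots> \<le> cmod (cplx ((1/2 - \<nu>) * x powr (- 1/2 - \<nu>)) * mac \<nu> x)
       + cmod (zeta * cplx (4 powr (1 - \<nu>) / 2 * x powr (\<nu> - 1/2)) * ?K)"
      unfolding pw by (rule norm_triangle_ineq4)
    also have "\<dots> = \<bar>1/2 - \<nu>\<bar> * x powr (- 1/2 - \<nu>) * cmod (mac \<nu> x)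
       + cmod zeta * (4 powr (1 - \<nu>) / 2 * x powr (\<nu> - 1/2)) * cmod ?K"
      unfolding norm_mult norm_of_real by (simp add: abs_mult)
    also have "\<dots> \<le> 1 * x * (C1 * exp (- \<delta> * x)) + cmod zeta * (4 powr (1 - \<nu>) / 2 * x) *
        (C2 * exp (- \<delta> * x))"
    proof (intro add_mono mult_mono M1 M2 x order_refl)
      show "x powr (- 1/2 - \<nu>) \<le> x" "x powr (\<nu> - 1/2) \<le> x"
        using powr_mono[of "- 1/2 - \<nu>" 1 x] powr_mono[of "\<nu> - 1/2" 1 x] x1 \<nu> by auto
    qed (use \<nu> x in auto)
    also have "\<dots> = (C1 + cmod zeta * (4 powr (1 - \<nu>) / 2) * C2) * (x * exp (- \<delta> * x))"
      by (simp add: algebra_simps)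
    finally show ?thesis using wf by (simp add: C_def field_simps)
  qed
  show ?thesis using Cge \<delta> A B by blast
qed

end

section \<open>The Hilbert space\<close>

lemma l2_rel_refl: "square_integrable f \<Longrightarrow> l2_rel f f"
  by (simp add: l2_rel_def)

lemma l2_cases: obtains f where "square_integrable f" "u = abs_l2 f"
  using Quotient3_abs_rep[OF Quotient3_l2, of u] Quotient3_rep_reflp[OF Quotient3_l2, of u]
  by (metis l2_rel_def)

lemma abs_l2_eq_iff:
  assumes "square_integrable f" "square_integrable g"
  shows "abs_l2 f = abs_l2 g \<longleftrightarrow> (AE x in half_line. f x = g x)"
  using Quotient3_rel[OF Quotient3_l2, of f g] assms by (auto simp: l2_rel_def)

lemma cinner_abs_l2:
  assumes "square_integrable f" "square_integrable g"
  shows "cinner (abs_l2 f) (abs_l2 g) = (LINT x|half_line. cnj (f x) * g x)"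
  using assms by (simp add: cinner.abs_eq l2_rel_refl)

lemma scaleC_abs_l2:
  "square_integrable f \<Longrightarrow> scaleC c (abs_l2 f) = abs_l2 (\<lambda>x. c * f x)"
  by (simp add: scaleC.abs_eq l2_rel_refl)

lemma plus_abs_l2:
  "square_integrable f \<Longrightarrow> square_integrable g \<Longrightarrow> abs_l2 f + abs_l2 g = abs_l2 (\<lambda>x. f x + g x)"
  by (simp add: plus_l2.abs_eq l2_rel_refl)

lemma minus_abs_l2:
  assumes "square_integrable f" "square_integrable g"
  shows "abs_l2 f - abs_l2 g = abs_l2 (\<lambda>x. f x - g x)"
  using plus_abs_l2[OF assms(1) square_integrable_scale[OF assms(2), of "-1"]] assms
  by (simp add: minus_l2_def scaleC_abs_l2)

lemma square_integrable_diff: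
  "square_integrable f \<Longrightarrow> square_integrable g \<Longrightarrow> square_integrable (\<lambda>x. f x - g x)"
  using square_integrable_add[of f "\<lambda>x. -1 * g x"] square_integrable_scale[of g "-1"] by simp

lemma norm_abs_l2:
  assumes "square_integrable f"
  shows "(norm (abs_l2 f))\<^sup>2 = (LINT x|half_line. (cmod (f x))\<^sup>2)"
proof -
  have "(norm (abs_l2 f))\<^sup>2 = Re (LINT x|half_line. cnj (f x) * f x)"
    using assms by (simp add: power2_norm_eq_inner inner_l2_def cinner_abs_l2)
  also have "(LINT x|half_line. cnj (f x) * f x) = (LINT x|half_line. cplx ((cmod (f x))\<^sup>2))"
    by (simp only: mult.commute [of "cnj _"] complex_norm_square)
  also have "\<dots> = cplx (LINT x|half_line. (cmod (f x))\<^sup>2)"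
    by (rule integral_complex_of_real)
  finally show ?thesis by simp
qed

lemma nn_integral_norm_abs_l2:
  assumes "square_integrable f"
  shows "(\<integral>\<^sup>+x. ennreal ((cmod (f x))\<^sup>2) \<partial>half_line) = ennreal ((norm (abs_l2 f))\<^sup>2)"
  unfolding norm_abs_l2[OF assms]
  using assms by (intro nn_integral_eq_integral) (auto simp: square_integrable_def)

lemma square_integrableI_nn_integral:
  assumes "f \<in> borel_measurable half_line" "(\<integral>\<^sup>+x. ennreal ((cmod (f x))\<^sup>2) \<partial>half_line) < \<infinity>"
  shows "square_integrable f"
  unfolding square_integrable_def
  using assms by (auto intro!: integrableI_bounded simp: less_top[symmetric])

lemma cinner_add_left: "cinner (u + v) w = cinner u w + cinner v w"
  by transfer (auto simp: l2_rel_def distrib_right square_integrable_mult_integrable)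

lemma cinner_add_right: "cinner w (u + v) = cinner w u + cinner w v"
  by transfer (auto simp: l2_rel_def distrib_left square_integrable_mult_integrable)

lemma cinner_scale_right: "cinner u (scaleC c v) = c * cinner u v"
  by transfer (simp add: mult.left_commute)

lemma cinner_scale_left: "cinner (scaleC c u) v = cnj c * cinner u v"
  by transfer (simp add: mult.assoc)

lemma cinner_commute: "cinner u v = cnj (cinner v u)"
  by transfer (simp add: Bochner_Integration.integral_cnj[symmetric] mult.commute)

lemma cinner_self: "cinner u u = cplx ((norm u)\<^sup>2)"
proof -
  have "Im (cinner u u) = 0"
    using cinner_commute[of u u] by (metis Reals_cnj_iff complex_is_Real_iff)
  then show ?thesis
    by (simp add: power2_norm_eq_inner inner_l2_def complex_eq_iff)
qed

lemma scaleC_add_right: "scaleC c (u + v) = scaleC c u + scaleC c v"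
  by transfer (auto simp: l2_rel_def distrib_left intro!: square_integrable_add square_integrable_scale)

lemma scaleC_add_left: "scaleC (c + d) u = scaleC c u + scaleC d u"
  by transfer (auto simp: l2_rel_def distrib_right intro!: square_integrable_add
      square_integrable_scale)

lemma scaleC_scaleC: "scaleC c (scaleC d u) = scaleC (c * d) u"
  by transfer (auto simp: l2_rel_def mult.assoc intro!: square_integrable_scale)

lemma scaleC_zero_left: "scaleC 0 u = 0"
  by transfer (auto simp: l2_rel_def square_integrable_zero)

lemma scaleR_eq_scaleC: "r *\<^sub>R (u :: l2) = scaleC (cplx r) u"
  by (simp add: scaleR_l2_def)

lemma norm_scaleC: "norm (scaleC c u) = cmod c * norm u"
proof (rule power2_eq_imp_eq)
  have "cplx ((norm (scaleC c u))\<^sup>2) = cplx ((cmod c * norm u)\<^sup>2)"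
    unfolding cinner_self[symmetric] cinner_scale_left cinner_scale_right
    by (simp only: cinner_self power_mult_distrib complex_norm_square of_real_mult mult_ac)
  then show "(norm (scaleC c u))\<^sup>2 = (cmod c * norm u)\<^sup>2" by (simp only: of_real_eq_iff)
qed auto

lemma cinner_diff_right: "cinner w (u - v) = cinner w u - cinner w v"
  by (simp add: minus_l2_def cinner_add_right cinner_scale_right)

lemma cinner_diff_left: "cinner (u - v) w = cinner u w - cinner v w"
  by (simp add: minus_l2_def cinner_add_left cinner_scale_left)

lemma cinner_zero_right: "cinner w 0 = 0"
  using cinner_diff_right[of w 0 0] by simp

lemma cinner_zero_left: "cinner 0 w = 0"
  using cinner_diff_left[of 0 0 w] by simp

lemma cinner_sum_right: "cinner w (\<Sum>e\<in>F. u e) = (\<Sum>e\<in>F. cinner w (u e))"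
  by (induction F rule: infinite_finite_induct) (simp_all add: cinner_zero_right cinner_add_right)

lemma cinner_sum_left: "cinner (\<Sum>e\<in>F. u e) w = (\<Sum>e\<in>F. cinner (u e) w)"
  by (induction F rule: infinite_finite_induct) (simp_all add: cinner_zero_left cinner_add_left)

lemma norm_cinner_le: "cmod (cinner u v) \<le> norm u * norm v"
proof (cases "cinner u v = 0")
  case False
  define c where "c = cinner u v / cplx (cmod (cinner u v))"
  have c: "cmod c = 1" using False by (simp add: c_def norm_divide)
  have "cnj c * cinner u v = cplx (cmod (cinner u v))"
    using False by (simp add: c_def complex_norm_square[symmetric] power2_eq_square
        mult.commute[of "cnj _"])
  then have "cmod (cinner u v) = inner (scaleC c u) v"
    by (simp add: inner_l2_def cinner_scale_left)
  also have "\<dots> \<le> norm (scaleC c u) * norm v" by (rule norm_cauchy_schwarz)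
  finally show ?thesis by (simp add: norm_scaleC c)
qed simp

lemma tendsto_cinner_right:
  assumes "X \<longlonglongrightarrow> v"
  shows "(\<lambda>n. cinner u (X n)) \<longlonglongrightarrow> cinner u v"
proof (rule LIM_zero_cancel, rule Lim_null_comparison)
  show "\<forall>\<^sub>F n in sequentially. norm (cinner u (X n) - cinner u v) \<le> norm u * norm (X n - v)"
    using norm_cinner_le[of u] by (simp add: cinner_diff_right[symmetric])
  show "(\<lambda>n. norm u * norm (X n - v)) \<longlonglongrightarrow> 0"
    using assms by (intro tendsto_mult_right_zero tendsto_norm_zero LIM_zero)
qed

text \<open>Riesz--Fischer: along a subsequence with \<open>\<parallel>f (n + 1) - f n\<parallel> \<le> 2\<^sup>-\<^sup>n\<close> the sum of
  \<open>2\<^sup>n \<bar>f (n + 1) - f n\<bar>\<^sup>2\<close> is integrable, which forces pointwise convergence almost everywhere; Fatou's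
  lemma upgrades this to convergence in norm.\<close>

lemma l2_complete:
  fixes X :: "nat \<Rightarrow> l2"
  assumes X: "Cauchy X"
  shows "convergent X"
proof -
  have "\<forall>n. \<exists>N. \<forall>k\<ge>N. \<forall>l\<ge>N. norm (X k - X l) < (1/2) ^ n"
    using X unfolding Cauchy_iff by (metis half_gt_zero_iff zero_less_one zero_less_power)
  then obtain N where N: "\<And>n k l. k \<ge> N n \<Longrightarrow> l \<ge> N n \<Longrightarrow> norm (X k - X l) < (1/2) ^ n"
    by metis
  define r where "r = rec_nat (N 0) (\<lambda>n m. max (Suc m) (N (Suc n)))"
  have r: "strict_mono r" "r n \<ge> N n" for n
    unfolding strict_mono_Suc_iff by (auto simp: r_def) (cases n; simp)
  obtain f where f: "\<And>n. square_integrable (f n)" "\<And>n. X (r n) = abs_l2 (f n)"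
  proof -
    have "\<forall>n. \<exists>f. square_integrable f \<and> X (r n) = abs_l2 f" by (meson l2_cases)
    then show ?thesis using that by metis
  qed
  have fm [measurable]: "f n \<in> borel_measurable half_line" for n
    using f(1)[of n] by (simp add: square_integrable_def)
  have nrm: "(\<integral>\<^sup>+x. ennreal ((cmod (f m x - f n x))\<^sup>2) \<partial>half_line) = ennreal
      ((norm (X (r m) - X (r n)))\<^sup>2)" for m n
    using nn_integral_norm_abs_l2[OF square_integrable_diff[OF f(1)[of m] f(1)[of n]]]
    by (simp add: f(2) minus_abs_l2 f(1))
  define g where "g = (\<lambda>x. \<Sum>n. ennreal (2 ^ n * (cmod (f (Suc n) x - f n x))\<^sup>2))"
  have "(\<integral>\<^sup>+x. g x \<partial>half_line) = (\<Sum>n. \<integral>\<^sup>+x. ennreal (2 ^ n * (cmod (f (Suc n) x - f n x))\<^sup>2) \<partial>half_line)"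
    unfolding g_def by (rule nn_integral_suminf) measurable
  also have "\<dots> \<le> (\<Sum>n. ennreal ((1/2) ^ n))"
  proof (rule suminf_le)
    fix n
    have "(\<integral>\<^sup>+x. ennreal (2 ^ n * (cmod (f (Suc n) x - f n x))\<^sup>2) \<partial>half_line)
        = ennreal (2 ^ n) * (\<integral>\<^sup>+x. ennreal ((cmod (f (Suc n) x - f n x))\<^sup>2) \<partial>half_line)"
      by (subst nn_integral_cmult[symmetric]) (auto simp: ennreal_mult)
    also have "\<dots> = ennreal (2 ^ n * (norm (X (r (Suc n)) - X (r n)))\<^sup>2)"
      by (simp add: nrm ennreal_mult)
    also have "\<dots> \<le> ennreal (2 ^ n * ((1/2) ^ n)\<^sup>2)"
    proof (intro ennreal_leI mult_left_mono power_mono)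
      have "r (Suc n) \<ge> r n" using r(1) by (simp add: strict_mono_less_eq)
      then show "norm (X (r (Suc n)) - X (r n)) \<le> (1/2) ^ n"
        using r(2)[of n] by (intro less_imp_le[OF N]) linarith+
    qed auto
    also have "2 ^ n * ((1/2) ^ n)\<^sup>2 = (1/2 :: real) ^ n"
      by (simp add: power2_eq_square power_divide)
    finally show "(\<integral>\<^sup>+x. ennreal (2 ^ n * (cmod (f (Suc n) x - f n x))\<^sup>2) \<partial>half_line) \<le> ennreal
        ((1/2) ^ n)" .
  qed auto
  also have "\<dots> = ennreal (\<Sum>n. (1/2) ^ n)"
    by (intro suminf_ennreal2) auto
  also have "\<dots> < \<infinity>" by simp
  finally have "(\<integral>\<^sup>+x. g x \<partial>half_line) \<noteq> \<infinity>" by simp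
  then have "AE x in half_line. g x \<noteq> \<infinity>"
    by (intro nn_integral_noteq_infinite) (simp_all add: g_def)
  then have conv: "AE x in half_line. convergent (\<lambda>n. f n x)"
  proof eventually_elim
    case (elim x)
    define d where "d = (\<lambda>n. cmod (f (Suc n) x - f n x))"
    have "summable (\<lambda>n. 2 ^ n * (d n)\<^sup>2)"
      using elim unfolding g_def d_def by (intro summable_suminf_not_top)
          (auto simp: top_ennreal.rep_eq)
    then have sg: "summable (\<lambda>n. (1/2) ^ n + 2 ^ n * (d n)\<^sup>2)"
      by (intro summable_add summable_geometric) auto
    have "summable (\<lambda>n. f (Suc n) x - f n x)"
    proof (rule summable_comparison_test'[OF sg])
      fix n
      have "0 \<le> 2 ^ n * (d n - (1/2) ^ n)\<^sup>2" by simp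
      also have "\<dots> = 2 ^ n * (d n)\<^sup>2 - 2 * d n + (1/2) ^ n"
        by (simp add: power2_diff algebra_simps power2_eq_square power_divide)
      finally have "2 * d n \<le> (1/2) ^ n + 2 ^ n * (d n)\<^sup>2" by simp
      moreover have "d n \<ge> 0" by (simp add: d_def)
      ultimately have "d n \<le> (1/2) ^ n + 2 ^ n * (d n)\<^sup>2" by linarith
      then show "norm (f (Suc n) x - f n x) \<le> (1/2) ^ n + 2 ^ n * (d n)\<^sup>2"
        by (simp add: d_def)
    qed
    then have "convergent (\<lambda>n. \<Sum>i<n. f (Suc i) x - f i x)"
      by (simp add: summable_iff_convergent)
    then have "convergent (\<lambda>n. f n x - f 0 x)"
      using sum_lessThan_telescope[of "\<lambda>n. f n x"] by simp
    then have "convergent (\<lambda>n. (f n x - f 0 x) + f 0 x)"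
      by (intro convergent_add convergent_const)
    then show ?case by simp
  qed
  define h where "h = (\<lambda>x. lim (\<lambda>n. f n x))"
  have hm [measurable]: "h \<in> borel_measurable half_line"
    unfolding h_def by (rule borel_measurable_lim_metric) (rule fm)
  have est: "(\<integral>\<^sup>+x. ennreal ((cmod (h x - f n x))\<^sup>2) \<partial>half_line) \<le> ennreal (e\<^sup>2)"
    if "\<And>m. m \<ge> n \<Longrightarrow> norm (X (r m) - X (r n)) \<le> e" for n e
  proof -
    have "(\<integral>\<^sup>+x. ennreal ((cmod (h x - f n x))\<^sup>2) \<partial>half_line)
        = (\<integral>\<^sup>+x. liminf (\<lambda>m. ennreal ((cmod (f m x - f n x))\<^sup>2)) \<partial>half_line)"
    proof (rule nn_integral_cong_AE)
      show "AE x in half_line. ennreal ((cmod (h x - f n x))\<^sup>2) = liminf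
          (\<lambda>m. ennreal ((cmod (f m x - f n x))\<^sup>2))"
        using conv
      proof eventually_elim
        case (elim x)
        then have "(\<lambda>m. f m x) \<longlonglongrightarrow> h x" unfolding h_def by (rule convergent_LIMSEQ_iff[THEN iffD1])
        then have "(\<lambda>m. ennreal ((cmod (f m x - f n x))\<^sup>2)) \<longlonglongrightarrow> ennreal ((cmod (h x - f n x))\<^sup>2)"
          by (intro tendsto_intros)
        then show ?case by (metis lim_imp_Liminf trivial_limit_sequentially)
      qed
    qed
    also have "\<dots> \<le> liminf (\<lambda>m. \<integral>\<^sup>+x. ennreal ((cmod (f m x - f n x))\<^sup>2) \<partial>half_line)"
      by (rule nn_integral_liminf) measurable
    also have "\<dots> \<le> ennreal (e\<^sup>2)"
    proof (rule Liminf_le)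
      show "\<forall>\<^sub>F m in sequentially. (\<integral>\<^sup>+x. ennreal ((cmod (f m x - f n x))\<^sup>2) \<partial>half_line) \<le> ennreal (e\<^sup>2)"
        unfolding nrm eventually_sequentially
        by (intro exI[of _ n] allI impI ennreal_leI power_mono that) auto
    qed simp
    finally show ?thesis .
  qed
  have hn: "square_integrable (\<lambda>x. h x - f n x)" and hn':
      "norm (abs_l2 (\<lambda>x. h x - f n x)) \<le> (1/2) ^ n" for n
  proof -
    have le: "(\<integral>\<^sup>+x. ennreal ((cmod (h x - f n x))\<^sup>2) \<partial>half_line) \<le> ennreal (((1/2) ^ n)\<^sup>2)"
    proof (rule est)
      fix m assume "m \<ge> n"
      then have "r m \<ge> r n" using r(1) by (simp add: strict_mono_less_eq)
      then show "norm (X (r m) - X (r n)) \<le> (1/2) ^ n"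
        using r(2)[of n] by (intro less_imp_le[OF N]) linarith+
    qed
    then show sq: "square_integrable (\<lambda>x. h x - f n x)"
      by (intro square_integrableI_nn_integral) (auto intro: le_less_trans)
    show "norm (abs_l2 (\<lambda>x. h x - f n x)) \<le> (1/2) ^ n"
    proof (rule power2_le_imp_le)
      show "(norm (abs_l2 (\<lambda>x. h x - f n x)))\<^sup>2 \<le> ((1/2) ^ n)\<^sup>2"
        using le unfolding nn_integral_norm_abs_l2[OF sq] by (subst (asm) ennreal_le_iff) simp_all
    qed simp
  qed
  have h: "square_integrable h"
    using square_integrable_add[OF hn[of 0] f(1)[of 0]] by simp
  have "(\<lambda>n. X (r n)) \<longlonglongrightarrow> abs_l2 h"
  proof (rule LIM_zero_cancel, rule Lim_null_comparison)
    show "\<forall>\<^sub>F n in sequentially. norm (X (r n) - abs_l2 h) \<le> (1/2) ^ n"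
      using hn' by (intro always_eventually allI)
        (simp add: f(2) norm_minus_commute[of _ "abs_l2 h"] minus_abs_l2[OF h f(1)])
    show "(\<lambda>n. (1/2) ^ n :: real) \<longlonglongrightarrow> 0" by (rule LIMSEQ_realpow_zero) auto
  qed
  then have "X \<longlonglongrightarrow> abs_l2 h"
    using Cauchy_converges_subseq[OF X r(1)] by (simp add: o_def)
  then show ?thesis unfolding convergent_def by blast
qed

section \<open>Orthonormal bases and rank-one operators\<close>

definition orthonormal :: "l2 set \<Rightarrow> bool" where
  "orthonormal E \<longleftrightarrow> (\<forall>e\<in>E. cinner e e = 1) \<and> (\<forall>e\<in>E. \<forall>e'\<in>E. e \<noteq> e' \<longrightarrow> cinner e e' = 0)"

lemma is_onb_exists: "\<exists>E. is_onb E"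
proof -
  have "\<Union>C \<in> Collect orthonormal" if C: "C \<in> chains (Collect orthonormal)" for C
  proof -
    have "cinner e e' = 0" if e: "e \<in> \<Union>C" "e' \<in> \<Union>C" "e \<noteq> e'" for e e'
    proof -
      obtain A B where AB: "A \<in> C" "B \<in> C" "e \<in> A" "e' \<in> B" using e by auto
      then have "A \<subseteq> B \<or> B \<subseteq> A" using chainsD[OF C] by blast
      then obtain M where "M \<in> C" "e \<in> M" "e' \<in> M" using AB by blast
      moreover have "orthonormal M" using chainsD2[OF C] \<open>M \<in> C\<close> by auto
      ultimately show ?thesis using e(3) by (auto simp: orthonormal_def)
    qed
    moreover have "cinner e e = 1" if "e \<in> \<Union>C" for e
      using chainsD2[OF C] that by (auto simp: orthonormal_def)
    ultimately show ?thesis by (simp add: orthonormal_def)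
  qed
  then obtain E where E: "orthonormal E" "\<And>F. orthonormal F \<Longrightarrow> E \<subseteq> F \<Longrightarrow> F = E"
    using Zorn_Lemma[of "Collect orthonormal"] by auto
  have "u = 0" if u: "\<forall>e\<in>E. cinner e u = 0" for u
  proof (rule ccontr)
    assume "u \<noteq> 0"
    define v where "v = scaleC (cplx (1 / norm u)) u"
    have "cinner v v = 1"
      using \<open>u \<noteq> 0\<close> by (simp add: cinner_self v_def norm_scaleC norm_divide)
    moreover have "cinner e v = 0" "cinner v e = 0" if "e \<in> E" for e
      using u that cinner_commute[of u e] by (auto simp: v_def cinner_scale_right cinner_scale_left)
    ultimately have "orthonormal (insert v E)"
      using E(1) by (auto simp: orthonormal_def)
    then have "v \<in> E" using E(2)[of "insert v E"] by auto
    then show False using \<open>cinner v v = 1\<close> \<open>\<And>e. e \<in> E \<Longrightarrow> cinner e v = 0\<close> by auto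
  qed
  then show ?thesis using E(1) by (auto simp: is_onb_def orthonormal_def)
qed

context
  fixes E :: "l2 set"
  assumes E: "is_onb E"
begin

definition fourier_sum :: "l2 \<Rightarrow> l2 set \<Rightarrow> l2" where
  "fourier_sum w F = (\<Sum>e\<in>F. scaleC (cinner e w) e)"

lemma cinner_fourier_sum:
  assumes "finite F" "F \<subseteq> E" "e \<in> E"
  shows "cinner e (fourier_sum w F) = (if e \<in> F then cinner e w else 0)"
proof -
  have "cinner e (fourier_sum w F) = (\<Sum>e'\<in>F. if e' = e then cinner e w else 0)"
    unfolding fourier_sum_def cinner_sum_right
    using E assms by (intro sum.cong) (auto simp: cinner_scale_right is_onb_def)
  then show ?thesis using assms by simp
qed

lemma cinner_fourier_sum_left:
  "cinner (fourier_sum w F) v = (\<Sum>e\<in>F. cnj (cinner e w) * cinner e v)"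
  by (simp add: fourier_sum_def cinner_sum_left cinner_scale_left)

lemma norm_fourier_sum:
  assumes "finite F" "F \<subseteq> E"
  shows "(norm (fourier_sum w F))\<^sup>2 = (\<Sum>e\<in>F. (cmod (cinner e w))\<^sup>2)"
proof -
  have "cplx ((norm (fourier_sum w F))\<^sup>2) = (\<Sum>e\<in>F. cnj (cinner e w) * cinner e w)"
    unfolding cinner_self[symmetric] cinner_fourier_sum_left
    using assms cinner_fourier_sum[OF assms] by (intro sum.cong) (auto simp: subset_iff)
  also have "\<dots> = cplx (\<Sum>e\<in>F. (cmod (cinner e w))\<^sup>2)"
    by (simp only: of_real_sum complex_norm_square mult.commute)
  finally show ?thesis by (simp only: of_real_eq_iff)
qed

lemma norm_diff_fourier_sum:
  assumes "finite F" "F \<subseteq> E"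
  shows "(norm (w - fourier_sum w F))\<^sup>2 = (norm w)\<^sup>2 - (\<Sum>e\<in>F. (cmod (cinner e w))\<^sup>2)"
proof -
  have l: "cinner (fourier_sum w F) w = cplx (\<Sum>e\<in>F. (cmod (cinner e w))\<^sup>2)"
    unfolding cinner_fourier_sum_left by (simp only: of_real_sum complex_norm_square mult.commute)
  have r: "cinner w (fourier_sum w F) = cplx (\<Sum>e\<in>F. (cmod (cinner e w))\<^sup>2)"
    by (subst cinner_commute, subst l) simp
  have "cplx ((norm (w - fourier_sum w F))\<^sup>2)
      = cplx ((norm w)\<^sup>2 - (\<Sum>e\<in>F. (cmod (cinner e w))\<^sup>2))"
    unfolding cinner_self[symmetric] cinner_diff_left cinner_diff_right l r
    unfolding cinner_self norm_fourier_sum[OF assms] by simp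
  then show ?thesis by (simp only: of_real_eq_iff)
qed

lemma bessel_inequality:
  assumes "finite F" "F \<subseteq> E"
  shows "(\<Sum>e\<in>F. (cmod (cinner e w))\<^sup>2) \<le> (norm w)\<^sup>2"
  using norm_diff_fourier_sum[OF assms, of w] zero_le_power2[of "norm (w - fourier_sum w F)"]
      by linarith

lemma bessel_summable: "(\<lambda>e. (cmod (cinner e w))\<^sup>2) summable_on E"
  by (rule nonneg_bdd_above_summable_on) (auto intro!: bdd_aboveI2[of _ _ "(norm w)\<^sup>2"]
      bessel_inequality)

text \<open>Finite sets \<open>G n\<close> whose coefficients exhaust the total give Fourier sums that converge to a vector
  with the same coefficients as \<open>w\<close>.\<close>

lemma parseval: "((\<lambda>e. (cmod (cinner e w))\<^sup>2) has_sum (norm w)\<^sup>2) E"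
proof -
  define c where "c = (\<lambda>e. (cmod (cinner e w))\<^sup>2)"
  define s where "s = infsum c E"
  have hs: "(c has_sum s) E" unfolding s_def c_def using bessel_summable by (rule has_sum_infsum)
  have le: "sum c F \<le> s" if "finite F" "F \<subseteq> E" for F
    unfolding s_def using bessel_summable that by (intro finite_sum_le_infsum) (auto simp: c_def)
  have "\<exists>F. finite F \<and> F \<subseteq> E \<and> s - 1 / real (Suc n) < sum c F" for n
  proof -
    have "\<forall>\<^sub>F F in finite_subsets_at_top E. s - 1 / real (Suc n) < sum c F"
      using hs unfolding has_sum_def by (rule order_tendstoD) simp
    then show ?thesis unfolding eventually_finite_subsets_at_top by blast
  qed
  then obtain F where F: "\<And>n. finite (F n)" "\<And>n. F n \<subseteq> E" "\<And>n. s - 1 / real (Suc n) < sum c (F n)"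
    by metis
  define G where "G = (\<lambda>n. \<Union>i\<le>n. F i)"
  have G: "finite (G n)" "G n \<subseteq> E" "s - 1 / real (Suc n) < sum c (G n)" for n
  proof -
    show "finite (G n)" "G n \<subseteq> E" using F by (auto simp: G_def)
    have "sum c (F n) \<le> sum c (G n)"
      using F by (intro sum_mono2) (auto simp: G_def c_def)
    then show "s - 1 / real (Suc n) < sum c (G n)" using F(3)[of n] by linarith
  qed
  have Gmono: "G n \<subseteq> G m" if "n \<le> m" for n m using that by (fastforce simp: G_def)
  define v where "v = (\<lambda>n. fourier_sum w (G n))"
  have dist: "(norm (v m - v n))\<^sup>2 \<le> 1 / real (Suc n)" if "n \<le> m" for m n
  proof -
    have "v m - v n = fourier_sum w (G m - G n)"
      unfolding v_def fourier_sum_def using G(1) Gmono[OF that] by (simp add: sum_diff)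
    then have "(norm (v m - v n))\<^sup>2 = sum c (G m - G n)"
      unfolding c_def using G by (simp only:) (intro norm_fourier_sum, auto)
    also have "\<dots> = sum c (G m) - sum c (G n)"
      using G(1) Gmono[OF that] by (simp add: sum_diff)
    also have "\<dots> \<le> 1 / real (Suc n)" using le[OF G(1,2), of m] G(3)[of n] by linarith
    finally show ?thesis .
  qed
  have "Cauchy v"
  proof (rule metric_CauchyI)
    fix e :: real assume "e > 0"
    obtain n where n: "1 / real (Suc n) < (e/2)\<^sup>2"
      using nat_approx_posE[of "(e/2)\<^sup>2"] \<open>e > 0\<close> by auto
    have "norm (v m - v n) < e/2" if "m \<ge> n" for m
    proof (rule power2_less_imp_less)
      show "(norm (v m - v n))\<^sup>2 < (e/2)\<^sup>2" using dist[OF that] n by linarith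
    qed (use \<open>e > 0\<close> in simp)
    then have "dist (v m) (v n) < e/2" if "m \<ge> n" for m using that by (simp add: dist_norm)
    then show "\<exists>M. \<forall>m\<ge>M. \<forall>n\<ge>M. dist (v m) (v n) < e"
      by (meson dist_triangle_half_l)
  qed
  then obtain v' where v': "v \<longlonglongrightarrow> v'" using l2_complete convergent_def by blast
  have "cinner e v' = cinner e w" if e: "e \<in> E" for e
  proof (rule LIMSEQ_unique[OF tendsto_cinner_right[OF v']])
    show "(\<lambda>n. cinner e (v n)) \<longlonglongrightarrow> cinner e w"
    proof (cases "\<exists>n. e \<in> G n")
      case True
      then obtain n where "e \<in> G n" by blast
      then have "cinner e (v m) = cinner e w" if "m \<ge> n" for m
        using Gmono[OF that] G e by (auto simp: v_def cinner_fourier_sum)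
      then show ?thesis
        by (intro tendsto_eventually) (auto simp: eventually_sequentially)
    next
      case False
      have "c e \<le> 1 / real (Suc n)" for n
      proof -
        have "sum c (insert e (G n)) \<le> s" using G e by (intro le) auto
        then show ?thesis using False G[of n] by simp
      qed
      have "c e \<le> 0"
      proof (rule ccontr)
        assume "\<not> c e \<le> 0"
        then obtain n where "1 / real (Suc n) < c e" using nat_approx_posE[of "c e"] by auto
        then show False using \<open>\<And>n. c e \<le> 1 / real (Suc n)\<close>[of n] by linarith
      qed
      then have "cinner e w = 0" by (simp add: c_def)
      then show ?thesis using False G e by (simp add: v_def cinner_fourier_sum)
    qed
  qed
  then have "\<forall>e\<in>E. cinner e (w - v') = 0" by (simp add: cinner_diff_right)
  then have "w - v' = 0" using E unfolding is_onb_def by blast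
  then have "v \<longlonglongrightarrow> w" using v' by simp
  then have "(\<lambda>n. (norm (v n))\<^sup>2) \<longlonglongrightarrow> (norm w)\<^sup>2" by (intro tendsto_intros)
  moreover have "(norm (v n))\<^sup>2 \<le> s" for n
    using le[OF G(1,2)] by (simp add: v_def norm_fourier_sum G c_def)
  ultimately have "(norm w)\<^sup>2 \<le> s" by (intro LIMSEQ_le_const2) auto
  moreover have "s \<le> (norm w)\<^sup>2"
    unfolding s_def c_def by (rule infsum_le_finite_sums[OF bessel_summable]) (rule bessel_inequality)
  ultimately show ?thesis using hs by (simp add: c_def)
qed

lemma parseval_cinner: "((\<lambda>e. cinner u e * cinner e w) has_sum cinner u w) E"
  unfolding has_sum_def
proof (rule LIM_zero_cancel, rule Lim_null_comparison)
  show "\<forall>\<^sub>F F in finite_subsets_at_top E. norm ((\<Sum>e\<in>F. cinner u e * cinner e w) - cinner u w)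
      \<le> norm u * sqrt ((norm w)\<^sup>2 - (\<Sum>e\<in>F. (cmod (cinner e w))\<^sup>2))"
  proof (rule eventually_mono[OF eventually_finite_subsets_at_top_weakI])
    fix F assume F: "finite F" "F \<subseteq> E"
    have "(\<Sum>e\<in>F. cinner u e * cinner e w) = cinner u (fourier_sum w F)"
      by (simp add: fourier_sum_def cinner_sum_right cinner_scale_right mult.commute)
    then have "norm ((\<Sum>e\<in>F. cinner u e * cinner e w) - cinner u w) = cmod
        (cinner u (w - fourier_sum w F))"
      by (simp add: cinner_diff_right norm_minus_commute)
    also have "\<dots> \<le> norm u * norm (w - fourier_sum w F)" by (rule norm_cinner_le)
    also have "norm (w - fourier_sum w F) = sqrt ((norm w)\<^sup>2 - (\<Sum>e\<in>F. (cmod (cinner e w))\<^sup>2))"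
      using norm_diff_fourier_sum[OF F, of w] by (simp add: real_sqrt_unique)
    finally show "norm ((\<Sum>e\<in>F. cinner u e * cinner e w) - cinner u w)
      \<le> norm u * sqrt ((norm w)\<^sup>2 - (\<Sum>e\<in>F. (cmod (cinner e w))\<^sup>2))" .
  qed
  have "((\<lambda>F. norm u * sqrt ((norm w)\<^sup>2 - (\<Sum>e\<in>F. (cmod (cinner e w))\<^sup>2))) \<longlongrightarrow>
      norm u * sqrt ((norm w)\<^sup>2 - (norm w)\<^sup>2)) (finite_subsets_at_top E)"
    using parseval unfolding has_sum_def by (intro tendsto_intros)
  then show "((\<lambda>F. norm u * sqrt ((norm w)\<^sup>2 - (\<Sum>e\<in>F. (cmod (cinner e w))\<^sup>2))) \<longlongrightarrow> 0)
      (finite_subsets_at_top E)"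
    by simp
qed

end

definition rank_one :: "complex \<Rightarrow> l2 \<Rightarrow> l2 \<Rightarrow> l2 \<Rightarrow> l2" where
  "rank_one \<kappa> a b f = scaleC (\<kappa> * cinner a f) b"

lemma bounded_clinear_rank_one: "bounded_clinear (rank_one \<kappa> a b)"
  unfolding bounded_clinear_def
proof (intro conjI allI)
  show "bounded_linear (rank_one \<kappa> a b)"
  proof (rule bounded_linear_intro)
    show "rank_one \<kappa> a b (u + v) = rank_one \<kappa> a b u + rank_one \<kappa> a b v" for u v
      by (simp add: rank_one_def cinner_add_right distrib_left scaleC_add_left)
    show "rank_one \<kappa> a b (r *\<^sub>R u) = r *\<^sub>R rank_one \<kappa> a b u" for r u
      by (simp add: rank_one_def scaleR_eq_scaleC cinner_scale_right scaleC_scaleC mult.left_commute)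
    show "norm (rank_one \<kappa> a b u) \<le> norm u * (cmod \<kappa> * norm a * norm b)" for u
    proof -
      have "norm (rank_one \<kappa> a b u) = cmod \<kappa> * cmod (cinner a u) * norm b"
        by (simp add: rank_one_def norm_scaleC norm_mult)
      also have "\<dots> \<le> cmod \<kappa> * (norm a * norm u) * norm b"
        by (intro mult_right_mono mult_left_mono norm_cinner_le) auto
      finally show ?thesis by (simp add: mult_ac)
    qed
  qed
  show "rank_one \<kappa> a b (scaleC c u) = scaleC c (rank_one \<kappa> a b u)" for c u
    by (simp add: rank_one_def cinner_scale_right scaleC_scaleC mult.left_commute)
qed

lemma trace_class_rank_one: "trace_class (rank_one \<kappa> a b)"
proof -
  obtain E where E: "is_onb E" using is_onb_exists by blast
  define \<beta> where "\<beta> = cmod \<kappa> * norm b / norm a"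
  define B where "B = rank_one (cplx \<beta>) a a"
  have diag: "cinner u (B u) = cplx (\<beta> * (cmod (cinner u a))\<^sup>2)" for u
    using complex_norm_square[of "cinner u a"] cinner_commute[of a u]
    by (simp add: B_def rank_one_def cinner_scale_right mult.commute)
  have "is_adjoint (rank_one \<kappa> a b) (rank_one (cnj \<kappa>) b a)"
    unfolding is_adjoint_def rank_one_def
    using cinner_commute[of _ b] by (simp add: cinner_scale_left cinner_scale_right mult_ac)
  moreover have "positive_operator B"
    unfolding positive_operator_def diag
    by (auto simp: B_def bounded_clinear_rank_one \<beta>_def complex_nonneg_Reals_iff)
  moreover have "B \<circ> B = rank_one (cnj \<kappa>) b a \<circ> rank_one \<kappa> a b"
  proof (rule ext, cases "a = 0")
    case False
    fix f
    have "\<beta> * \<beta> * (norm a)\<^sup>2 = (cmod \<kappa>)\<^sup>2 * (norm b)\<^sup>2"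
      using False by (simp add: \<beta>_def power2_eq_square)
    then have "cplx (\<beta> * \<beta> * (norm a)\<^sup>2) = cplx ((cmod \<kappa>)\<^sup>2 * (norm b)\<^sup>2)"
      by simp
    then have "cplx \<beta> * cplx \<beta> * cinner a a = \<kappa> * cnj \<kappa> * cinner b b"
      unfolding cinner_self by (simp only: of_real_mult complex_norm_square)
    then have "cplx \<beta> * cplx \<beta> * cinner a a * cinner a f = \<kappa> * cnj \<kappa> * cinner b b * cinner a f"
      by simp
    then have "cplx \<beta> * (cplx \<beta> * cinner a f * cinner a a) =
        cnj \<kappa> * (\<kappa> * cinner a f * cinner b b)"
      by (simp only: mult_ac)
    then show "(B \<circ> B) f = (rank_one (cnj \<kappa>) b a \<circ> rank_one \<kappa> a b) f"
      by (simp only: B_def rank_one_def cinner_scale_right o_def)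
  qed (simp add: B_def rank_one_def cinner_zero_left cinner_zero_right scaleC_zero_left)
  moreover have "(\<lambda>e. cinner e (B e)) summable_on E"
  proof -
    have "(\<lambda>e. cplx (\<beta> * (cmod (cinner e a))\<^sup>2)) summable_on E"
      by (intro summable_on_of_real summable_on_cmult_right bessel_summable E)
    then show ?thesis unfolding diag .
  qed
  ultimately show ?thesis
    unfolding trace_class_def using bounded_clinear_rank_one E by blast
qed

lemma op_trace_rank_one: "op_trace (rank_one \<kappa> a b) = \<kappa> * cinner a b"
proof -
  have hs: "((\<lambda>e. cinner e (rank_one \<kappa> a b e)) has_sum (\<kappa> * cinner a b)) E" if "is_onb E" for E
    using has_sum_cmult_right[OF parseval_cinner[OF that, of a b], of \<kappa>]
    by (simp add: rank_one_def cinner_scale_right mult.assoc)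
  obtain E where E: "is_onb E" using is_onb_exists by blast
  show ?thesis
    unfolding op_trace_def
  proof (rule the_equality)
    show "\<forall>E. is_onb E \<longrightarrow> ((\<lambda>e. cinner e (rank_one \<kappa> a b e)) has_sum (\<kappa> * cinner a b)) E"
      using hs by blast
    fix t assume "\<forall>E. is_onb E \<longrightarrow> ((\<lambda>e. cinner e (rank_one \<kappa> a b e)) has_sum t) E"
    then show "t = \<kappa> * cinner a b" using hs[OF E] E has_sum_unique by blast
  qed
qed

section \<open>The maximal operator\<close>

lemma absolutely_continuous_cong:
  assumes "\<And>x. x \<in> {a..b} \<Longrightarrow> f x = g x" and ac: "absolutely_continuous_on a b f"
  shows "absolutely_continuous_on a b g"
  by (rule absolutely_continuous_bilinear[OF ac ac, of _ 1]) (simp add: assms(1)[symmetric])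

lemma D_halfD:
  assumes "g \<in> D_half"
  shows "0 < x \<Longrightarrow> (g has_vector_derivative D1 g x) (at x)"
    and "0 < a \<Longrightarrow> absolutely_continuous_on a b g"
    and "0 < a \<Longrightarrow> absolutely_continuous_on a b (D1 g)"
proof -
  show "(g has_vector_derivative D1 g x) (at x)" if "0 < x"
  proof -
    have "g differentiable (at x within {0<..})"
      using assms that unfolding D_half_def differentiable_on_def by auto
    then have "g differentiable (at x)"
      using that at_within_open[of x "{0<..}"] by simp
    then show ?thesis using vector_derivative_works by blast
  qed
  have *: "absolutely_continuous_on a b f" if "f \<in> AC_loc" "0 < a" for f a b
  proof (cases "a \<le> b")
    case True
    then show ?thesis using that by (auto simp: AC_loc_def)
  next
    case False
    then show ?thesis by (intro lipschitz_imp_absolutely_continuous[where L = 0]) auto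
  qed
  show "0 < a \<Longrightarrow> absolutely_continuous_on a b g" "0 < a \<Longrightarrow> absolutely_continuous_on a b (D1 g)"
    using assms * by (auto simp: D_half_def)
qed

lemma max_action_second_derivative:
  assumes "max_action \<nu> g h"
  obtains N where "negligible N"
    "\<And>x. 0 < x \<Longrightarrow> x \<notin> N \<Longrightarrow> (D1 g has_vector_derivative bpot \<nu> x * g x - h x) (at x)"
proof -
  have "AE x in half_line. (D1 g has_vector_derivative bpot \<nu> x * g x - h x) (at x)"
    using assms unfolding max_action_def bessel_expression_def by (auto elim!: AE_mp)
  then have "AE x in lebesgue. x \<in> {0<..} \<longrightarrow> (D1 g has_vector_derivative bpot \<nu> x * g x - h x) (at x)"
    by (simp add: AE_restrict_space_iff)
  then obtain N where N: "N \<in> null_sets lebesgue"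
    "\<And>x. x \<in> space lebesgue - N \<Longrightarrow> x \<in> {0<..} \<longrightarrow> (D1 g has_vector_derivative bpot \<nu> x * g x - h x) (at x)"
    by (rule AE_E3) blast
  show ?thesis
  proof (rule that)
    show "negligible N" using N(1) by (simp add: negligible_iff_null_sets)
    show "(D1 g has_vector_derivative bpot \<nu> x * g x - h x) (at x)"
      if "0 < x" "x \<notin> N" for x
      using N(2)[of x] that by (simp only: space_completion space_lborel space_borel) blast
  qed
qed

lemma half_line_continuous_measurable:
  "continuous_on {0<..} (f :: real \<Rightarrow> complex) \<Longrightarrow> f \<in> borel_measurable half_line"
  by (rule continuous_imp_measurable_on_sets_lebesgue) auto

lemma half_line_continuous_onI:
  assumes "\<And>x::real. 0 < x \<Longrightarrow> (f has_vector_derivative f' x) (at x)"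
  shows "continuous_on {0<..} f"
  using assms by (auto intro!: continuous_at_imp_continuous_on intro: has_vector_derivative_continuous)

lemma max_actionI:
  assumes f: "\<And>x. 0 < x \<Longrightarrow> (f has_vector_derivative f' x) (at x)"
    and f': "\<And>x. 0 < x \<Longrightarrow> (f' has_vector_derivative f'' x) (at x)"
    and cont: "continuous_on {0<..} f''"
    and sq: "square_integrable f" "square_integrable h"
    and eq: "\<And>x. 0 < x \<Longrightarrow> h x = - f'' x + bpot \<nu> x * f x"
  shows "max_action \<nu> f h" "\<And>x. 0 < x \<Longrightarrow> D1 f x = f' x"
proof -
  show D1: "D1 f x = f' x" if "0 < x" for x using f[OF that] by (rule vector_derivative_at)
  have f'c: "continuous_on {0<..} f'" by (rule half_line_continuous_onI[OF f'])
  have "f \<in> AC_loc"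
    unfolding AC_loc_def
    by (auto intro!: C1_imp_absolutely_continuous[of _ _ f f'] f intro: continuous_on_subset[OF f'c])
  moreover have "f differentiable_on {0<..}"
    unfolding differentiable_on_def using f
    by (metis differentiableI_vector differentiable_at_withinI greaterThan_iff)
  moreover have "D1 f \<in> AC_loc"
    unfolding AC_loc_def
  proof (safe)
    fix a b :: real assume ab: "0 < a" "a \<le> b"
    have "absolutely_continuous_on a b f'"
      using ab by (intro C1_imp_absolutely_continuous[of _ _ f' f''] f'
          continuous_on_subset[OF cont]) auto
    then show "absolutely_continuous_on a b (D1 f)"
      using ab by (rule_tac absolutely_continuous_cong[of a b f']) (auto simp: D1)
  qed
  moreover have "bessel_expression \<nu> f h"
    unfolding bessel_expression_def
  proof (rule AE_half_lineI)
    fix x :: real assume x: "0 < x"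
    have "(D1 f has_vector_derivative f'' x) (at x)"
      by (rule has_vector_derivative_transform_within_open[OF f'[OF x], of "{0<..}"]) (use x D1 in auto)
    then show "\<exists>g''. (D1 f has_vector_derivative g'') (at x) \<and> h x = - g'' + bpot \<nu> x * f x"
      using eq[OF x] by blast
  qed
  ultimately show "max_action \<nu> f h" using sq by (simp add: max_action_def D_half_def)
qed

lemma max_action_lincomb:
  assumes g1: "max_action \<nu> g1 h1" and g2: "max_action \<nu> g2 h2"
  shows "max_action \<nu> (\<lambda>x. g1 x + c * g2 x) (\<lambda>x. h1 x + c * h2 x)"
    and "\<And>x. 0 < x \<Longrightarrow> D1 (\<lambda>x. g1 x + c * g2 x) x = D1 g1 x + c * D1 g2 x"
proof -
  have D: "g1 \<in> D_half" "g2 \<in> D_half" using assms by (auto simp: max_action_def)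
  have d: "((\<lambda>x. g1 x + c * g2 x) has_vector_derivative D1 g1 x + c * D1 g2 x) (at x)" if "0 < x" for x
    using D_halfD(1)[OF D(1) that] D_halfD(1)[OF D(2) that]
    by (intro has_vector_derivative_add has_vector_derivative_mult_right)
  then show D1: "D1 (\<lambda>x. g1 x + c * g2 x) x = D1 g1 x + c * D1 g2 x" if "0 < x" for x
    using that by (intro vector_derivative_at)
  have "(\<lambda>x. g1 x + c * g2 x) \<in> AC_loc"
    unfolding AC_loc_def using D_halfD(2)[OF D(1)] D_halfD(2)[OF D(2)]
    by (auto intro!: absolutely_continuous_lincomb)
  moreover have "(\<lambda>x. g1 x + c * g2 x) differentiable_on {0<..}"
    unfolding differentiable_on_def using d
    by (metis differentiableI_vector differentiable_at_withinI greaterThan_iff)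
  moreover have "D1 (\<lambda>x. g1 x + c * g2 x) \<in> AC_loc"
    unfolding AC_loc_def
  proof (safe)
    fix a b :: real assume ab: "0 < a" "a \<le> b"
    have "absolutely_continuous_on a b (\<lambda>x. D1 g1 x + c * D1 g2 x)"
      using ab by (intro absolutely_continuous_lincomb D_halfD(3) D)
    then show "absolutely_continuous_on a b (D1 (\<lambda>x. g1 x + c * g2 x))"
      using ab by (rule_tac absolutely_continuous_cong) (auto simp: D1)
  qed
  moreover have "square_integrable (\<lambda>x. g1 x + c * g2 x)" "square_integrable (\<lambda>x. h1 x + c * h2 x)"
    using assms by (auto simp: max_action_def intro!: square_integrable_add square_integrable_scale)
  moreover have "bessel_expression \<nu> (\<lambda>x. g1 x + c * g2 x) (\<lambda>x. h1 x + c * h2 x)"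
  proof -
    have e1: "AE x in half_line. \<exists>g''. (D1 g1 has_vector_derivative g'') (at x) \<and>
        h1 x = - g'' + bpot \<nu> x * g1 x"
      and e2: "AE x in half_line. \<exists>g''. (D1 g2 has_vector_derivative g'') (at x) \<and>
        h2 x = - g'' + bpot \<nu> x * g2 x"
      using assms by (auto simp: max_action_def bessel_expression_def)
    have "AE x in half_line. 0 < x" by (rule AE_I2) (simp add: space_restrict_space)
    with e1 e2 show ?thesis
      unfolding bessel_expression_def
    proof eventually_elim
      case (elim x)
      then obtain d1 d2 where d12: "(D1 g1 has_vector_derivative d1) (at x)"
          "(D1 g2 has_vector_derivative d2) (at x)"
        "h1 x = - d1 + bpot \<nu> x * g1 x" "h2 x = - d2 + bpot \<nu> x * g2 x"
        by blast
      have "((\<lambda>x. D1 g1 x + c * D1 g2 x) has_vector_derivative d1 + c * d2) (at x)"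
        by (intro has_vector_derivative_add has_vector_derivative_mult_right d12)
      then have "(D1 (\<lambda>x. g1 x + c * g2 x) has_vector_derivative d1 + c * d2) (at x)"
        by (rule has_vector_derivative_transform_within_open[of _ _ _ "{0<..}"]) (use elim D1 in auto)
      moreover have "h1 x + c * h2 x = - (d1 + c * d2) + bpot \<nu> x * (g1 x + c * g2 x)"
        unfolding d12(3,4) by (simp only: ring_distribs minus_add_distrib mult_minus_right
            mult.left_commute add_ac)
      ultimately show ?case by blast
    qed
  qed
  ultimately show "max_action \<nu> (\<lambda>x. g1 x + c * g2 x) (\<lambda>x. h1 x + c * h2 x)"
    by (simp add: max_action_def D_half_def)
qed

lemma max_action_zero: "max_action \<nu> (\<lambda>x. 0) (\<lambda>x. 0)"
  by (rule max_actionI(1)[of _ "\<lambda>x. 0" "\<lambda>x. 0"]) (auto simp: square_integrable_zero)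

lemma green_formula:
  assumes g: "max_action \<nu> g h" and y: "bessel_solution \<nu> z y y'" and ab: "0 < a" "a \<le> b"
  shows "((\<lambda>x. y x * h x - z * (y x * g x)) has_integral
    (wronskian g (D1 g) y y' b - wronskian g (D1 g) y y' a)) {a..b}"
proof -
  have D: "g \<in> D_half" using g by (simp add: max_action_def)
  obtain N where N: "negligible N"
    "\<And>x. 0 < x \<Longrightarrow> x \<notin> N \<Longrightarrow> (D1 g has_vector_derivative bpot \<nu> x * g x - h x) (at x)"
    by (rule max_action_second_derivative[OF g]) blast
  have yd: "(y has_vector_derivative y' x) (at x)"
    "(y' has_vector_derivative (bpot \<nu> x - z) * y x) (at x)" if "0 < x" for x
    using y that by (auto simp: bessel_solution_def)
  have yc: "continuous_on {0<..} y" "continuous_on {0<..} y'"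
    using half_line_continuous_onI[OF yd(1)] half_line_continuous_onI[OF yd(2)] by auto
  have sub: "{a..b} \<subseteq> {0<..}" using ab by auto
  have acy: "absolutely_continuous_on a b y" "absolutely_continuous_on a b y'"
  proof -
    show "absolutely_continuous_on a b y"
      using ab by (intro C1_imp_absolutely_continuous[of _ _ y y'] yd
          continuous_on_subset[OF yc(2) sub]) auto
    have "continuous_on {a..b} (\<lambda>x. (bpot \<nu> x - z) * y x)"
      using ab by (intro continuous_intros continuous_on_subset[OF yc(1) sub]) auto
    moreover have "(y' has_vector_derivative (bpot \<nu> x - z) * y x) (at x)"
      if "x \<in> {a..b}" for x
      using that ab by (intro yd) auto
    ultimately show "absolutely_continuous_on a b y'"
      by (intro C1_imp_absolutely_continuous)
  qed
  have "absolutely_continuous_on a b (\<lambda>x. g x * y' x + (-1) * (D1 g x * y x))"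
    by (intro absolutely_continuous_lincomb absolutely_continuous_mult acy D_halfD[OF D] ab)
  then have ac: "absolutely_continuous_on a b (wronskian g (D1 g) y y')"
    by (rule absolutely_continuous_cong[rotated]) (simp add: wronskian_def)
  show ?thesis
  proof (rule absolutely_continuous_FTC[OF ac ab(2) N(1)])
    fix x assume "x \<in> {a..b} - N"
    then have x: "0 < x" "x \<notin> N" using ab by auto
    have "(wronskian g (D1 g) y y' has_vector_derivative
        g x * ((bpot \<nu> x - z) * y x) - (bpot \<nu> x * g x - h x) * y x) (at x)"
      by (intro has_vector_derivative_wronskian D_halfD(1)[OF D] yd N x)
    moreover have "g x * ((c - z) * y x) - (c * g x - h x) * y x = y x * h x - z * (y x * g x)" for c
      by (simp add: algebra_simps)
    ultimately show "(wronskian g (D1 g) y y' has_vector_derivative y x * h x - z * (y x * g x)) (at x)"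
      by (simp only:)
  qed
qed

lemma square_integrable_power_near_0:
  assumes "- 1/2 < s"
  shows "square_integrable (\<lambda>x. indicator {0<..1} x *\<^sub>R pow_fun s x)"
  unfolding square_integrable_def
proof
  show m: "(\<lambda>x. indicator {0<..1} x *\<^sub>R pow_fun s x) \<in> borel_measurable half_line"
    by (intro half_line_measurable) measurable
  show "integrable half_line (\<lambda>x. (cmod (indicator {0<..1} x *\<^sub>R pow_fun s x))\<^sup>2)"
  proof (rule Bochner_Integration.integrable_bound)
    show "integrable half_line (\<lambda>x. exp 1 * (exp (- 1 * x) * x powr ((2 * s + 1) - 1)))"
      using assms by (intro integrable_mult_right Gamma_integral_scaled(1)) auto
    show "(\<lambda>x. (cmod (indicator {0<..1} x *\<^sub>R pow_fun s x))\<^sup>2) \<in> borel_measurable half_line"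
      using m by measurable
    show "AE x in half_line. norm ((cmod (indicator {0<..1} x *\<^sub>R pow_fun s x))\<^sup>2)
        \<le> norm (exp 1 * (exp (- 1 * x) * x powr ((2 * s + 1) - 1)))"
    proof (rule AE_half_lineI)
      fix x :: real assume x: "0 < x"
      show "norm ((cmod (indicator {0<..1} x *\<^sub>R pow_fun s x))\<^sup>2)
        \<le> norm (exp 1 * (exp (- 1 * x) * x powr ((2 * s + 1) - 1)))"
      proof (cases "x \<le> 1")
        case True
        have "(x powr s)\<^sup>2 = x powr (2 * s)"
          using x by (simp add: power2_eq_square powr_add[symmetric])
        moreover have "1 * x powr (2 * s) \<le> exp (1 - x) * x powr (2 * s)"
          using True by (intro mult_right_mono) auto
        ultimately show ?thesis using x True by (simp add: exp_diff exp_minus divide_inverse mult_ac)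
      qed simp
    qed
  qed
qed

lemma bessel_solution_pow_fun:
  assumes "s * (s - 1) = \<nu>\<^sup>2 - 1/4"
  shows "bessel_solution \<nu> 0 (pow_fun s) (pow_fun' s)"
  unfolding bessel_solution_def
proof (intro allI impI conjI)
  fix x :: real assume x: "0 < x"
  show "(pow_fun s has_vector_derivative pow_fun' s x) (at x)"
    by (rule has_vector_derivative_pow_fun[OF x])
  show "(pow_fun' s has_vector_derivative (bpot \<nu> x - 0) * pow_fun s x) (at x)"
    using has_vector_derivative_pow_fun'[OF x, of s] unfolding assms by simp
qed

lemma bval_exists:
  assumes g: "max_action \<nu> g h" and s: "s * (s - 1) = \<nu>\<^sup>2 - 1/4" "- 1/2 < s"
  shows "\<exists>l. (wronskian g (D1 g) (pow_fun s) (pow_fun' s) \<longlongrightarrow> l) (at_right 0)"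
proof -
  let ?W = "wronskian g (D1 g) (pow_fun s) (pow_fun' s)"
  let ?F = "\<lambda>x. pow_fun s x * h x"
  have int: "(?F has_integral (?W 1 - ?W a)) {a..1}" if "0 < a" "a \<le> 1" for a
    using green_formula[OF g bessel_solution_pow_fun[OF s(1)] that] by simp
  have "integrable half_line (\<lambda>x. cnj (indicator {0<..1} x *\<^sub>R pow_fun s x) * h x)"
    using g by (intro square_integrable_mult_integrable square_integrable_power_near_0 s(2))
        (simp add: max_action_def)
  then have "(\<lambda>x. cnj (indicator {0<..1} x *\<^sub>R pow_fun s x) * h x) absolutely_integrable_on {0<..1}"
    by (rule integrable_half_line_subset) auto
  then have "(\<lambda>x. cnj (indicator {0<..1} x *\<^sub>R pow_fun s x) * h x) integrable_on {0<..1}"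
    by (rule set_lebesgue_integral_eq_integral(1))
  then have "?F integrable_on {0<..1}"
    by (rule integrable_eq) simp
  then have "?F integrable_on {0..1}"
    by (rule integrable_spike_set) (auto intro: negligible_subset[of "{0}"])
  then have "continuous_on {0..1} (\<lambda>x. integral {x..1} ?F)"
    by (rule indefinite_integral_continuous_1')
  then have "((\<lambda>x. integral {x..1} ?F) \<longlongrightarrow> integral {0..1} ?F) (at 0 within {0..1})"
    by (simp add: continuous_on_def)
  then have "((\<lambda>x. integral {x..1} ?F) \<longlongrightarrow> integral {0..1} ?F) (at_right 0)"
    by (simp add: at_within_Icc_at_right)
  then have "((\<lambda>x. ?W 1 - integral {x..1} ?F) \<longlongrightarrow> ?W 1 - integral {0..1} ?F) (at_right 0)"
    by (intro tendsto_intros)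
  moreover have "eventually (\<lambda>x. ?W 1 - integral {x..1} ?F = ?W x) (at_right 0)"
  proof -
    have "eventually (\<lambda>x. x \<in> {0<..<1}) (at_right (0::real))"
      by (rule eventually_at_right_real) simp
    then show ?thesis
    proof eventually_elim
      case (elim x)
      then have "integral {x..1} ?F = ?W 1 - ?W x" by (intro integral_unique int) auto
      then show ?case by (simp only: diff_diff_eq2 add_diff_cancel_left')
    qed
  qed
  ultimately show ?thesis by (intro exI) (rule Lim_transform_eventually)
qed

lemma max_action_growth:
  assumes g: "max_action \<nu> g h"
  shows "\<exists>K\<ge>0. \<forall>x\<ge>1. cmod (D1 g x) \<le> K * x \<and> cmod (g x) \<le> K * x\<^sup>2"
proof -
  have D: "g \<in> D_half" and sq: "square_integrable g" "square_integrable h"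
    using g by (auto simp: max_action_def)
  obtain N where N: "negligible N"
    "\<And>x. 0 < x \<Longrightarrow> x \<notin> N \<Longrightarrow> (D1 g has_vector_derivative bpot \<nu> x * g x - h x) (at x)"
    by (rule max_action_second_derivative[OF g]) blast
  define c where "c = \<bar>\<nu>\<^sup>2 - 1/4\<bar>"
  define I where "I = (LINT x|half_line. c * (cmod (g x))\<^sup>2 + (cmod (h x))\<^sup>2)"
  have intI: "integrable half_line (\<lambda>x. c * (cmod (g x))\<^sup>2 + (cmod (h x))\<^sup>2)"
    using sq by (auto simp: square_integrable_def)
  have I0: "I \<ge> 0" unfolding I_def by (rule Bochner_Integration.integral_nonneg) (simp add: c_def)
  define K1 where "K1 = cmod (D1 g 1) + (c + 1) + I"
  have K1: "K1 \<ge> 0" using I0 by (simp add: K1_def c_def)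
  have b1: "cmod (D1 g x) \<le> K1 * x" if x: "x \<ge> 1" for x
  proof -
    let ?F = "\<lambda>x. bpot \<nu> x * g x - h x"
    have F: "(?F has_integral (D1 g x - D1 g 1)) {1..x}"
      by (rule absolutely_continuous_FTC[OF D_halfD(3)[OF D] _ N(1)]) (use x N(2) in auto)
    have aint: "set_integrable lebesgue {1..x} (\<lambda>x. c * (cmod (g x))\<^sup>2 + (cmod (h x))\<^sup>2)"
    proof -
      have "set_integrable lebesgue {0<..} (\<lambda>x. c * (cmod (g x))\<^sup>2 + (cmod (h x))\<^sup>2)"
        using intI by (simp add: integrable_restrict_space set_integrable_def)
      then show ?thesis by (rule set_integrable_subset) auto
    qed
    have G: "(\<lambda>x. (c + 1) + (c * (cmod (g x))\<^sup>2 + (cmod (h x))\<^sup>2)) integrable_on {1..x}"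
      by (intro integrable_add integrable_const_ivl set_lebesgue_integral_eq_integral(1)[OF aint])
    have "cmod (integral {1..x} ?F) \<le> integral {1..x}
        (\<lambda>x. (c + 1) + (c * (cmod (g x))\<^sup>2 + (cmod (h x))\<^sup>2))"
    proof (rule Henstock_Kurzweil_Integration.integral_norm_bound_integral[OF _ G])
      show "?F integrable_on {1..x}" using F by blast
      fix t assume "t \<in> {1..x}"
      then have t: "t \<ge> 1" by simp
      have "cmod (bpot \<nu> t * g t) = c / t\<^sup>2 * cmod (g t)"
        unfolding norm_mult norm_of_real by (simp add: c_def abs_divide)
      also have "\<dots> \<le> c * cmod (g t)"
        using t by (intro mult_right_mono) (auto simp: c_def divide_le_eq mult_le_cancel_left1)
      also have "\<dots> \<le> c * (1 + (cmod (g t))\<^sup>2)"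
      proof (intro mult_left_mono)
        have "0 \<le> (cmod (g t) - 1)\<^sup>2" by simp
        then have "2 * cmod (g t) \<le> 1 + (cmod (g t))\<^sup>2" by (simp add: power2_diff)
        then show "cmod (g t) \<le> 1 + (cmod (g t))\<^sup>2" using norm_ge_zero[of "g t"] by linarith
      qed (simp add: c_def)
      finally have A: "cmod (bpot \<nu> t * g t) \<le> c * (1 + (cmod (g t))\<^sup>2)" .
      have "0 \<le> (cmod (h t) - 1)\<^sup>2" by simp
      then have "2 * cmod (h t) \<le> 1 + (cmod (h t))\<^sup>2" by (simp add: power2_diff)
      then have B: "cmod (h t) \<le> 1 + (cmod (h t))\<^sup>2" using norm_ge_zero[of "h t"] by linarith
      have "cmod (?F t) \<le> cmod (bpot \<nu> t * g t) + cmod (h t)"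
        by (rule norm_triangle_ineq4)
      with A B show "cmod (?F t) \<le> (c + 1) + (c * (cmod (g t))\<^sup>2 + (cmod (h t))\<^sup>2)"
        by (simp add: algebra_simps)
    qed
    also have "\<dots> = integral {1..x} (\<lambda>x. c + 1) + integral {1..x}
        (\<lambda>x. c * (cmod (g x))\<^sup>2 + (cmod (h x))\<^sup>2)"
      by (intro Henstock_Kurzweil_Integration.integral_add integrable_const_ivl
          set_lebesgue_integral_eq_integral(1)[OF aint])
    also have "integral {1..x} (\<lambda>x. c + 1) = (x - 1) * (c + 1)" using x by simp
    also have "integral {1..x} (\<lambda>x. c * (cmod (g x))\<^sup>2 + (cmod (h x))\<^sup>2) \<le> I"
    proof -
      have "integral {1..x} (\<lambda>x. c * (cmod (g x))\<^sup>2 + (cmod (h x))\<^sup>2) =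
          (LINT t:{1..x}|lebesgue. c * (cmod (g t))\<^sup>2 + (cmod (h t))\<^sup>2)"
        using set_lebesgue_integral_eq_integral(2)[OF aint] by simp
      also have "\<dots> \<le> (LINT t:{0<..}|lebesgue. c * (cmod (g t))\<^sup>2 + (cmod (h t))\<^sup>2)"
        unfolding set_lebesgue_integral_def
      proof (rule integral_mono)
        show "integrable lebesgue (\<lambda>t. indicator {1..x} t *\<^sub>R (c * (cmod (g t))\<^sup>2 + (cmod (h t))\<^sup>2))"
          using aint by (simp add: set_integrable_def)
        show "integrable lebesgue (\<lambda>t. indicator {0<..} t *\<^sub>R (c * (cmod (g t))\<^sup>2 + (cmod (h t))\<^sup>2))"
          using intI by (simp add: integrable_restrict_space)
      qed (auto simp: indicator_def c_def)
      also have "\<dots> = I" unfolding I_def set_lebesgue_integral_def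
          by (subst integral_restrict_space) auto
      finally show ?thesis .
    qed
    finally have "cmod (D1 g x - D1 g 1) \<le> (x - 1) * (c + 1) + I"
      using F by (simp add: integral_unique)
    then have "cmod (D1 g x) \<le> cmod (D1 g 1) + (x - 1) * (c + 1) + I"
      using norm_triangle_sub[of "D1 g x" "D1 g 1"] by linarith
    also have "\<dots> \<le> cmod (D1 g 1) * x + x * (c + 1) + I * x"
      using x I0 by (intro add_mono mult_right_mono) (auto simp: c_def mult_le_cancel_left1)
    also have "\<dots> = K1 * x" by (simp add: K1_def algebra_simps)
    finally show ?thesis .
  qed
  have b2: "cmod (g x) \<le> (K1 + cmod (g 1)) * x\<^sup>2" if x: "x \<ge> 1" for x
  proof -
    have "norm (g x - g 1) \<le> (K1 * x) * norm (x - 1)"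
    proof (rule differentiable_bound[of "{1..x}" g "\<lambda>t h. h *\<^sub>R D1 g t"])
      fix t assume t: "t \<in> {1..x}"
      then show "(g has_derivative (\<lambda>h. h *\<^sub>R D1 g t)) (at t within {1..x})"
        using D_halfD(1)[OF D, of t] by (auto simp: has_vector_derivative_def intro:
            has_derivative_at_withinI)
      have "cmod (D1 g t) \<le> K1 * x"
        using b1[of t] t K1 by (auto intro: order_trans mult_left_mono)
      then show "onorm (\<lambda>h. h *\<^sub>R D1 g t) \<le> K1 * x"
        by (intro onorm_le) (simp add: mult.commute[of "K1 * x"] mult_left_mono)
    qed (use x in auto)
    also have "\<dots> \<le> (K1 * x) * x" using x K1 by (intro mult_left_mono) auto
    finally have "cmod (g x) \<le> cmod (g 1) + K1 * x\<^sup>2"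
      using norm_triangle_sub[of "g x" "g 1"] by (simp add: power2_eq_square)
    also have "\<dots> \<le> cmod (g 1) * x\<^sup>2 + K1 * x\<^sup>2"
      using x by (simp add: mult_le_cancel_left1 one_le_power)
    finally show ?thesis by (simp add: algebra_simps)
  qed
  show ?thesis
  proof (intro exI[of _ "K1 + cmod (g 1)"] conjI allI impI)
    show "0 \<le> K1 + cmod (g 1)" using K1 by simp
    fix x :: real assume x: "1 \<le> x"
    show "cmod (g x) \<le> (K1 + cmod (g 1)) * x\<^sup>2" using b2[OF x] .
    show "cmod (D1 g x) \<le> (K1 + cmod (g 1)) * x"
      using b1[OF x] x by (auto simp: algebra_simps intro: order_trans)
  qed
qed

section \<open>Boundary conditions\<close>

lemma tendsto_at_right_cong:
  assumes "(f \<longlongrightarrow> l) (at_right (0::real))" "\<And>x. 0 < x \<Longrightarrow> x < 1 \<Longrightarrow> f x = g x"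
  shows "(g \<longlongrightarrow> l) (at_right 0)"
proof (rule Lim_transform_eventually[OF assms(1)])
  have "eventually (\<lambda>x. x \<in> {0<..<1}) (at_right (0::real))"
    by (rule eventually_at_right_real) simp
  then show "eventually (\<lambda>x. f x = g x) (at_right 0)"
    by eventually_elim (use assms(2) in auto)
qed

lemma lagrange_bracket_0_pow_fun:
  assumes \<phi>: "\<And>x. x \<in> {0<..<1} \<Longrightarrow> \<phi> x = cplx a * pow_fun s x"
    and l: "(wronskian g (D1 g) (pow_fun s) (pow_fun' s) \<longlongrightarrow> l) (at_right 0)"
  shows "lagrange_bracket_0 g \<phi> = cplx a * l"
proof -
  have "(lagrange_bracket g \<phi> \<longlongrightarrow> cplx a * l) (at_right 0)"
  proof (rule tendsto_at_right_cong[OF tendsto_mult_left[OF l]])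
    fix x :: real assume x: "0 < x" "x < 1"
    have "((\<lambda>x. cplx a * pow_fun s x) has_vector_derivative cplx a * pow_fun' s x) (at x)"
      by (intro has_vector_derivative_mult_right has_vector_derivative_pow_fun x)
    then have "(\<phi> has_vector_derivative cplx a * pow_fun' s x) (at x)"
      by (rule has_vector_derivative_transform_within_open[of _ _ _ "{0<..<1}"]) (use x \<phi> in auto)
    then have "D1 \<phi> x = cplx a * pow_fun' s x" by (rule vector_derivative_at)
    then show "cplx a * wronskian g (D1 g) (pow_fun s) (pow_fun' s) x = lagrange_bracket g \<phi> x"
      using x \<phi>[of x] by (simp add: lagrange_bracket_def wronskian_def algebra_simps)
  qed
  then show ?thesis unfolding lagrange_bracket_0_def by (intro tendsto_Lim) auto
qed

text \<open>The pair \<open>r = [g, x\<^sup>1\<^sup>/\<^sup>2\<^sup>-\<^sup>\<nu>](0)\<close>, \<open>q = [g, x\<^sup>1\<^sup>/\<^sup>2\<^sup>+\<^sup>\<nu>](0)\<close>;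
  thus \<open>[g, \<psi>](0) = r / (2 \<nu>)\<close> and \<open>[g, \<phi>](0) = q\<close>.\<close>

definition has_bval :: "real \<Rightarrow> (real \<Rightarrow> complex) \<Rightarrow> complex \<Rightarrow> complex \<Rightarrow> bool" where
  "has_bval \<nu> g r q \<longleftrightarrow> (bval_minus \<nu> g (D1 g) \<longlongrightarrow> r) (at_right 0) \<and> (bval_plus \<nu> g (D1 g) \<longlongrightarrow> q)
      (at_right 0)"

lemma has_bvalI:
  assumes "(bval_minus \<nu> f f' \<longlongrightarrow> r) (at_right 0)" "(bval_plus \<nu> f f' \<longlongrightarrow> q) (at_right 0)"
    and "\<And>x. 0 < x \<Longrightarrow> D1 f x = f' x"
  shows "has_bval \<nu> f r q"
  unfolding has_bval_def
  by (intro conjI tendsto_at_right_cong[OF assms(1)] tendsto_at_right_cong[OF assms(2)])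
    (simp_all add: wronskian_def assms(3))

lemma has_bval_exists:
  assumes "max_action \<nu> g h" "0 < \<nu>" "\<nu> < 1"
  shows "\<exists>r q. has_bval \<nu> g r q"
  using bval_exists[OF assms(1), of "1/2 - \<nu>"] bval_exists[OF assms(1), of "1/2 + \<nu>"] assms(2,3)
  unfolding has_bval_def by (auto simp: power2_eq_square algebra_simps)

lemma has_bval_lincomb:
  assumes "max_action \<nu> g1 h1" "max_action \<nu> g2 h2" "has_bval \<nu> g1 r1 q1" "has_bval \<nu> g2 r2 q2"
  shows "has_bval \<nu> (\<lambda>x. g1 x + c * g2 x) (r1 + c * r2) (q1 + c * q2)"
proof (rule has_bvalI[where f' = "\<lambda>x. 1 * D1 g1 x + c * D1 g2 x"])
  have l: "((\<lambda>x. 1 * bval_minus \<nu> g1 (D1 g1) x + c * bval_minus \<nu> g2 (D1 g2) x) \<longlongrightarrow> 1 * r1 + c * r2)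
      (at_right 0)"
    "((\<lambda>x. 1 * bval_plus \<nu> g1 (D1 g1) x + c * bval_plus \<nu> g2 (D1 g2) x) \<longlongrightarrow> 1 * q1 + c * q2) (at_right 0)"
    using assms(3,4) unfolding has_bval_def by (auto intro!: tendsto_intros)
  show "(bval_minus \<nu> (\<lambda>x. g1 x + c * g2 x) (\<lambda>x. 1 * D1 g1 x + c * D1 g2 x) \<longlongrightarrow> r1 + c * r2) (at_right 0)"
    using tendsto_at_right_cong[OF l(1)] by (simp add: wronskian_def algebra_simps)
  show "(bval_plus \<nu> (\<lambda>x. g1 x + c * g2 x) (\<lambda>x. 1 * D1 g1 x + c * D1 g2 x) \<longlongrightarrow> q1 + c * q2) (at_right 0)"
    using tendsto_at_right_cong[OF l(2)] by (simp add: wronskian_def algebra_simps)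
qed (simp add: max_action_lincomb(2)[OF assms(1,2)])

lemma resolvent_eqI:
  assumes "z \<in> resolvent_set T" "(u, f + scaleC z u) \<in> T"
  shows "resolvent T z f = u"
  unfolding resolvent_def using assms by (intro the1_equality) (auto simp: resolvent_set_def)

lemma moment_integral:
  assumes "0 < a"
  shows "integrable half_line (\<lambda>x. x ^ n * exp (- a * x))"
    and "(LINT x|half_line. x ^ n * exp (- a * x)) = fact n / a ^ Suc n"
proof -
  have e: "exp (- a * x) * x powr ((real n + 1) - 1) = x ^ n * exp (- a * x)" if
      "x \<in> space half_line" for x
    using that by (simp add: space_restrict_space powr_realpow)
  note G = Gamma_integral_scaled[of "real n + 1" a]
  show "integrable half_line (\<lambda>x. x ^ n * exp (- a * x))"
    by (rule iffD1[OF Bochner_Integration.integrable_cong[OF refl e] G(1)]) (use assms in auto)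
  have "(LINT x|half_line. x ^ n * exp (- a * x)) = Gamma (real n + 1) * a powr (- (real n + 1))"
    by (rule trans[OF Bochner_Integration.integral_cong[OF refl e[symmetric]] G(2)]) (use assms in auto)
  also have "\<dots> = fact n / a ^ Suc n"
  proof -
    have "a powr (- (real n + 1)) = 1 / a ^ Suc n"
      using powr_realpow[OF assms, of "Suc n"] powr_minus_divide[of a "real n + 1"]
          by (simp add: add.commute)
    then show ?thesis using Gamma_fact[of n, where 'a = real] by (simp add: add.commute)
  qed
  finally show "(LINT x|half_line. x ^ n * exp (- a * x)) = fact n / a ^ Suc n" .
qed

context
  fixes \<nu> :: real and \<phi> \<psi> :: "real \<Rightarrow> complex"
  assumes \<nu>: "0 < \<nu>" "\<nu> < 1" and bf: "boundary_functions \<nu> \<phi> \<psi>"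
begin

lemma T_bc_iff:
  "(u, v) \<in> T_bc \<nu> \<phi> \<psi> \<theta> \<longleftrightarrow> (\<exists>g h r q. u = abs_l2 g \<and> v = abs_l2 h \<and> max_action \<nu> g h
      \<and> has_bval \<nu> g r q \<and>
     cplx (cos \<theta>) * q + cplx (sin \<theta>) * (r / cplx (2 * \<nu>)) = 0)"
proof -
  have phi: "lagrange_bracket_0 g \<phi> = q" and psi: "lagrange_bracket_0 g \<psi> = r / cplx (2 * \<nu>)"
    if "has_bval \<nu> g r q" for g r q
  proof -
    have "lagrange_bracket_0 g \<phi> = cplx 1 * q"
      by (rule lagrange_bracket_0_pow_fun[where s = "1/2 + \<nu>"])
        (use that bf in \<open>auto simp: has_bval_def boundary_functions_def\<close>)
    then show "lagrange_bracket_0 g \<phi> = q" by simp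
    have "lagrange_bracket_0 g \<psi> = cplx (1 / (2 * \<nu>)) * r"
      by (rule lagrange_bracket_0_pow_fun[where s = "1/2 - \<nu>"])
        (use that bf in \<open>auto simp: has_bval_def boundary_functions_def\<close>)
    then show "lagrange_bracket_0 g \<psi> = r / cplx (2 * \<nu>)" by simp
  qed
  show ?thesis
  proof
    assume "(u, v) \<in> T_bc \<nu> \<phi> \<psi> \<theta>"
    then obtain g h where gh: "u = abs_l2 g" "v = abs_l2 h" "max_action \<nu> g h"
      "cplx (cos \<theta>) * lagrange_bracket_0 g \<phi> + cplx (sin \<theta>) * lagrange_bracket_0 g \<psi> = 0"
      by (auto simp: T_bc_def)
    obtain r q where "has_bval \<nu> g r q" using has_bval_exists[OF gh(3) \<nu>] by blast
    with gh phi psi show "\<exists>g h r q. u = abs_l2 g \<and> v = abs_l2 h \<and> max_action \<nu> g h \<and> has_bval \<nu> g r q \<and>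
     cplx (cos \<theta>) * q + cplx (sin \<theta>) * (r / cplx (2 * \<nu>)) = 0"
      by metis
  next
    assume "\<exists>g h r q. u = abs_l2 g \<and> v = abs_l2 h \<and> max_action \<nu> g h \<and> has_bval \<nu> g r q \<and>
     cplx (cos \<theta>) * q + cplx (sin \<theta>) * (r / cplx (2 * \<nu>)) = 0"
    then show "(u, v) \<in> T_bc \<nu> \<phi> \<psi> \<theta>" unfolding T_bc_def using phi psi by fastforce
  qed
qed

text \<open>A spectral point \<open>\<lambda> \<ge> 0\<close> is excluded by the approximate eigenfunctions
  \<open>x\<^sup>2 exp ((i \<lambda>\<^sup>1\<^sup>/\<^sup>2 - e) x)\<close>, where \<open>e\<close> tends to 0.\<close>

lemma resolvent_set_Friedrichs:
  assumes z: "z \<in> resolvent_set (T_bc \<nu> \<phi> \<psi> 0)"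
  shows "z \<notin> \<real>\<^sub>\<ge>\<^sub>0"
proof
  assume "z \<in> \<real>\<^sub>\<ge>\<^sub>0"
  then obtain l where l: "z = cplx l" "l \<ge> 0" by (auto simp: nonneg_Reals_def)
  define \<kappa> where "\<kappa> = sqrt l"
  have \<kappa>: "\<kappa> \<ge> 0" "\<kappa>\<^sup>2 = l" using l by (auto simp: \<kappa>_def)
  define c where "c = \<nu>\<^sup>2 - 1/4"
  obtain K where K: "\<And>f. norm (resolvent (T_bc \<nu> \<phi> \<psi> 0) z f) \<le> norm f * K" "K \<ge> 0"
    using z bounded_linear.nonneg_bounded unfolding resolvent_set_def bounded_clinear_def by blast
  define A where "A = \<bar>c\<bar> + 2"
  define B where "B = 4 * (\<kappa> + 1)"
  define G where "G = 1 + 2 * \<kappa>"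
  define M where "M = 16 * A\<^sup>2 + 8 * B\<^sup>2 + 24 * G\<^sup>2"
  define e where "e = 1 / (K\<^sup>2 * M + 1)"
  have M0: "M \<ge> 0" by (simp add: M_def)
  have e: "0 < e" "e \<le> 1" using M0 by (auto simp: e_def add_nonneg_pos)
  define a where "a = \<i> * cplx \<kappa> - cplx e"
  have cmod_a: "cmod a \<le> \<kappa> + 1"
    unfolding a_def using norm_triangle_ineq4[of "\<i> * cplx \<kappa>" "cplx e"] \<kappa> e by (simp add: norm_mult)
  have Re_a: "Re a = - e" by (simp add: a_def)
  define E where "E = (\<lambda>x::real. exp (a * cplx x))"
  have cE: "cmod (E x) = exp (- e * x)" for x by (simp add: E_def Re_a)
  define g where "g = (\<lambda>x. (cplx x)\<^sup>2 * E x)"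
  define g' where "g' = (\<lambda>x. (2 * cplx x + a * (cplx x)\<^sup>2) * E x)"
  define g'' where "g'' = (\<lambda>x. (2 + 4 * a * cplx x + a\<^sup>2 * (cplx x)\<^sup>2) * E x)"
  define F where "F = (\<lambda>x. (cplx c - 2 - 4 * a * cplx x - (a\<^sup>2 + z) * (cplx x)\<^sup>2) * E x)"
  define h where "h = (\<lambda>x. F x + z * g x)"
  have dE: "(E has_vector_derivative a * E x) (at x)" for x
  proof -
    have "((\<lambda>x. a * cplx x) has_vector_derivative a * cplx 1) (at x)"
      by (intro has_vector_derivative_mult_right has_vector_derivative_of_real)
          (auto intro!: derivative_eq_intros)
    from field_vector_diff_chain_at[OF this DERIV_exp] show ?thesis
      by (simp add: E_def o_def mult.commute)
  qed
  have dx: "(cplx has_vector_derivative 1) (at x)" for x :: real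
    using has_vector_derivative_of_real[of "\<lambda>x. x" 1 "at x"] by simp
  have dx2: "((\<lambda>x. (cplx x)\<^sup>2) has_vector_derivative 2 * cplx x) (at x)" for x :: real
    using has_vector_derivative_mult[OF dx dx, of x]
        by (simp add: power2_eq_square algebra_simps mult_2)
  have dg: "(g has_vector_derivative g' x) (at x)" for x
    using has_vector_derivative_mult[OF dx2 dE, of x] by (simp add: g_def g'_def algebra_simps)
  have dg': "(g' has_vector_derivative g'' x) (at x)" for x
  proof -
    have "(g' has_vector_derivative (2 * cplx x + a * (cplx x)\<^sup>2) * (a * E x)
        + (2 * 1 + a * (2 * cplx x)) * E x) (at x)"
      unfolding g'_def
      by (intro has_vector_derivative_mult has_vector_derivative_add
          has_vector_derivative_mult_right dE dx dx2)
    then show ?thesis by (simp add: g''_def algebra_simps power2_eq_square)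
  qed
  have contE: "continuous_on S E" for S unfolding E_def by (intro continuous_intros)
  have normg: "(cmod (g x))\<^sup>2 = x ^ 4 * exp (- (2 * e) * x)" for x
  proof -
    have "(cmod (g x))\<^sup>2 = (x\<^sup>2)\<^sup>2 * (exp (- e * x))\<^sup>2"
      by (simp add: g_def norm_mult norm_power cE power_mult_distrib)
    also have "(exp (- e * x))\<^sup>2 = exp (- (2 * e) * x)"
      by (simp add: power2_eq_square mult_exp_exp)
    finally show ?thesis by simp
  qed
  define H where "H = (\<lambda>x. 3 * (A\<^sup>2 * (x ^ 0 * exp (- (2 * e) * x)) + B\<^sup>2 * (x ^ 2 * exp (- (2 * e) * x))
      + (G * e)\<^sup>2 * (x ^ 4 * exp (- (2 * e) * x))))"
  have intH: "integrable half_line H"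
    unfolding H_def using e
    by (intro integrable_mult_right Bochner_Integration.integrable_add moment_integral(1)) auto
  have normF: "(cmod (F x))\<^sup>2 \<le> H x" if x: "0 < x" for x
  proof -
    have "a\<^sup>2 + z = cplx (e\<^sup>2) - 2 * \<i> * cplx (\<kappa> * e)"
      unfolding a_def l(1) \<kappa>(2)[symmetric] by (simp add: power2_eq_square algebra_simps)
    then have "cmod (a\<^sup>2 + z) \<le> e\<^sup>2 + 2 * (\<kappa> * e)"
      using norm_triangle_ineq4[of "cplx (e\<^sup>2)" "2 * \<i> * cplx (\<kappa> * e)"] e \<kappa>
      by (simp add: norm_mult norm_power)
    also have "\<dots> \<le> G * e"
      using e \<kappa> by (simp add: G_def power2_eq_square algebra_simps mult_left_le)
    finally have az: "cmod (a\<^sup>2 + z) \<le> G * e" .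
    have "cmod (cplx c - 2 - 4 * a * cplx x - (a\<^sup>2 + z) * (cplx x)\<^sup>2)
       \<le> cmod (cplx c - 2) + cmod (4 * a * cplx x) + cmod ((a\<^sup>2 + z) * (cplx x)\<^sup>2)"
      by (intro order_trans[OF norm_triangle_ineq4] add_mono order_refl norm_triangle_ineq4)
    also have "\<dots> \<le> A + B * x + G * e * x\<^sup>2"
    proof (intro add_mono)
      show "cmod (cplx c - 2) \<le> A"
        using norm_triangle_ineq4[of "cplx c" 2] by (simp add: A_def)
      show "cmod (4 * a * cplx x) \<le> B * x"
        using cmod_a x by (simp add: B_def norm_mult)
      show "cmod ((a\<^sup>2 + z) * (cplx x)\<^sup>2) \<le> G * e * x\<^sup>2"
        using az by (simp add: norm_mult norm_power mult_right_mono)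
    qed
    finally have "(cmod (cplx c - 2 - 4 * a * cplx x - (a\<^sup>2 + z) * (cplx x)\<^sup>2))\<^sup>2
       \<le> (A + B * x + G * e * x\<^sup>2)\<^sup>2"
      by (intro power_mono) auto
    also have "\<dots> \<le> 3 * (A\<^sup>2 + B\<^sup>2 * x ^ 2 + (G * e)\<^sup>2 * x ^ 4)"
    proof -
      have "(p + q + r)\<^sup>2 \<le> 3 * (p\<^sup>2 + q\<^sup>2 + r\<^sup>2)" for p q r :: real
        using sum_squares_bound[of p q] sum_squares_bound[of p r] sum_squares_bound[of q r]
        by (simp add: power2_eq_square algebra_simps)
      from this[of A "B * x" "G * e * x\<^sup>2"] show ?thesis by (simp add: power_mult_distrib)
    qed
    finally have "(cmod (cplx c - 2 - 4 * a * cplx x - (a\<^sup>2 + z) * (cplx x)\<^sup>2))\<^sup>2 * (exp (- e * x))\<^sup>2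
       \<le> 3 * (A\<^sup>2 + B\<^sup>2 * x ^ 2 + (G * e)\<^sup>2 * x ^ 4) * (exp (- e * x))\<^sup>2"
      by (rule mult_right_mono) simp
    also have "\<dots> = H x"
    proof -
      have "(exp (- e * x))\<^sup>2 = exp (- (2 * e) * x)"
        by (simp add: power2_eq_square mult_exp_exp)
      then show ?thesis by (simp add: H_def algebra_simps)
    qed
    finally show ?thesis unfolding F_def norm_mult cE power_mult_distrib .
  qed
  have sqg: "square_integrable g"
    unfolding square_integrable_def normg using e
    by (intro conjI moment_integral(1) half_line_continuous_measurable)
        (auto simp: g_def intro!: continuous_intros contE)
  have sqF: "square_integrable F"
    unfolding square_integrable_def
  proof
    show m: "F \<in> borel_measurable half_line"
      unfolding F_def by (intro half_line_continuous_measurable continuous_intros contE)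
    show "integrable half_line (\<lambda>x. (cmod (F x))\<^sup>2)"
    proof (rule Bochner_Integration.integrable_bound[OF intH])
      show "(\<lambda>x. (cmod (F x))\<^sup>2) \<in> borel_measurable half_line" using m by measurable
      show "AE x in half_line. norm ((cmod (F x))\<^sup>2) \<le> norm (H x)"
        by (rule AE_I2) (use normF in \<open>auto simp: space_restrict_space intro:
            order_trans[OF _ abs_ge_self]\<close>)
    qed
  qed
  have sqh: "square_integrable h"
    unfolding h_def by (intro square_integrable_add square_integrable_scale sqF sqg)
  have eqh: "h x = - g'' x + bpot \<nu> x * g x" if x: "0 < x" for x
  proof -
    have "bpot \<nu> x * g x = cplx c * E x"
      using x by (simp add: g_def c_def)
    then show ?thesis by (simp add: h_def F_def g''_def g_def algebra_simps)
  qed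
  have "continuous_on {0<..} g''"
    unfolding g''_def by (intro continuous_intros contE)
  note act = max_actionI[OF dg dg' this sqg sqh eqh]
  have bv: "(wronskian g g' (pow_fun s) (pow_fun' s) \<longlongrightarrow> 0) (at_right 0)" if s: "- 1 < s" for s
  proof -
    have p: "((\<lambda>x. x powr (s + 1)) \<longlongrightarrow> 0) (at_right 0)" "((\<lambda>x. x powr (s + 2)) \<longlongrightarrow> 0) (at_right 0)"
      using s by real_asymp+
    have "(E \<longlongrightarrow> E 0) (at_right 0)"
      using contE[of UNIV] by (auto simp: continuous_on_def intro: tendsto_within_subset)
    then have "((\<lambda>x. (cplx ((s - 2) * x powr (s + 1)) - a * cplx (x powr (s + 2))) * E x)
        \<longlongrightarrow> (cplx ((s - 2) * 0) - a * cplx 0) * E 0) (at_right 0)"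
      by (intro tendsto_intros p)
    then have "(wronskian g g' (pow_fun s) (pow_fun' s)
        \<longlongrightarrow> (cplx ((s - 2) * 0) - a * cplx 0) * E 0) (at_right 0)"
    proof (rule tendsto_at_right_cong)
      fix x :: real assume x: "0 < x"
      have "x powr (s + 1) = x\<^sup>2 * x powr (s - 1)" "x powr s = x * x powr (s - 1)"
          "x powr (s + 2) = x * (x\<^sup>2 * x powr (s - 1))"
      proof -
        have "s + 1 = 2 + (s - 1)" "s + 2 = 1 + (2 + (s - 1))" by simp_all
        then have "x powr (s + 1) = x powr 2 * x powr (s - 1)"
            "x powr (s + 2) = x powr 1 * (x powr 2 * x powr (s - 1))"
          by (simp_all only: powr_add)
        then show "x powr (s + 1) = x\<^sup>2 * x powr (s - 1)" "x powr (s + 2) = x * (x\<^sup>2 * x powr (s - 1))"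
          using x by simp_all
        show "x powr s = x * x powr (s - 1)" using x by (simp add: powr_mult_base)
      qed
      then show "(cplx ((s - 2) * x powr (s + 1)) - a * cplx (x powr (s + 2))) * E x =
          wronskian g g' (pow_fun s) (pow_fun' s) x"
        by (simp add: wronskian_def g_def g'_def algebra_simps power2_eq_square)
    qed
    then show ?thesis by simp
  qed
  have "has_bval \<nu> g 0 0"
    using \<nu> by (intro has_bvalI[OF bv bv act(2)]) auto
  then have "(abs_l2 g, abs_l2 h) \<in> T_bc \<nu> \<phi> \<psi> 0"
    unfolding T_bc_iff using act(1) by (intro exI[of _ g] exI[of _ h] exI[of _ 0]) simp
  moreover have "abs_l2 h = abs_l2 F + scaleC z (abs_l2 g)"
    by (simp add: h_def scaleC_abs_l2 plus_abs_l2 sqF sqg square_integrable_scale)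
  ultimately have "resolvent (T_bc \<nu> \<phi> \<psi> 0) z (abs_l2 F) = abs_l2 g"
    by (intro resolvent_eqI[OF z]) simp
  with K(1)[of "abs_l2 F"] have "norm (abs_l2 g) \<le> norm (abs_l2 F) * K" by simp
  then have "(norm (abs_l2 g))\<^sup>2 \<le> (norm (abs_l2 F) * K)\<^sup>2" by (rule power_mono) simp
  then have "(norm (abs_l2 g))\<^sup>2 \<le> K\<^sup>2 * (norm (abs_l2 F))\<^sup>2"
      by (simp add: power_mult_distrib mult.commute)
  also have "(norm (abs_l2 g))\<^sup>2 = 24 / (2 * e) ^ 5"
    unfolding norm_abs_l2[OF sqg] normg using moment_integral(2)[of "2 * e" 4] e
        by (simp add: fact_numeral)
  also have "(norm (abs_l2 F))\<^sup>2 \<le> (LINT x|half_line. H x)"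
    unfolding norm_abs_l2[OF sqF]
    by (rule integral_mono) (use sqF intH normF in \<open>auto simp: square_integrable_def
        space_restrict_space\<close>)
  also have "(LINT x|half_line. H x) = 3 * (A\<^sup>2 * (1 / (2 * e)) + B\<^sup>2 * (2 / (2 * e) ^ 3) + (G * e)\<^sup>2 *
      (24 / (2 * e) ^ 5))"
  proof -
    note m = moment_integral[of "2 * e"]
    show ?thesis
      unfolding H_def using m(1)[of 0] m(1)[of 2] m(1)[of 4] m(2)[of 0] m(2)[of 2] m(2)[of 4] e
      by (simp add: fact_numeral)
  qed
  finally have "24 / (2 * e) ^ 5 \<le> K\<^sup>2 * (3 * (A\<^sup>2 * (1 / (2 * e)) + B\<^sup>2 * (2 / (2 * e) ^ 3) + (G * e)\<^sup>2
      * (24 / (2 * e) ^ 5)))"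
    by (simp add: mult_left_mono)
  then have "24 / (2 * e) ^ 5 * (2 * e) ^ 5 \<le> K\<^sup>2 *
      (3 * (A\<^sup>2 * (1 / (2 * e)) + B\<^sup>2 * (2 / (2 * e) ^ 3) + (G * e)\<^sup>2 * (24 / (2 * e) ^ 5))) * (2 * e) ^ 5"
    by (rule mult_right_mono) (use e in simp)
  moreover have "K\<^sup>2 * (3 * (A\<^sup>2 * p + B\<^sup>2 * q + (G * e)\<^sup>2 * r)) * w
      = K\<^sup>2 * (3 * (A\<^sup>2 * (p * w) + B\<^sup>2 * (q * w) + (G * e)\<^sup>2 * (r * w)))" for p q r w :: real
    by (simp add: algebra_simps)
  moreover have "1 / (2 * e) * (2 * e) ^ 5 = 16 * e ^ 4" "2 / (2 * e) ^ 3 * (2 * e) ^ 5 = 8 * e\<^sup>2"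
      "24 / (2 * e) ^ 5 * (2 * e) ^ 5 = 24"
    using e by (simp_all add: field_simps eval_nat_numeral)
  ultimately have "24 \<le> K\<^sup>2 * (3 * (A\<^sup>2 * (16 * e ^ 4) + B\<^sup>2 * (8 * e\<^sup>2) + (G * e)\<^sup>2 * 24))"
    by (simp only:)
  also have "\<dots> = 3 * K\<^sup>2 * (e\<^sup>2 * (16 * A\<^sup>2 * e\<^sup>2 + 8 * B\<^sup>2 + 24 * G\<^sup>2))"
    by (simp add: algebra_simps eval_nat_numeral)
  finally have "24 \<le> 3 * K\<^sup>2 * (e\<^sup>2 * (16 * A\<^sup>2 * e\<^sup>2 + 8 * B\<^sup>2 + 24 * G\<^sup>2))" .
  also have "\<dots> \<le> 3 * K\<^sup>2 * (e * M)"
  proof (intro mult_left_mono mult_mono)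
    show "e\<^sup>2 \<le> e" using e by (simp add: power2_eq_square mult_left_le)
    have "e\<^sup>2 \<le> 1" using e by (simp add: power_le_one)
    then show "16 * A\<^sup>2 * e\<^sup>2 + 8 * B\<^sup>2 + 24 * G\<^sup>2 \<le> M" by (simp add: M_def mult_left_le)
  qed (use e M0 in auto)
  also have "\<dots> = 3 * (K\<^sup>2 * M / (K\<^sup>2 * M + 1))" by (simp add: e_def)
  also have "\<dots> \<le> 3" using M0 by (simp add: divide_le_eq add_nonneg_pos)
  finally show False by simp
qed

end

section \<open>Green's formula for the square-integrable solution\<close>

lemma square_integrable_cnj:
  assumes "square_integrable f"
  shows "square_integrable (\<lambda>x. cnj (f x))"
proof -
  have "f \<in> borel_measurable half_line" using assms by (simp add: square_integrable_def)
  then have "(\<lambda>x. cnj (f x)) \<in> borel_measurable half_line"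
    by (rule borel_measurable_continuous_on[OF continuous_on_cnj[OF continuous_on_id]])
  then show ?thesis using assms by (simp add: square_integrable_def)
qed

lemma integrable_mult_square_integrable:
  assumes "square_integrable f" "square_integrable g"
  shows "integrable half_line (\<lambda>x. f x * g x)"
  using square_integrable_mult_integrable[OF square_integrable_cnj[OF assms(1)] assms(2)] by simp

lemma square_integrable_half_line_cong:
  assumes "\<And>x. 0 < x \<Longrightarrow> f x = g x" "square_integrable g"
  shows "square_integrable f" "abs_l2 f = abs_l2 g"
proof -
  have "f \<in> borel_measurable half_line \<longleftrightarrow> g \<in> borel_measurable half_line"
    by (rule measurable_cong) (simp add: assms(1) space_restrict_space)
  moreover have "integrable half_line (\<lambda>x. (cmod (f x))\<^sup>2) \<longleftrightarrow> integrable half_line (\<lambda>x. (cmod (g x))\<^sup>2)"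
    by (rule Bochner_Integration.integrable_cong) (simp_all add: assms(1) space_restrict_space)
  ultimately show f: "square_integrable f" using assms(2) by (simp add: square_integrable_def)
  show "abs_l2 f = abs_l2 g"
    unfolding abs_l2_eq_iff[OF f assms(2)] by (rule AE_I2) (simp add: assms(1) space_restrict_space)
qed

context
  fixes \<nu> :: real and z :: complex
  assumes \<nu>: "0 < \<nu>" "\<nu> < 1" and z: "z \<notin> \<real>\<^sub>\<ge>\<^sub>0"
begin

lemma weyl_derivatives:
  assumes "0 < x"
  shows "(weyl \<nu> z has_vector_derivative weyl' \<nu> z x) (at x)"
    "(weyl' \<nu> z has_vector_derivative (bpot \<nu> x - z) * weyl \<nu> z x) (at x)"
  using bessel_solution_weyl[OF \<nu>, of z] assms by (auto simp: bessel_solution_def)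

lemma continuous_on_weyl: "continuous_on {0<..} (weyl \<nu> z)"
  by (rule half_line_continuous_onI[OF weyl_derivatives(1)])

lemma square_integrable_weyl: "square_integrable (weyl \<nu> z)"
  unfolding square_integrable_def
proof
  show m: "weyl \<nu> z \<in> borel_measurable half_line"
    by (rule half_line_continuous_measurable[OF continuous_on_weyl])
  obtain C \<delta> where C: "0 \<le> C" "0 < \<delta>" "\<And>x. 0 < x \<Longrightarrow> cmod (weyl \<nu> z x) \<le> C *
      (x powr (1/2 - \<nu>) * exp (- \<delta> * x))"
    using weyl_decay[OF \<nu> z] by blast
  show "integrable half_line (\<lambda>x. (cmod (weyl \<nu> z x))\<^sup>2)"
  proof (rule Bochner_Integration.integrable_bound)
    show "integrable half_line (\<lambda>x. C\<^sup>2 * (exp (- (2 * \<delta>) * x) * x powr ((2 - 2 * \<nu>) - 1)))"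
      using \<nu> C(2) by (intro integrable_mult_right Gamma_integral_scaled(1)) auto
    show "(\<lambda>x. (cmod (weyl \<nu> z x))\<^sup>2) \<in> borel_measurable half_line" using m by measurable
    show "AE x in half_line. norm ((cmod (weyl \<nu> z x))\<^sup>2) \<le> norm
        (C\<^sup>2 * (exp (- (2 * \<delta>) * x) * x powr ((2 - 2 * \<nu>) - 1)))"
    proof (rule AE_half_lineI)
      fix x :: real assume x: "0 < x"
      have "(cmod (weyl \<nu> z x))\<^sup>2 \<le> (C * (x powr (1/2 - \<nu>) * exp (- \<delta> * x)))\<^sup>2"
        using C(3)[OF x] by (rule power_mono) simp
      also have "\<dots> = C\<^sup>2 * ((exp (- \<delta> * x) * exp (- \<delta> * x)) * (x powr (1/2 - \<nu>) * x powr (1/2 - \<nu>)))"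
        by (simp add: power2_eq_square)
      also have "\<dots> = C\<^sup>2 * (exp (- (2 * \<delta>) * x) * x powr ((2 - 2 * \<nu>) - 1))"
        unfolding mult_exp_exp powr_add[symmetric] by simp
      finally show "norm ((cmod (weyl \<nu> z x))\<^sup>2) \<le> norm
          (C\<^sup>2 * (exp (- (2 * \<delta>) * x) * x powr ((2 - 2 * \<nu>) - 1)))"
        by simp
    qed
  qed
qed

lemma max_action_weyl:
  "max_action \<nu> (weyl \<nu> z) (\<lambda>x. z * weyl \<nu> z x)" "0 < x \<Longrightarrow> D1 (weyl \<nu> z) x = weyl' \<nu> z x"
proof -
  have cont: "continuous_on {0<..} (\<lambda>x. (bpot \<nu> x - z) * weyl \<nu> z x)"
    by (intro continuous_intros continuous_on_weyl) auto
  note act = max_actionI[OF weyl_derivatives cont square_integrable_weyl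
      square_integrable_scale[OF square_integrable_weyl, of z], of \<nu>]
  show "max_action \<nu> (weyl \<nu> z) (\<lambda>x. z * weyl \<nu> z x)"
    by (rule act(1)) (auto simp: algebra_simps)
  show "0 < x \<Longrightarrow> D1 (weyl \<nu> z) x = weyl' \<nu> z x"
    by (rule act(2)) (auto simp: algebra_simps)
qed

lemma has_bval_weyl: "has_bval \<nu> (weyl \<nu> z) (cplx (2 * \<nu>) * krein_m \<nu> z) 1"
  by (rule has_bvalI[OF bval_weyl[OF \<nu>] max_action_weyl(2)])

lemma weyl_decay_at_top:
  "\<exists>C \<delta>. 0 \<le> C \<and> 0 < \<delta> \<and> (\<forall>x\<ge>1. cmod (weyl \<nu> z x) \<le> C * (x * exp (- \<delta> * x)) \<and>
     cmod (weyl' \<nu> z x) \<le> C * (x * exp (- \<delta> * x)))"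
proof -
  obtain C \<delta> where C: "0 \<le> C" "0 < \<delta>" "\<And>x. 0 < x \<Longrightarrow> cmod (weyl \<nu> z x) \<le> C *
      (x powr (1/2 - \<nu>) * exp (- \<delta> * x))"
      "\<And>x. 1 \<le> x \<Longrightarrow> cmod (weyl' \<nu> z x) \<le> C * (x * exp (- \<delta> * x))"
    using weyl_decay[OF \<nu> z] by blast
  have "cmod (weyl \<nu> z x) \<le> C * (x * exp (- \<delta> * x))" if x: "x \<ge> 1" for x
  proof -
    have "x powr (1/2 - \<nu>) \<le> x" using powr_mono[of "1/2 - \<nu>" 1 x] x \<nu> by simp
    then have "C * (x powr (1/2 - \<nu>) * exp (- \<delta> * x)) \<le> C * (x * exp (- \<delta> * x))"
      using C(1) by (intro mult_left_mono mult_right_mono) auto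
    then show ?thesis using C(3)[of x] x by linarith
  qed
  then show ?thesis using C by blast
qed

lemma green_weyl:
  assumes g: "max_action \<nu> g h" and bv: "has_bval \<nu> g r q"
  shows "(LINT x|half_line. weyl \<nu> z x * h x - z * (weyl \<nu> z x * g x)) = q * krein_m \<nu> z - r / cplx
      (2 * \<nu>)"
proof -
  have sq: "square_integrable g" "square_integrable h" using g by (auto simp: max_action_def)
  have "(LINT x|half_line. weyl \<nu> z x * h x - z * (weyl \<nu> z x * g x))
      = 0 - (r * 1 - q * (cplx (2 * \<nu>) * krein_m \<nu> z)) / cplx (2 * \<nu>)"
  proof (rule integral_half_line_improper)
    show "integrable half_line (\<lambda>x. weyl \<nu> z x * h x - z * (weyl \<nu> z x * g x))"
      by (intro Bochner_Integration.integrable_diff integrable_mult_right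
          integrable_mult_square_integrable square_integrable_weyl sq)
    show "((\<lambda>x. weyl \<nu> z x * h x - z * (weyl \<nu> z x * g x)) has_integral
        (wronskian g (D1 g) (weyl \<nu> z) (weyl' \<nu> z) b - wronskian g (D1 g) (weyl \<nu> z) (weyl' \<nu> z) a))
            {a..b}"
      if "0 < a" "a \<le> b" for a b
      by (rule green_formula[OF g bessel_solution_weyl[OF \<nu>] that])
    show "(wronskian g (D1 g) (weyl \<nu> z) (weyl' \<nu> z) \<longlongrightarrow>
        (r * 1 - q * (cplx (2 * \<nu>) * krein_m \<nu> z)) / cplx (2 * \<nu>)) (at_right 0)"
      using bv unfolding has_bval_def by (intro tendsto_wronskian_bval[OF \<nu>] bval_weyl[OF \<nu>]) auto
    obtain K where K: "K \<ge> 0" "\<And>x. x \<ge> 1 \<Longrightarrow> cmod (D1 g x) \<le> K * x" "\<And>x. x \<ge> 1 \<Longrightarrow> cmod (g x) \<le> K * x\<^sup>2"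
      using max_action_growth[OF g] by blast
    obtain C \<delta> where C: "0 \<le> C" "0 < \<delta>" "\<And>x. x \<ge> 1 \<Longrightarrow> cmod (weyl \<nu> z x) \<le> C * (x * exp (- \<delta> * x))"
      "\<And>x. x \<ge> 1 \<Longrightarrow> cmod (weyl' \<nu> z x) \<le> C * (x * exp (- \<delta> * x))"
      using weyl_decay_at_top by blast
    show "(wronskian g (D1 g) (weyl \<nu> z) (weyl' \<nu> z) \<longlongrightarrow> 0) at_top"
    proof (rule Lim_null_comparison)
      show "((\<lambda>x. 2 * K * C * (x ^ 3 * exp (- \<delta> * x))) \<longlongrightarrow> 0) at_top"
      proof (rule tendsto_mult_right_zero)
        show "((\<lambda>x. x ^ 3 * exp (- \<delta> * x)) \<longlongrightarrow> 0) at_top" using C(2) by real_asymp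
      qed
      show "\<forall>\<^sub>F x in at_top. norm (wronskian g (D1 g) (weyl \<nu> z) (weyl' \<nu> z) x) \<le> 2 * K * C *
          (x ^ 3 * exp (- \<delta> * x))"
      proof (rule eventually_mono[OF eventually_ge_at_top[of 1]])
        fix x :: real assume x: "1 \<le> x"
        have "norm (wronskian g (D1 g) (weyl \<nu> z) (weyl' \<nu> z) x)
            \<le> cmod (g x) * cmod (weyl' \<nu> z x) + cmod (D1 g x) * cmod (weyl \<nu> z x)"
          unfolding wronskian_def using norm_triangle_ineq4[of "g x * weyl' \<nu> z x"
              "D1 g x * weyl \<nu> z x"] by (simp add: norm_mult)
        also have "\<dots> \<le> (K * x\<^sup>2) * (C * (x * exp (- \<delta> * x))) + (K * x) * (C * (x * exp (- \<delta> * x)))"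
          using K C x by (intro add_mono mult_mono) auto
        also have "(K * x) * (C * (x * exp (- \<delta> * x))) \<le> (K * x\<^sup>2) * (C * (x * exp (- \<delta> * x)))"
          using K C x by (intro mult_right_mono mult_left_mono)
              (auto simp: power2_eq_square mult_le_cancel_left1)
        finally show "norm (wronskian g (D1 g) (weyl \<nu> z) (weyl' \<nu> z) x) \<le> 2 * K * C *
            (x ^ 3 * exp (- \<delta> * x))"
          by (simp add: power2_eq_square power3_eq_cube algebra_simps)
      qed
    qed
  qed
  then show ?thesis using \<nu> by (simp add: field_simps)
qed

text \<open>Scaling shows that \<open>(\<tau> - z) (x w') = 2 z w\<close> for a solution \<open>w\<close>; hence the Wronskian of \<open>x w'\<close> and
  \<open>w\<close> is a primitive of \<open>2 z w\<^sup>2\<close>. At the origin it is the product of the two boundary values.\<close>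

lemma weyl_primitive:
  assumes x: "0 < x"
  defines "c \<equiv> \<lambda>x. cplx ((\<nu>\<^sup>2 - 1/4) / x)"
  shows "((\<lambda>x. cplx x * (weyl' \<nu> z x)\<^sup>2 - weyl \<nu> z x * weyl' \<nu> z x - (c x - z * cplx x) * (weyl \<nu> z x)\<^sup>2)
    has_vector_derivative 2 * z * (weyl \<nu> z x * weyl \<nu> z x)) (at x)"
proof -
  let ?w = "weyl \<nu> z" and ?w' = "weyl' \<nu> z"
  define d where "d = bpot \<nu> x"
  have cd: "c x = d * cplx x" using x by (simp add: c_def d_def power2_eq_square)
  have dw: "(?w has_vector_derivative ?w' x) (at x)" "(?w' has_vector_derivative (d - z) * ?w x) (at x)"
    using weyl_derivatives[OF x] by (auto simp: d_def)
  have dx: "(cplx has_vector_derivative 1) (at x)"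
    using has_vector_derivative_of_real[of "\<lambda>x. x" 1 "at x"] by simp
  have dc: "(c has_vector_derivative - d) (at x)"
  proof -
    have "((\<lambda>x. (\<nu>\<^sup>2 - 1/4) / x) has_real_derivative - ((\<nu>\<^sup>2 - 1/4) / x\<^sup>2)) (at x)"
      using x by (auto intro!: derivative_eq_intros simp: power2_eq_square minus_divide_left)
    from has_vector_derivative_of_real[OF this, where 'a = complex]
    show ?thesis unfolding c_def d_def of_real_minus .
  qed
  have "((\<lambda>x. cplx x * (?w' x * ?w' x) - ?w x * ?w' x - (c x - z * cplx x) * (?w x * ?w x))
      has_vector_derivative
      (cplx x * (?w' x * ((d - z) * ?w x) + ((d - z) * ?w x) * ?w' x) + 1 * (?w' x * ?w' x))
      - (?w x * ((d - z) * ?w x) + ?w' x * ?w' x)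
      - ((c x - z * cplx x) * (?w x * ?w' x + ?w' x * ?w x) + (- d - z * 1) * (?w x * ?w x))) (at x)"
    by (intro has_vector_derivative_diff has_vector_derivative_mult has_vector_derivative_mult_right
        dw dx dc)
  moreover have "(cplx x * (?w' x * ((d - z) * ?w x) + ((d - z) * ?w x) * ?w' x) + 1 * (?w' x * ?w' x))
      - (?w x * ((d - z) * ?w x) + ?w' x * ?w' x)
      - ((c x - z * cplx x) * (?w x * ?w' x + ?w' x * ?w x) + (- d - z * 1) * (?w x * ?w x))
      = 2 * z * (?w x * ?w x)"
    unfolding cd by (simp add: algebra_simps)
  ultimately show ?thesis unfolding power2_eq_square by simp
qed

lemma weyl_primitive_bval:
  assumes x: "0 < x"
  shows "cplx x * (f' x)\<^sup>2 - f x * f' x - cplx ((\<nu>\<^sup>2 - 1/4) / x) * (f x)\<^sup>2 = bval_minus \<nu> f f' x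
      * bval_plus \<nu> f f' x"
proof -
  have e: "x powr (1/2 - \<nu>) * x powr (1/2 + \<nu>) = x" "x powr (1/2 - \<nu> - 1) * x powr (1/2 + \<nu>) = 1"
    "x powr (1/2 - \<nu>) * x powr (1/2 + \<nu> - 1) = 1" "x powr (1/2 - \<nu> - 1) * x powr (1/2 + \<nu> - 1) = 1 / x"
    unfolding powr_add[symmetric] using x by (simp_all add: powr_neg_one)
  have "bval_minus \<nu> f f' x * bval_plus \<nu> f f' x =
    cplx ((1/2 - \<nu>) * (1/2 + \<nu>) * (x powr (1/2 - \<nu> - 1) * x powr (1/2 + \<nu> - 1))) * (f x)\<^sup>2
    - cplx ((1/2 - \<nu>) * (x powr (1/2 - \<nu> - 1) * x powr (1/2 + \<nu>)) + (1/2 + \<nu>) *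
        (x powr (1/2 - \<nu>) * x powr (1/2 + \<nu> - 1))) * (f x * f' x)
    + cplx (x powr (1/2 - \<nu>) * x powr (1/2 + \<nu>)) * (f' x)\<^sup>2"
    unfolding wronskian_def of_real_mult of_real_add power2_eq_square by (simp only: algebra_simps)
  also have "\<dots> = cplx x * (f' x)\<^sup>2 - f x * f' x - cplx ((\<nu>\<^sup>2 - 1/4) / x) * (f x)\<^sup>2"
  proof -
    have "(1/2 - \<nu>) * (1/2 + \<nu>) * (1 / x) = - ((\<nu>\<^sup>2 - 1/4) / x)"
      by (simp add: power2_eq_square algebra_simps diff_divide_distrib)
    moreover have "(1/2 - \<nu>) * 1 + (1/2 + \<nu>) * 1 = (1::real)" by simp
    ultimately show ?thesis unfolding e by (simp only: of_real_minus of_real_1) simp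
  qed
  finally show ?thesis by simp
qed

lemma integral_weyl_square:
  "(LINT x|half_line. weyl \<nu> z x * weyl \<nu> z x) = - (cplx \<nu> * krein_m \<nu> z / z)"
proof -
  let ?w = "weyl \<nu> z" and ?w' = "weyl' \<nu> z"
  define c where "c = (\<lambda>x. cplx ((\<nu>\<^sup>2 - 1/4) / x))"
  define A where "A = (\<lambda>x. cplx x * (?w' x)\<^sup>2 - ?w x * ?w' x - (c x - z * cplx x) * (?w x)\<^sup>2)"
  have zn: "z \<noteq> 0" using z by auto
  have "(LINT x|half_line. 2 * z * (?w x * ?w x)) = 0 - cplx (2 * \<nu>) * krein_m \<nu> z * 1"
  proof (rule integral_half_line_improper)
    show "integrable half_line (\<lambda>x. 2 * z * (?w x * ?w x))"
      by (intro integrable_mult_right integrable_mult_square_integrable square_integrable_weyl)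
    show "((\<lambda>x. 2 * z * (?w x * ?w x)) has_integral (A b - A a)) {a..b}" if "0 < a" "a \<le> b" for a b
    proof (rule fundamental_theorem_of_calculus[OF that(2)])
      fix x assume "x \<in> {a..b}"
      then have "0 < x" using that by simp
      then show "(A has_vector_derivative 2 * z * (?w x * ?w x)) (at x within {a..b})"
        unfolding A_def c_def by (rule has_vector_derivative_at_within[OF weyl_primitive])
    qed
    obtain C \<delta> where C: "0 \<le> C" "0 < \<delta>" "\<And>x. 0 < x \<Longrightarrow> cmod (?w x) \<le> C *
        (x powr (1/2 - \<nu>) * exp (- \<delta> * x))"
      using weyl_decay[OF \<nu> z] by blast
    have "((\<lambda>x. z * (cplx x * (?w x)\<^sup>2)) \<longlongrightarrow> 0) (at_right 0)"
    proof (intro tendsto_mult_right_zero, rule Lim_null_comparison)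
      show "((\<lambda>x. C\<^sup>2 * x powr (2 - 2 * \<nu>)) \<longlongrightarrow> 0) (at_right 0)"
        using \<nu> by (intro tendsto_mult_right_zero) real_asymp
      show "\<forall>\<^sub>F x in at_right 0. norm (cplx x * (?w x)\<^sup>2) \<le> C\<^sup>2 * x powr (2 - 2 * \<nu>)"
      proof (rule eventually_mono[OF eventually_at_right_less])
        fix x :: real assume x: "0 < x"
        have "x powr (1/2 - \<nu>) * exp (- \<delta> * x) \<le> x powr (1/2 - \<nu>) * 1"
          using x C(2) by (intro mult_left_mono) auto
        then have "cmod (?w x) \<le> C * x powr (1/2 - \<nu>)"
          using C(3)[OF x] mult_left_mono[OF _ C(1)] by fastforce
        then have "(cmod (?w x))\<^sup>2 \<le> (C * x powr (1/2 - \<nu>))\<^sup>2" by (rule power_mono) simp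
        then have "x * (cmod (?w x))\<^sup>2 \<le> x * (C * x powr (1/2 - \<nu>))\<^sup>2" using x
            by (intro mult_left_mono) auto
        also have "\<dots> = C\<^sup>2 * (x powr 1 * (x powr (1/2 - \<nu>) * x powr (1/2 - \<nu>)))"
          using x by (simp add: power2_eq_square)
        also have "\<dots> = C\<^sup>2 * x powr (2 - 2 * \<nu>)" unfolding powr_add[symmetric] by simp
        finally show "norm (cplx x * (?w x)\<^sup>2) \<le> C\<^sup>2 * x powr (2 - 2 * \<nu>)"
          using x by (simp add: norm_mult norm_power)
      qed
    qed
    then have "((\<lambda>x. bval_minus \<nu> ?w ?w' x * bval_plus \<nu> ?w ?w' x + z * (cplx x * (?w x)\<^sup>2))
        \<longlongrightarrow> cplx (2 * \<nu>) * krein_m \<nu> z * 1 + 0) (at_right 0)"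
      by (intro tendsto_add tendsto_mult bval_weyl[OF \<nu>])
    then have "(A \<longlongrightarrow> cplx (2 * \<nu>) * krein_m \<nu> z * 1 + 0) (at_right 0)"
      by (rule tendsto_at_right_cong)
        (simp only: weyl_primitive_bval[symmetric] A_def c_def, simp add: algebra_simps)
    then show "(A \<longlongrightarrow> cplx (2 * \<nu>) * krein_m \<nu> z * 1) (at_right 0)" by simp
    obtain D \<epsilon> where D: "0 \<le> D" "0 < \<epsilon>" "\<And>x. x \<ge> 1 \<Longrightarrow> cmod (?w x) \<le> D * (x * exp (- \<epsilon> * x))"
      "\<And>x. x \<ge> 1 \<Longrightarrow> cmod (?w' x) \<le> D * (x * exp (- \<epsilon> * x))"
      using weyl_decay_at_top by blast
    define a where "a = \<bar>\<nu>\<^sup>2 - 1/4\<bar>"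
    show "(A \<longlongrightarrow> 0) at_top"
    proof (rule Lim_null_comparison)
      show "((\<lambda>x. (2 + a + cmod z) * D\<^sup>2 * (x * (x * exp (- \<epsilon> * x))\<^sup>2)) \<longlongrightarrow> 0) at_top"
      proof (rule tendsto_mult_right_zero)
        show "((\<lambda>x. x * (x * exp (- \<epsilon> * x))\<^sup>2) \<longlongrightarrow> 0) at_top" using D(2) by real_asymp
      qed
      show "\<forall>\<^sub>F x in at_top. norm (A x) \<le> (2 + a + cmod z) * D\<^sup>2 * (x * (x * exp (- \<epsilon> * x))\<^sup>2)"
      proof (rule eventually_mono[OF eventually_ge_at_top[of 1]])
        fix x :: real assume x: "1 \<le> x"
        define t where "t = D * (x * exp (- \<epsilon> * x))"
        have t: "cmod (?w x) \<le> t" "cmod (?w' x) \<le> t" using D x by (auto simp: t_def)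
        have t0: "0 \<le> t" using order_trans[OF norm_ge_zero t(1)] .
        have cx: "cmod (c x) \<le> a * x"
        proof -
          have "cmod (c x) = a / x" using x
              by (simp only: c_def norm_of_real a_def abs_divide abs_of_nonneg)
          also have "\<dots> \<le> a * x" using x by (simp add: a_def divide_le_eq mult_le_cancel_left1
              power2_eq_square[symmetric] one_le_power mult.assoc)
          finally show ?thesis .
        qed
        have "norm (A x) \<le> cmod (cplx x * (?w' x)\<^sup>2) + cmod (?w x * ?w' x) + cmod
            ((c x - z * cplx x) * (?w x)\<^sup>2)"
          unfolding A_def by (intro order_trans[OF norm_triangle_ineq4] add_mono order_refl
              norm_triangle_ineq4)
        also have "\<dots> \<le> x * t\<^sup>2 + x * t\<^sup>2 + (a * x + cmod z * x) * t\<^sup>2"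
        proof (intro add_mono)
          show "cmod (cplx x * (?w' x)\<^sup>2) \<le> x * t\<^sup>2"
            using x t by (simp add: norm_mult norm_power mult_left_mono power_mono)
          have "cmod (?w x * ?w' x) \<le> 1 * (t * t)"
            using t t0 by (simp add: norm_mult mult_mono)
          also have "\<dots> \<le> x * (t * t)" using x t0 by (intro mult_right_mono) auto
          finally show "cmod (?w x * ?w' x) \<le> x * t\<^sup>2" by (simp add: power2_eq_square)
          have "cmod (c x - z * cplx x) \<le> a * x + cmod z * x"
            using norm_triangle_ineq4[of "c x" "z * cplx x"] cx x by (simp add: norm_mult)
          then show "cmod ((c x - z * cplx x) * (?w x)\<^sup>2) \<le> (a * x + cmod z * x) * t\<^sup>2"
            using t x unfolding norm_mult norm_power by (intro mult_mono power_mono) (auto simp: a_def)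
        qed
        also have "\<dots> = (2 + a + cmod z) * (x * t\<^sup>2)" by (simp add: algebra_simps)
        finally show "norm (A x) \<le> (2 + a + cmod z) * D\<^sup>2 * (x * (x * exp (- \<epsilon> * x))\<^sup>2)"
          by (simp only: t_def power_mult_distrib mult_ac)
      qed
    qed
  qed
  then have "2 * z * (LINT x|half_line. ?w x * ?w x) = - (cplx (2 * \<nu>) * krein_m \<nu> z)" by simp
  then show ?thesis using zn by (simp add: field_simps)
qed

end

lemma krein_m_nonzero:
  assumes "0 < \<nu>" "\<nu> < 1" "z \<noteq> 0"
  shows "krein_m \<nu> z \<noteq> 0"
proof -
  have "Gamma (1 - \<nu>) \<noteq> 0" "Gamma (1 + \<nu>) \<noteq> 0"
    using Gamma_real_pos[of "1 - \<nu>"] Gamma_real_pos[of "1 + \<nu>"] assms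
        by (metis add_pos_pos diff_gt_0_iff_gt less_irrefl zero_less_one)+
  then show ?thesis using assms cpow_nonzero[of z \<nu>] by (simp add: krein_m_def)
qed

lemma krein_coeff_eq: "krein_coeff \<nu> \<theta> z = cplx (cot \<theta>) + krein_m \<nu> z"
  by (simp add: krein_coeff_def krein_m_def)

section \<open>The resolvent formula\<close>

context
  fixes \<nu> \<theta> :: real and z :: complex and \<phi> \<psi> :: "real \<Rightarrow> complex"
  assumes \<nu>: "0 < \<nu>" "\<nu> < 1" and \<theta>: "0 < \<theta>" "\<theta> < pi" and bf: "boundary_functions \<nu> \<phi> \<psi>"
    and z0: "z \<in> resolvent_set (T_bc \<nu> \<phi> \<psi> 0)" and z\<theta>: "z \<in> resolvent_set (T_bc \<nu> \<phi> \<psi> \<theta>)"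
begin

lemma z_not_nonneg: "z \<notin> \<real>\<^sub>\<ge>\<^sub>0"
  by (rule resolvent_set_Friedrichs[OF \<nu> bf z0])

lemma sin_theta: "sin \<theta> > 0" "cplx (cos \<theta>) = cplx (sin \<theta>) * cplx (cot \<theta>)"
proof -
  show s: "sin \<theta> > 0" using \<theta> by (rule sin_gt_zero)
  then have "cos \<theta> = sin \<theta> * cot \<theta>" by (simp add: cot_def)
  then show "cplx (cos \<theta>) = cplx (sin \<theta>) * cplx (cot \<theta>)" by (metis of_real_mult)
qed

lemma T_bc_condition:
  "cplx (cos \<theta>) * q + cplx (sin \<theta>) * (r / cplx (2 * \<nu>)) =
    cplx (sin \<theta>) * (cplx (cot \<theta>) * q + r / cplx (2 * \<nu>))"
  unfolding sin_theta(2) by (simp only: algebra_simps)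

lemma krein_coeff_nonzero: "krein_coeff \<nu> \<theta> z \<noteq> 0"
proof
  assume k: "krein_coeff \<nu> \<theta> z = 0"
  note zn = z_not_nonneg
  have "cplx (cot \<theta>) * 1 + cplx (2 * \<nu>) * krein_m \<nu> z / cplx (2 * \<nu>) = 0"
    using k \<nu> by (simp add: krein_coeff_eq)
  then have "(abs_l2 (weyl \<nu> z), abs_l2 (\<lambda>x. z * weyl \<nu> z x)) \<in> T_bc \<nu> \<phi> \<psi> \<theta>"
    unfolding T_bc_iff[OF \<nu> bf] T_bc_condition
    using max_action_weyl(1)[OF \<nu> zn] has_bval_weyl[OF \<nu> zn] by (metis mult_zero_right)
  then have 1: "(abs_l2 (weyl \<nu> z), 0 + scaleC z (abs_l2 (weyl \<nu> z))) \<in> T_bc \<nu> \<phi> \<psi> \<theta>"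
    by (simp add: scaleC_abs_l2 square_integrable_weyl[OF \<nu> zn])
  have "has_bval \<nu> (\<lambda>x. 0) 0 0"
    by (rule has_bvalI[where f' = "\<lambda>x. 0"]) (simp_all add: wronskian_def[abs_def])
  then have "(abs_l2 (\<lambda>x. 0), abs_l2 (\<lambda>x. 0)) \<in> T_bc \<nu> \<phi> \<psi> \<theta>"
    unfolding T_bc_iff[OF \<nu> bf]
    by (intro exI[of _ "\<lambda>x. 0"] exI[of _ 0]) (simp add: max_action_zero)
  then have "(0, 0 + scaleC z 0) \<in> T_bc \<nu> \<phi> \<psi> \<theta>"
    using scaleC_scaleC[of z 0 0] by (simp add: scaleC_zero_left zero_l2_def[symmetric])
  with 1 z\<theta> have "abs_l2 (weyl \<nu> z) = 0"
    unfolding resolvent_set_def by blast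
  then have "AE x in half_line. weyl \<nu> z x = 0"
    using abs_l2_eq_iff[OF square_integrable_weyl[OF \<nu> zn] square_integrable_zero]
        by (simp add: zero_l2_def)
  then have "(LINT x|half_line. weyl \<nu> z x * weyl \<nu> z x) = 0"
    by (intro integral_eq_zero_AE) (auto elim: eventually_mono)
  then show False
    using integral_weyl_square[OF \<nu> zn] krein_m_nonzero[OF \<nu>, of z] Arg2pi_pos(3)[OF zn] \<nu> by simp
qed

lemma krein_resolvent_formula:
  "resolvent (T_bc \<nu> \<phi> \<psi> \<theta>) z f = resolvent (T_bc \<nu> \<phi> \<psi> 0) z f +
    scaleC (inverse (krein_coeff \<nu> \<theta> z) * cinner (abs_l2 (\<lambda>x. cnj (weyl \<nu> z x))) f) (abs_l2 (weyl \<nu> z))"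
proof -
  note zn = z_not_nonneg
  let ?w = "weyl \<nu> z"
  note sqw = square_integrable_weyl[OF \<nu> zn]
  define u where "u = resolvent (T_bc \<nu> \<phi> \<psi> 0) z f"
  have "\<exists>!u. (u, f + scaleC z u) \<in> T_bc \<nu> \<phi> \<psi> 0"
    using z0 by (simp add: resolvent_set_def)
  then have "(u, f + scaleC z u) \<in> T_bc \<nu> \<phi> \<psi> 0"
    unfolding u_def resolvent_def by (rule theI')
  then obtain g h r q where g: "u = abs_l2 g" "f + scaleC z u = abs_l2 h" "max_action \<nu> g h"
      "has_bval \<nu> g r q" "q = 0"
    unfolding T_bc_iff[OF \<nu> bf] by auto
  have sq: "square_integrable g" "square_integrable h" using g(3) by (auto simp: max_action_def)
  define \<alpha> where "\<alpha> = cinner (abs_l2 (\<lambda>x. cnj (?w x))) f"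
  have "f = abs_l2 h - scaleC z (abs_l2 g)" using g(1,2) by (simp add: algebra_simps)
  then have f: "f = abs_l2 (\<lambda>x. h x - z * g x)"
    by (simp add: scaleC_abs_l2 minus_abs_l2 sq square_integrable_scale)
  have "\<alpha> = (LINT x|half_line. ?w x * h x - z * (?w x * g x))"
    unfolding \<alpha>_def f
    by (subst cinner_abs_l2) (auto intro!: square_integrable_cnj square_integrable_diff
        square_integrable_scale sq sqw
        Bochner_Integration.integral_cong simp: algebra_simps)
  then have \<alpha>: "\<alpha> = - (r / cplx (2 * \<nu>))"
    using green_weyl[OF \<nu> zn g(3,4)] g(5) by simp
  define c where "c = inverse (krein_coeff \<nu> \<theta> z) * \<alpha>"
  have ck: "c * krein_coeff \<nu> \<theta> z = \<alpha>" using krein_coeff_nonzero by (simp add: c_def)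
  note act = max_action_lincomb(1)[OF g(3) max_action_weyl(1)[OF \<nu> zn], of c]
  note bv = has_bval_lincomb[OF g(3) max_action_weyl(1)[OF \<nu> zn] g(4) has_bval_weyl[OF \<nu> zn], of c]
  have "cplx (cot \<theta>) * (q + c * 1) + (r + c * (cplx (2 * \<nu>) * krein_m \<nu> z)) / cplx (2 * \<nu>)
      = c * krein_coeff \<nu> \<theta> z + r / cplx (2 * \<nu>)"
    using \<nu> g(5) by (simp add: krein_coeff_eq field_simps)
  also have "\<dots> = 0" unfolding ck \<alpha> by simp
  finally have cond: "cplx (cot \<theta>) * (q + c * 1) +
      (r + c * (cplx (2 * \<nu>) * krein_m \<nu> z)) / cplx (2 * \<nu>) = 0" .
  have "(abs_l2 (\<lambda>x. g x + c * ?w x), abs_l2 (\<lambda>x. h x + c * (z * ?w x))) \<in> T_bc \<nu> \<phi> \<psi> \<theta>"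
    unfolding T_bc_iff[OF \<nu> bf] T_bc_condition
    by (rule exI[of _ "\<lambda>x. g x + c * ?w x"], rule exI[of _ "\<lambda>x. h x + c * (z * ?w x)"],
        rule exI[of _ "r + c * (cplx (2 * \<nu>) * krein_m \<nu> z)"], rule exI[of _ "q + c * 1"],
        intro conjI refl act bv, simp only: cond mult_zero_right)
  moreover have "abs_l2 (\<lambda>x. g x + c * ?w x) = u + scaleC c (abs_l2 ?w)"
    by (simp add: g(1) plus_abs_l2 scaleC_abs_l2 sq sqw square_integrable_scale)
  moreover have "abs_l2 (\<lambda>x. h x + c * (z * ?w x)) = f + scaleC z (u + scaleC c (abs_l2 ?w))"
  proof -
    have "abs_l2 (\<lambda>x. h x + c * (z * ?w x)) = (f + scaleC z u) + scaleC c (scaleC z (abs_l2 ?w))"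
      by (simp add: g(2) plus_abs_l2 scaleC_abs_l2 sq sqw square_integrable_scale)
    then show ?thesis by (simp add: scaleC_add_right scaleC_scaleC mult.commute add.assoc)
  qed
  ultimately have "resolvent (T_bc \<nu> \<phi> \<psi> \<theta>) z f = u + scaleC c (abs_l2 ?w)"
    by (intro resolvent_eqI[OF z\<theta>]) simp
  then show ?thesis by (simp add: u_def c_def \<alpha>_def)
qed

end

theorem proposition5p1:
  fixes \<nu> \<theta> :: real and z :: complex and \<phi> \<psi> :: "real \<Rightarrow> complex"
  assumes "\<nu> \<in> {0<..<1}"
    and "\<theta> \<in> {0<..<pi}"
    and "boundary_functions \<nu> \<phi> \<psi>"
    and "z \<in> resolvent_set (T_bc \<nu> \<phi> \<psi> 0) \<inter> resolvent_set (T_bc \<nu> \<phi> \<psi> \<theta>)"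
  defines "D \<equiv> (\<lambda>f. resolvent (T_bc \<nu> \<phi> \<psi> \<theta>) z f - resolvent (T_bc \<nu> \<phi> \<psi> 0) z f)"
    and "w \<equiv> abs_l2 (w_fun \<nu> z)"
    and "w_bar \<equiv> abs_l2 (w_fun \<nu> (cnj z))"
    and "k \<equiv> krein_coeff \<nu> \<theta> z"
  shows "square_integrable (w_fun \<nu> z) \<and> square_integrable (w_fun \<nu> (cnj z)) \<and> k \<noteq> 0
    \<and> (\<forall>f. D f = scaleC (inverse k * cinner w_bar f) w)
    \<and> trace_class D
    \<and> op_trace D = inverse k * cinner w_bar w
    \<and> inverse k * cinner w_bar w =
        - (complex_of_real (Gamma (1 - \<nu>) * \<nu>) * exp (- \<i> * complex_of_real (\<nu> * pi)) *
             cpow z (\<nu> - 1)) /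
          (complex_of_real (Gamma (1 + \<nu>) * 2 powr (2 * \<nu> + 1) * \<nu> * cot \<theta>) +
           complex_of_real (Gamma (1 - \<nu>)) * exp (- \<i> * complex_of_real (\<nu> * pi)) * cpow z \<nu>)"
proof -
  have \<nu>: "0 < \<nu>" "\<nu> < 1" and \<theta>: "0 < \<theta>" "\<theta> < pi" using assms(1,2) by auto
  have z0: "z \<in> resolvent_set (T_bc \<nu> \<phi> \<psi> 0)" and z\<theta>: "z \<in> resolvent_set (T_bc \<nu> \<phi> \<psi> \<theta>)"
    using assms(4) by auto
  have zn: "z \<notin> \<real>\<^sub>\<ge>\<^sub>0" by (rule z_not_nonneg[OF \<nu> \<theta> assms(3) z0 z\<theta>])
  then have zcn: "cnj z \<notin> \<real>\<^sub>\<ge>\<^sub>0" by (simp add: complex_nonneg_Reals_iff)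
  note sqw = square_integrable_weyl[OF \<nu> zn]
  have wz: "w_fun \<nu> z x = weyl \<nu> z x" "w_fun \<nu> (cnj z) x = cnj (weyl \<nu> z x)" if "0 < x" for x
    using w_fun_eq_weyl[OF \<nu> zn that] w_fun_eq_weyl[OF \<nu> zcn that] weyl_cnj[OF zn] by auto
  note cong = square_integrable_half_line_cong[OF wz(1) sqw]
      square_integrable_half_line_cong[OF wz(2) square_integrable_cnj[OF sqw]]
  have w: "w = abs_l2 (weyl \<nu> z)" "w_bar = abs_l2 (\<lambda>x. cnj (weyl \<nu> z x))"
    unfolding w_def w_bar_def using cong by auto
  have k: "k \<noteq> 0" unfolding k_def by (rule krein_coeff_nonzero[OF \<nu> \<theta> assms(3) z0 z\<theta>])
  have D: "D = rank_one (inverse k) w_bar w"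
    unfolding D_def rank_one_def[abs_def] w k_def
    using krein_resolvent_formula[OF \<nu> \<theta> assms(3) z0 z\<theta>] by (auto simp: fun_eq_iff)
  define a where "a = Gamma (1 + \<nu>) * 2 powr (2 * \<nu> + 1) * \<nu>"
  define b where "b = cplx (Gamma (1 - \<nu>)) * exp (- \<i> * cplx (\<nu> * pi))"
  have "0 < 1 + \<nu>" using \<nu> by simp
  then have "Gamma (1 + \<nu>) \<noteq> 0" using Gamma_real_pos by (metis less_irrefl)
  then have a: "a \<noteq> 0" using \<nu> by (simp add: a_def)
  have m: "krein_m \<nu> z = b * cpow z \<nu> / cplx a" by (simp add: krein_m_def a_def b_def)
  have z1: "z \<noteq> 0" using Arg2pi_pos(3)[OF zn] .
  have cz: "cpow z \<nu> = cpow z (\<nu> - 1) * z"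
    using cpow_add[OF z1, of "\<nu> - 1" 1] cpow_one[OF z1] by simp
  have "cinner w_bar w = (LINT x|half_line. weyl \<nu> z x * weyl \<nu> z x)"
    unfolding w using sqw by (simp add: cinner_abs_l2 square_integrable_cnj)
  also have "\<dots> = - (cplx \<nu> * krein_m \<nu> z / z)" by (rule integral_weyl_square[OF \<nu> zn])
  also have "\<dots> = - (cplx \<nu> * b * cpow z (\<nu> - 1)) / cplx a"
    unfolding m cz using z1 by simp
  finally have c: "cinner w_bar w = - (cplx \<nu> * b * cpow z (\<nu> - 1)) / cplx a" .
  have "cplx a * k = cplx (a * cot \<theta>) + b * cpow z \<nu>"
    unfolding k_def krein_coeff_eq m using a by (simp add: algebra_simps)
  then have "inverse k * cinner w_bar w = - (cplx \<nu> * b * cpow z (\<nu> - 1)) /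
      (cplx (a * cot \<theta>) + b * cpow z \<nu>)"
    unfolding c by (metis divide_divide_eq_left divide_inverse mult.commute)
  then have final: "inverse k * cinner w_bar w = -
      (cplx (Gamma (1 - \<nu>) * \<nu>) * exp (- \<i> * cplx (\<nu> * pi)) *
             cpow z (\<nu> - 1)) /
          (cplx (Gamma (1 + \<nu>) * 2 powr (2 * \<nu> + 1) * \<nu> * cot \<theta>) +
           cplx (Gamma (1 - \<nu>)) * exp (- \<i> * cplx (\<nu> * pi)) * cpow z \<nu>)"
    unfolding a_def b_def by (simp only: of_real_mult mult_ac)
  show ?thesis
    using cong(1,3) k final trace_class_rank_one[of "inverse k" w_bar w]
        op_trace_rank_one[of "inverse k" w_bar w]
    unfolding D by (auto simp: rank_one_def)
qed

end
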